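(* Let $A$ be a commutative real unital algebra which carries a nuclear barrelled locally convex topology such that $A$ is a topological algebra. Let $L$ be a continuous linear functional on $A$ satisfying one of the following assumptions: (i) $L$ is $A_+$-positive, that is, $L(a)\geq 0$ for all $a\in A_+$; (ii) $L$ is positive, that is, $L(a^2)\geq 0$ for all $a\in A$, and Carleman's condition $\sum_{n=1}^\infty L(t^{2n})^{-\frac{1}{2n}}=+\infty$ holds for all $t$ of some vector space basis of $A$. Then there exists a ($\sigma$-additive) measure $\mu$ on the $\sigma$-algebra $\mathcal{B}(\hat{A})$ such that $$L(a)=\int_{\hat{A}} a(\chi)\,d\mu(\chi)\quad\text{for all } a\in A.$$
   Context: $\hat{A}$ is the set of characters of $A$, i.e. algebra homomorphisms $\chi:A\to\mathbb{R}$ with $\chi(1)=1$; for $a\in A$ write $a(\chi):=\chi(a)$. $A_+:=\{f\in A: f(\chi)\geq 0\text{ for all }\chi\in\hat{A}\}$. $\mathcal{B}(\hat{A})$ is the $\sigma$-algebra on $\hat{A}$ generated by the cylinder sets, i.e. by the evaluation functions $\chi\mapsto\chi(a)$, $a\in A$. A real algebra equipped with a locally convex topology is called a topological algebra if for each element $b$ the maps $c\mapsto bc$ and $c\mapsto cb$ are continuous. A locally convex space is barrelled if each absolutely convex closed absorbing subset is a zero neighbourhood. Locally convex topologies are assumed Hausdorff. In Carleman's condition a term with $L(t^{2n})=0$ is read as $+\infty$. *)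

theory Defs
  imports "HOL-Analysis.Analysis"
begin

section \<open>Locally convex topologies\<close>

definition locally_convex_topology :: "'a::real_vector topology \<Rightarrow> bool" where
  "locally_convex_topology T \<longleftrightarrow>
     topspace T = UNIV \<and>
     Hausdorff_space T \<and>
     continuous_map (prod_topology T T) T (\<lambda>(x, y). x + y) \<and>
     continuous_map (prod_topology euclideanreal T) T (\<lambda>(c, x). c *\<^sub>R x) \<and>
     (\<forall>U. openin T U \<and> 0 \<in> U \<longrightarrow> (\<exists>V. openin T V \<and> 0 \<in> V \<and> convex V \<and> V \<subseteq> U))"

definition absolutely_convex :: "'a::real_vector set \<Rightarrow> bool" where
  "absolutely_convex B \<longleftrightarrow> convex B \<and> (\<forall>x\<in>B. \<forall>c. \<bar>c\<bar> \<le> 1 \<longrightarrow> c *\<^sub>R x \<in> B)"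

definition absorbing :: "'a::real_vector set \<Rightarrow> bool" where
  "absorbing B \<longleftrightarrow> (\<forall>x. \<exists>r>0. \<forall>c. \<bar>c\<bar> \<le> r \<longrightarrow> c *\<^sub>R x \<in> B)"

definition barrelled :: "'a::real_vector topology \<Rightarrow> bool" where
  "barrelled T \<longleftrightarrow>
     (\<forall>B. absolutely_convex B \<and> closedin T B \<and> absorbing B
        \<longrightarrow> (\<exists>U. openin T U \<and> 0 \<in> U \<and> U \<subseteq> B))"

section \<open>Nuclear spaces\<close>

definition seminorm :: "('a::real_vector \<Rightarrow> real) \<Rightarrow> bool" where
  "seminorm p \<longleftrightarrow> (\<forall>x y. p (x + y) \<le> p x + p y) \<and> (\<forall>c x. p (c *\<^sub>R x) = \<bar>c\<bar> * p x)"

text \<open>The dual of the seminormed space \<open>(E, q)\<close>, equivalently of the completion of \<open>E / ker q\<close>,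
  with its dual norm.\<close>

definition dual_space :: "('a::real_vector \<Rightarrow> real) \<Rightarrow> ('a \<Rightarrow> real) set" where
  "dual_space q = {f. linear f \<and> (\<exists>C. \<forall>x. \<bar>f x\<bar> \<le> C * q x)}"

definition dual_norm :: "('a::real_vector \<Rightarrow> real) \<Rightarrow> ('a \<Rightarrow> real) \<Rightarrow> real" where
  "dual_norm q f = (SUP x\<in>{x. q x \<le> 1}. \<bar>f x\<bar>)"

text \<open>The Banach space \<open>E\<^sub>p\<close>, the completion of \<open>E / ker p\<close>, is represented by the \<open>p\<close>-Cauchy
  sequences of \<open>E\<close>. Two sequences represent the same element iff the completion norm of their
  difference vanishes; \<open>x \<in> E\<close> is represented by the constant sequence.\<close>

definition completion :: "('a::real_vector \<Rightarrow> real) \<Rightarrow> (nat \<Rightarrow> 'a) set" where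
  "completion p = {s. \<forall>e>0. \<exists>N. \<forall>m\<ge>N. \<forall>n\<ge>N. p (s m - s n) < e}"

definition completion_norm :: "('a::real_vector \<Rightarrow> real) \<Rightarrow> (nat \<Rightarrow> 'a) \<Rightarrow> real" where
  "completion_norm p s = lim (\<lambda>k. p (s k))"

text \<open>For \<open>p \<le> q\<close>, the canonical map \<open>E\<^sub>q \<rightarrow> E\<^sub>p\<close> is nuclear if it has the form \<open>\<Sum>n. f\<^sub>n(\<cdot>) y\<^sub>n\<close> with
  \<open>f\<^sub>n \<in> (E\<^sub>q)'\<close>, \<open>y\<^sub>n \<in> E\<^sub>p\<close> and \<open>\<Sum>n. \<parallel>f\<^sub>n\<parallel> \<parallel>y\<^sub>n\<parallel> < \<infinity>\<close>. Both sides being continuous on \<open>E\<^sub>q\<close>, the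
  identity is stated on the dense image of \<open>E\<close>.\<close>

definition nuclear_canonical_map ::
    "('a::real_vector \<Rightarrow> real) \<Rightarrow> ('a \<Rightarrow> real) \<Rightarrow> bool" where
  "nuclear_canonical_map q p \<longleftrightarrow>
     (\<exists>f y. (\<forall>n. f n \<in> dual_space q) \<and> (\<forall>n. y n \<in> completion p) \<and>
        summable (\<lambda>n. dual_norm q (f n) * completion_norm p (y n)) \<and>
        (\<forall>x. (\<lambda>N. completion_norm p (\<lambda>k. x - (\<Sum>n<N. f n x *\<^sub>R y n k))) \<longlonglongrightarrow> 0))"

definition nuclear :: "'a::real_vector topology \<Rightarrow> bool" where
  "nuclear T \<longleftrightarrow>
     (\<forall>p. seminorm p \<and> continuous_map T euclideanreal p \<longrightarrow>
        (\<exists>q. seminorm q \<and> continuous_map T euclideanreal q \<and> (\<forall>x. p x \<le> q x) \<and>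
           nuclear_canonical_map q p))"

section \<open>Algebras, characters and positivity\<close>

definition separately_continuous_mult :: "'a::real_algebra topology \<Rightarrow> bool" where
  "separately_continuous_mult T \<longleftrightarrow>
     (\<forall>b. continuous_map T T (\<lambda>c. b * c) \<and> continuous_map T T (\<lambda>c. c * b))"

text \<open>The sort \<open>{real_algebra, comm_monoid_mult}\<close> is that of commutative unital real algebras.
  Unlike \<open>real_algebra_1\<close> it does not exclude the zero algebra.\<close>

definition characters :: "('a::{real_algebra, comm_monoid_mult} \<Rightarrow> real) set" where
  "characters = {\<phi>. linear \<phi> \<and> (\<forall>a b. \<phi> (a * b) = \<phi> a * \<phi> b) \<and> \<phi> 1 = 1}"

definition pos_cone :: "'a::{real_algebra, comm_monoid_mult} set" where
  "pos_cone = {a. \<forall>\<phi>\<in>characters. \<phi> a \<ge> 0}"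

definition character_sigma :: "('a::{real_algebra, comm_monoid_mult} \<Rightarrow> real) measure" where
  "character_sigma = sigma characters {(\<lambda>\<phi>. \<phi> a) -` S \<inter> characters | a S. S \<in> sets borel}"

definition carleman :: "('a::{real_algebra, comm_monoid_mult} \<Rightarrow> real) \<Rightarrow> 'a \<Rightarrow> bool" where
  "carleman L t \<longleftrightarrow>
     (\<Sum>k. let n = Suc k in
        if L (t ^ (2 * n)) = 0 then \<infinity>
        else ennreal (L (t ^ (2 * n)) powr (- 1 / (2 * real n)))) = \<infinity>"

end

theory Submission
  imports Defs
begin

text \<open>
  Either hypothesis makes \<open>L\<close> nonnegative on every element \<open>p(a\<^sub>1, \<dots>, a\<^sub>n)\<close> with \<open>p\<close> a polynomial that is
  nonnegative on \<open>\<real>\<^sup>n\<close>. Under (i) this is immediate. Under (ii) Carleman's condition forces the norms of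
  the orthonormal polynomials at \<open>\<i>\<close> to diverge (Christoffel-Darboux and Carleman's inequality), so
  \<open>(1 + t\<^sup>2)A\<close> is dense for all the functionals \<open>L(b\<^sup>2 \<cdot>)\<close>; this permits division by powers of
  \<open>1 + t\<^sup>2\<close>, and the positive kernels \<open>(cos \<phi> + t sin \<phi>)\<^bsup>2N\<^esup> / (1 + t\<^sup>2)\<^bsup>N\<^esup>\<close> then replace the variables
  \<open>t\<close> by real numbers one at a time.

  Such an \<open>L\<close> extends by Hahn-Banach to all polynomially bounded functions on \<open>\<real>\<^bsup>A\<^esup>\<close>, which gives a finitely
  additive content on all subsets. Barrelledness makes \<open>a \<mapsto> L(a\<^sup>2)\<^bsup>1/2\<^esup>\<close> a continuous seminorm, and
  nuclearity bounds all coordinates \<open>x a\<close> simultaneously outside a set of small content. The content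
  therefore becomes a measure on a set of ultrafilters along which every coordinate converges, and the
  limits along such an ultrafilter form a character.
\<close>

section \<open>Positive functionals and sums of squares\<close>

text \<open>In several variables a nonnegative polynomial need not be a sum of squares, so under
  (ii) positivity on squares does not suffice, and Carleman's condition has to supply a substitute
  for dividing by \<open>1 + t * t\<close>. It is given only for \<open>L\<close> and only on a
  basis, whereas the induction over the variables turns \<open>L\<close> into
  \<open>L (b * b * x)\<close>. The density statement therefore carries a weight \<open>b\<close>
  from the start, and elements outside the basis enter through their finite expansions. The points
  of the function space are arbitrary functions on the algebra, with no linearity or
  multiplicativity built in. A polynomial that represents 0 in the algebra exceeds any positive
  level only on a set of content zero, and the ultrafilters are chosen to avoid such sets; this is
  what makes the limits characters. A content on all subsets raises no measurability question on the
  uncountable product; sigma-additivity is recovered from compactness on the side of the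
  ultrafilters. Since \<open>L (a * a)\<close> is finite, tails of a coordinate can be estimated and
  unbounded coordinates can be integrated by truncation.\<close>

inductive_set sos :: "'a::{real_algebra, comm_monoid_mult} set" where
  sq: "x * x \<in> sos"
| add: "x \<in> sos \<Longrightarrow> y \<in> sos \<Longrightarrow> x + y \<in> sos"

lemma sos_mult_square:
  assumes "y \<in> sos"
  shows "x * x * y \<in> sos"
  using assms
proof induction
  case (sq y)
  have "x * x * (y * y) = (x * y) * (x * y)" by (simp add: ac_simps)
  then show ?case by (metis sos.sq)
next
  case (add y z)
  then show ?case by (simp add: distrib_left sos.add)
qed

lemma sos_mult:
  assumes "x \<in> sos" "y \<in> sos"
  shows "x * y \<in> sos"
  using assms
proof induction
  case (sq x)
  then show ?case by (rule sos_mult_square)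
next
  case (add x z)
  then show ?case by (simp add: distrib_right sos.add)
qed

locale positive_functional =
  fixes L :: "'a::{real_algebra, comm_monoid_mult} \<Rightarrow> real"
  assumes linear: "linear L"
    and square_nonneg: "L (a * a) \<ge> 0"
begin

lemmas L_simps = linear_add[OF linear] linear_diff[OF linear] linear_scale[OF linear]
  linear_0[OF linear] linear_neg[OF linear]

lemma sos_nonneg: "x \<in> sos \<Longrightarrow> L x \<ge> 0"
  by (induction rule: sos.induct) (auto simp: L_simps square_nonneg)

text \<open>Sums of squares are closed under products, so weighting by one keeps positivity. All
  later changes of functional are of this kind: \<open>L (b * b * x)\<close> in the induction over
  variables, \<open>L (v * x)\<close> in Carleman's argument.\<close>

lemma shift:
  assumes "x \<in> sos"
  shows "positive_functional (\<lambda>y. L (x * y))"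
proof (rule positive_functional.intro)
  show "linear (\<lambda>y. L (x * y))"
    by (rule linearI) (simp_all add: L_simps distrib_left)
  show "0 \<le> L (x * (a * a))" for a
    using assms by (intro sos_nonneg sos_mult sos.sq)
qed

lemma one_nonneg: "L 1 \<ge> 0"
  using square_nonneg[of 1] by simp

lemma cauchy_schwarz: "(L (a * b))\<^sup>2 \<le> L (a * a) * L (b * b)"
proof -
  have ineq: "0 \<le> L (a * a) + 2 * r * L (a * b) + r\<^sup>2 * L (b * b)" for r
  proof -
    have "0 \<le> L ((a + r *\<^sub>R b) * (a + r *\<^sub>R b))" by (rule square_nonneg)
    then show ?thesis
      by (simp add: algebra_simps L_simps power2_eq_square mult.commute[of b a])
  qed
  show ?thesis
  proof (cases "L (b * b) = 0")
    case False
    then have pos: "L (b * b) > 0" using square_nonneg[of b] by simp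
    have "0 \<le> L (a * a) - (L (a * b))\<^sup>2 / L (b * b)"
      using ineq[of "- L (a * b) / L (b * b)"] pos
      by (simp add: power2_eq_square field_simps)
    then show ?thesis using pos by (simp add: field_simps)
  next
    case True
    have "L (a * b) = 0"
    proof (rule ccontr)
      assume "L (a * b) \<noteq> 0"
      \<comment> \<open>At this value of \<open>r\<close> the quadratic inequality reads
        \<open>0 \<le> - 1\<close>.\<close>
      then show False
        using ineq[of "- (L (a * a) + 1) / (2 * L (a * b))"] True square_nonneg[of a]
        by (simp add: field_simps)
    qed
    then show ?thesis using True by simp
  qed
qed

lemma abs_le_sqrt: "\<bar>L (a * b)\<bar> \<le> sqrt (L (a * a)) * sqrt (L (b * b))"
proof -
  have "sqrt ((L (a * b))\<^sup>2) \<le> sqrt (L (a * a) * L (b * b))"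
    using cauchy_schwarz by (rule real_sqrt_le_mono)
  then show ?thesis by (simp add: real_sqrt_mult)
qed

lemma add_square_le: "L ((x + y) * (x + y)) \<le> 2 * L (x * x) + 2 * L (y * y)"
proof -
  have "0 \<le> L ((x - y) * (x - y))" by (rule square_nonneg)
  then show ?thesis by (simp add: algebra_simps L_simps)
qed

end

section \<open>Substituting real numbers for a variable\<close>

lemma scaleR_power': "(c *\<^sub>R x) ^ n = c ^ n *\<^sub>R x ^ n" for x :: "'a::{real_algebra, comm_monoid_mult}"
  by (induction n) simp_all

text \<open>Substitute for an inverse of \<open>1 + t * t\<close>. The weight \<open>b\<close> is
  quantified so that an approximation error may afterwards be multiplied by any fixed element of the
  algebra.\<close>

definition resolvent_dense :: "('a::{real_algebra, comm_monoid_mult} \<Rightarrow> real) \<Rightarrow> 'a \<Rightarrow> bool" where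
  "resolvent_dense L t \<longleftrightarrow> (\<forall>b x. \<forall>\<delta>>0. \<exists>k.
     L ((b * (x - (1 + t * t) * k)) * (b * (x - (1 + t * t) * k))) < \<delta>)"

context positive_functional
begin

text \<open>If \<open>g = w + r\<close> with \<open>w\<close> a multiple of
  \<open>1 + t * t\<close>, then \<open>v * (g * g)\<close> and \<open>v * (w * w)\<close> differ
  only by \<open>(v * r) * g\<close> and \<open>(v * r) * r\<close> terms, which Cauchy-Schwarz
  makes small.\<close>

lemma nonneg_of_dense_multiples:
  assumes dense: "resolvent_dense L t"
    and nonneg: "\<And>k. L (v * (((1 + t * t) * k) * ((1 + t * t) * k))) \<ge> 0"
  shows "L (v * (g * g)) \<ge> 0"
proof -
  \<comment> \<open>The square of \<open>b * r\<close> is \<open>r * r\<close> plus further squares,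
    among them that of \<open>v * r\<close>; one approximation with this weight thus makes both
    \<open>r\<close> and \<open>v * r\<close> small.\<close>
  define b where "b = 1 + v * v"
  have bound: "- (2 * \<delta> * sqrt (L (g * g)) + \<delta>\<^sup>2) \<le> L (v * (g * g))" if "\<delta> > 0" for \<delta>
  proof -
    have "\<delta>\<^sup>2 > 0" using that by simp
    then obtain k where k: "L ((b * (g - (1 + t * t) * k)) * (b * (g - (1 + t * t) * k))) < \<delta>\<^sup>2"
      using dense unfolding resolvent_dense_def by blast
    define w where "w = (1 + t * t) * k"
    define r where "r = g - w"
    have br: "L ((b * r) * (b * r)) < \<delta>\<^sup>2" using k by (simp add: r_def w_def)
    have eq: "(b * r) * (b * r) = r * r + (v * r) * (v * r) + (v * r) * (v * r) + (v * v * r) * (v * v * r)"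
      by (simp add: b_def algebra_simps)
    have "L (r * r) < \<delta>\<^sup>2" "L ((v * r) * (v * r)) < \<delta>\<^sup>2"
      using br square_nonneg[of r] square_nonneg[of "v * r"] square_nonneg[of "v * v * r"]
      unfolding eq L_simps by linarith+
    then have r: "sqrt (L (r * r)) \<le> \<delta>" and vr: "sqrt (L ((v * r) * (v * r))) \<le> \<delta>"
      using that real_sqrt_le_mono[of _ "\<delta>\<^sup>2"] by fastforce+
    have "\<bar>L ((v * r) * g)\<bar> \<le> \<delta> * sqrt (L (g * g))"
      by (rule order_trans[OF abs_le_sqrt mult_right_mono[OF vr]]) (simp add: square_nonneg)
    moreover have "\<bar>L ((v * r) * r)\<bar> \<le> \<delta> * \<delta>"
      by (rule order_trans[OF abs_le_sqrt mult_mono[OF vr r]])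
        (use that in \<open>simp_all add: square_nonneg\<close>)
    moreover have "v * (g * g) = v * (w * w) + (v * r) * g + (v * r) * g - (v * r) * r"
      by (simp add: r_def algebra_simps)
    moreover have "L (v * (w * w)) \<ge> 0" using nonneg[of k] by (simp add: w_def)
    ultimately show ?thesis by (simp only: L_simps power2_eq_square)
  qed
  have "((\<lambda>\<delta>. - (2 * \<delta> * sqrt (L (g * g)) + \<delta>\<^sup>2)) \<longlongrightarrow> - (2 * 0 * sqrt (L (g * g)) + 0\<^sup>2)) (at_right 0)"
    by (intro tendsto_intros)
  then have "- (2 * 0 * sqrt (L (g * g)) + 0\<^sup>2) \<le> L (v * (g * g))"
    by (rule tendsto_upperbound[OF _ eventually_mono[OF eventually_at_right_less[of 0] bound]]) auto
  then show ?thesis by simp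
qed

text \<open>The induction hypothesis removes \<open>m\<close> factors while the last one is kept
  inside \<open>v\<close>, squared; the previous lemma then removes it.\<close>

lemma nonneg_of_dense_power_multiples:
  assumes dense: "resolvent_dense L t"
    and nonneg: "\<And>k. L (v * (((1 + t * t) ^ m * k) * ((1 + t * t) ^ m * k))) \<ge> 0"
  shows "L (v * (g * g)) \<ge> 0"
  using nonneg
proof (induction m arbitrary: v g)
  case (Suc m)
  let ?W = "1 + t * t"
  have "L (v * ((?W * k) * (?W * k))) \<ge> 0" for k
  proof -
    have "L ((v * ?W * ?W) * (k * k)) \<ge> 0"
      by (rule Suc.IH) (use Suc.prems in \<open>simp add: ac_simps\<close>)
    then show ?thesis by (simp add: ac_simps)
  qed
  then show ?case by (rule nonneg_of_dense_multiples[OF dense])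
qed simp

end

text \<open>Boundedness expressed by the order: the inequality survives multiplication by any sum of
  squares and application of any positive functional, and \<open>Y\<close> does not depend on the
  angle.\<close>

definition bounded_family :: "('b \<Rightarrow> 'a::{real_algebra, comm_monoid_mult}) \<Rightarrow> bool" where
  "bounded_family F \<longleftrightarrow> (\<exists>Y. \<forall>\<phi>. Y - F \<phi> * F \<phi> \<in> sos)"

lemma bounded_family_const: "bounded_family (\<lambda>_. x)"
  unfolding bounded_family_def using sos.sq[of 0] by (intro exI[of _ "x * x"]) simp

lemma bounded_family_add:
  assumes "bounded_family F" "bounded_family G"
  shows "bounded_family (\<lambda>\<phi>. F \<phi> + G \<phi>)"
proof -
  obtain Y Z where Y: "\<And>\<phi>. Y - F \<phi> * F \<phi> \<in> sos" and Z: "\<And>\<phi>. Z - G \<phi> * G \<phi> \<in> sos"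
    using assms unfolding bounded_family_def by blast
  have "(Y + Y + Z + Z) - (F \<phi> + G \<phi>) * (F \<phi> + G \<phi>)
      = (Y - F \<phi> * F \<phi>) + (Y - F \<phi> * F \<phi>) + (Z - G \<phi> * G \<phi>) + (Z - G \<phi> * G \<phi>)
        + (F \<phi> - G \<phi>) * (F \<phi> - G \<phi>)" for \<phi>
    by (simp add: algebra_simps)
  moreover have "(Y - F \<phi> * F \<phi>) + (Y - F \<phi> * F \<phi>) + (Z - G \<phi> * G \<phi>) + (Z - G \<phi> * G \<phi>)
        + (F \<phi> - G \<phi>) * (F \<phi> - G \<phi>) \<in> sos" for \<phi>
    by (intro sos.intros Y Z)
  ultimately have "(Y + Y + Z + Z) - (F \<phi> + G \<phi>) * (F \<phi> + G \<phi>) \<in> sos" for \<phi> by metis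
  then show ?thesis unfolding bounded_family_def by blast
qed

lemma bounded_family_mult:
  assumes "bounded_family F" "bounded_family G"
  shows "bounded_family (\<lambda>\<phi>. F \<phi> * G \<phi>)"
proof -
  obtain Y Z where Y: "\<And>\<phi>. Y - F \<phi> * F \<phi> \<in> sos" and Z: "\<And>\<phi>. Z - G \<phi> * G \<phi> \<in> sos"
    using assms unfolding bounded_family_def by blast
  have "Y * Z - (F \<phi> * G \<phi>) * (F \<phi> * G \<phi>)
      = ((Y - F \<phi> * F \<phi>) + F \<phi> * F \<phi>) * (Z - G \<phi> * G \<phi>) + (Y - F \<phi> * F \<phi>) * (G \<phi> * G \<phi>)" for \<phi>
    by (simp add: algebra_simps)
  moreover have "((Y - F \<phi> * F \<phi>) + F \<phi> * F \<phi>) * (Z - G \<phi> * G \<phi>)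
      + (Y - F \<phi> * F \<phi>) * (G \<phi> * G \<phi>) \<in> sos" for \<phi>
    by (rule sos.add[OF sos_mult[OF sos.add[OF Y sos.sq] Z] sos_mult[OF Y sos.sq]])
  ultimately have "Y * Z - (F \<phi> * G \<phi>) * (F \<phi> * G \<phi>) \<in> sos" for \<phi> by metis
  then show ?thesis unfolding bounded_family_def by blast
qed

lemma bounded_family_power: "bounded_family F \<Longrightarrow> bounded_family (\<lambda>\<phi>. F \<phi> ^ n)"
  by (induction n) (simp_all add: bounded_family_const bounded_family_mult)

text \<open>\<open>e \<phi> = cos \<phi> + t sin \<phi>\<close> is \<open>\<surd>(1 + t\<^sup>2)\<close> times the cosine of the angle between the directions
  \<open>(1, t)\<close> and \<open>(cos \<phi>, sin \<phi>)\<close>; for large \<open>N\<close> the weight \<open>e \<phi> ^ (2 * N)\<close> concentrates where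
  \<open>tan \<phi> = t\<close>. Up to sign, \<open>f \<phi>\<close> is the corresponding sine.\<close>

locale angular_kernel = positive_functional L
  for L :: "'a::{real_algebra, comm_monoid_mult} \<Rightarrow> real" +
  fixes t :: 'a
begin

definition W :: 'a where "W = 1 + t * t"

definition e :: "real \<Rightarrow> 'a" where "e \<phi> = cos \<phi> *\<^sub>R 1 + sin \<phi> *\<^sub>R t"

definition f :: "real \<Rightarrow> 'a" where "f \<phi> = sin \<phi> *\<^sub>R 1 - cos \<phi> *\<^sub>R t"

lemma cos_sin_sq: "(cos \<phi> * cos \<phi>) *\<^sub>R x + (sin \<phi> * sin \<phi>) *\<^sub>R x = (x::'a)"
  by (simp flip: scaleR_add_left power2_eq_square)

lemma e_sq_add_f_sq: "e \<phi> * e \<phi> + f \<phi> * f \<phi> = W"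
proof -
  have "e \<phi> * e \<phi> + f \<phi> * f \<phi>
      = ((cos \<phi> * cos \<phi>) *\<^sub>R 1 + (sin \<phi> * sin \<phi>) *\<^sub>R 1)
        + ((cos \<phi> * cos \<phi>) *\<^sub>R (t * t) + (sin \<phi> * sin \<phi>) *\<^sub>R (t * t))"
    by (simp add: e_def f_def algebra_simps)
  then show ?thesis unfolding cos_sin_sq W_def by simp
qed

text \<open>Up to a multiple of \<open>f \<phi>\<close>, the vector
  \<open>(cos \<phi>, sin \<phi>)\<close> scaled by \<open>W\<close> is \<open>e \<phi>\<close>
  times \<open>(1, t)\<close>. This is how the number \<open>tan \<phi>\<close> is exchanged for
  \<open>t\<close>.\<close>

lemma cos_W: "cos \<phi> *\<^sub>R W = e \<phi> - t * f \<phi>"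
  and sin_W: "sin \<phi> *\<^sub>R W = t * e \<phi> + f \<phi>"
  by (simp_all add: W_def e_def f_def algebra_simps)

lemma bounded_e: "bounded_family e" and bounded_f: "bounded_family f"
proof -
  have "W - e \<phi> * e \<phi> = f \<phi> * f \<phi>" "W - f \<phi> * f \<phi> = e \<phi> * e \<phi>" for \<phi>
    using e_sq_add_f_sq[of \<phi>] by (auto simp: algebra_simps)
  then show "bounded_family e" "bounded_family f"
    unfolding bounded_family_def by (metis sos.sq)+
qed

text \<open>The cofactor of \<open>f \<phi>\<close> is bounded uniformly in \<open>\<phi>\<close>,
  so that the error can be integrated over the angle against the kernel.\<close>

definition f_cong :: "(real \<Rightarrow> 'a) \<Rightarrow> (real \<Rightarrow> 'a) \<Rightarrow> bool" where
  "f_cong F G \<longleftrightarrow> (\<exists>y. bounded_family y \<and> (\<forall>\<phi>. F \<phi> = G \<phi> + f \<phi> * y \<phi>))"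

lemma f_cong_refl: "f_cong F F"
  unfolding f_cong_def by (intro exI[of _ "\<lambda>_. 0"]) (simp add: bounded_family_const)

lemma f_cong_add:
  assumes "f_cong F G" "f_cong F' G'"
  shows "f_cong (\<lambda>\<phi>. F \<phi> + F' \<phi>) (\<lambda>\<phi>. G \<phi> + G' \<phi>)"
proof -
  obtain y y' where "bounded_family y" "\<And>\<phi>. F \<phi> = G \<phi> + f \<phi> * y \<phi>"
    "bounded_family y'" "\<And>\<phi>. F' \<phi> = G' \<phi> + f \<phi> * y' \<phi>"
    using assms unfolding f_cong_def by blast
  then show ?thesis unfolding f_cong_def
    by (intro exI[of _ "\<lambda>\<phi>. y \<phi> + y' \<phi>"]) (simp add: bounded_family_add algebra_simps)
qed

lemma f_cong_mult:
  assumes "f_cong F G" "f_cong F' G'" "bounded_family F'" "bounded_family G"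
  shows "f_cong (\<lambda>\<phi>. F \<phi> * F' \<phi>) (\<lambda>\<phi>. G \<phi> * G' \<phi>)"
proof -
  obtain y y' where y: "bounded_family y" "\<And>\<phi>. F \<phi> = G \<phi> + f \<phi> * y \<phi>"
    and y': "bounded_family y'" "\<And>\<phi>. F' \<phi> = G' \<phi> + f \<phi> * y' \<phi>"
    using assms unfolding f_cong_def by blast
  have "F \<phi> * F' \<phi> = G \<phi> * G' \<phi> + f \<phi> * (G \<phi> * y' \<phi> + y \<phi> * F' \<phi>)" for \<phi>
  proof -
    have "F \<phi> * F' \<phi> = G \<phi> * F' \<phi> + f \<phi> * y \<phi> * F' \<phi>"
      by (subst y(2)) (simp add: distrib_right)
    also have "G \<phi> * F' \<phi> = G \<phi> * G' \<phi> + G \<phi> * (f \<phi> * y' \<phi>)"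
      by (subst y'(2)) (simp add: distrib_left)
    finally show ?thesis by (simp add: algebra_simps)
  qed
  moreover have "bounded_family (\<lambda>\<phi>. G \<phi> * y' \<phi> + y \<phi> * F' \<phi>)"
    using y(1) y'(1) assms(3,4) by (intro bounded_family_add bounded_family_mult)
  ultimately show ?thesis unfolding f_cong_def by blast
qed

lemma f_cong_power:
  assumes "f_cong F G" "bounded_family F" "bounded_family G"
  shows "f_cong (\<lambda>\<phi>. F \<phi> ^ n) (\<lambda>\<phi>. G \<phi> ^ n)"
  by (induction n) (simp_all add: f_cong_refl f_cong_mult bounded_family_power assms)

lemma f_cong_sum:
  assumes "\<And>j. j \<in> S \<Longrightarrow> f_cong (F j) (G j)"
  shows "f_cong (\<lambda>\<phi>. \<Sum>j\<in>S. F j \<phi>) (\<lambda>\<phi>. \<Sum>j\<in>S. G j \<phi>)"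
  using assms
  by (induction S rule: infinite_finite_induct) (simp_all add: f_cong_refl f_cong_add)

text \<open>The left side is the polynomial with coefficients \<open>p j\<close> at the number
  \<open>tan \<phi>\<close>, cleared of denominators by \<open>cos \<phi> ^ D\<close> and multiplied
  by \<open>W ^ D\<close>; its positivity is what a substitution hypothesis yields. The right side
  is the element of interest times a kernel weight.\<close>

lemma f_cong_homogenized:
  assumes "n \<le> D"
  shows "f_cong (\<lambda>\<phi>. \<Sum>j\<le>n. (cos \<phi> *\<^sub>R W) ^ (D - j) * (sin \<phi> *\<^sub>R W) ^ j * p j)
     (\<lambda>\<phi>. e \<phi> ^ D * (\<Sum>j\<le>n. t ^ j * p j))"
proof -
  have bt: "bounded_family (\<lambda>\<phi>. t * e \<phi>)"
    by (intro bounded_family_mult bounded_family_const bounded_e)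
  have bc: "bounded_family (\<lambda>\<phi>. cos \<phi> *\<^sub>R W)"
  proof -
    have "bounded_family (\<lambda>\<phi>. e \<phi> + (- t) * f \<phi>)"
      by (intro bounded_family_add bounded_family_mult bounded_family_const bounded_e bounded_f)
    then show ?thesis by (simp add: cos_W)
  qed
  have bs: "bounded_family (\<lambda>\<phi>. sin \<phi> *\<^sub>R W)"
    unfolding sin_W by (intro bounded_family_add bt bounded_f)
  have c: "f_cong (\<lambda>\<phi>. cos \<phi> *\<^sub>R W) e"
    unfolding f_cong_def cos_W
    by (intro exI[of _ "\<lambda>_. - t"]) (simp add: bounded_family_const mult.commute)
  have s: "f_cong (\<lambda>\<phi>. sin \<phi> *\<^sub>R W) (\<lambda>\<phi>. t * e \<phi>)"
    unfolding f_cong_def sin_W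
    by (intro exI[of _ "\<lambda>_. 1"]) (simp add: bounded_family_const)
  have "f_cong (\<lambda>\<phi>. (cos \<phi> *\<^sub>R W) ^ (D - j) * (sin \<phi> *\<^sub>R W) ^ j * p j)
      (\<lambda>\<phi>. e \<phi> ^ (D - j) * (t * e \<phi>) ^ j * p j)" for j
    by (intro f_cong_mult f_cong_power c s f_cong_refl bounded_family_mult bounded_family_power
        bc bs bt bounded_e bounded_family_const)
  then have "f_cong (\<lambda>\<phi>. \<Sum>j\<le>n. (cos \<phi> *\<^sub>R W) ^ (D - j) * (sin \<phi> *\<^sub>R W) ^ j * p j)
     (\<lambda>\<phi>. \<Sum>j\<le>n. e \<phi> ^ (D - j) * (t * e \<phi>) ^ j * p j)"
    by (intro f_cong_sum)
  moreover have "(\<Sum>j\<le>n. e \<phi> ^ (D - j) * (t * e \<phi>) ^ j * p j) = e \<phi> ^ D * (\<Sum>j\<le>n. t ^ j * p j)" for \<phi>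
  proof -
    have "e \<phi> ^ (D - j) * (t * e \<phi>) ^ j * p j = e \<phi> ^ D * (t ^ j * p j)" if "j \<le> n" for j
    proof -
      have "e \<phi> ^ D = e \<phi> ^ (D - j) * e \<phi> ^ j"
        using that assms by (simp flip: power_add)
      then show ?thesis by (simp add: power_mult_distrib ac_simps)
    qed
    then show ?thesis by (simp add: sum_distrib_left)
  qed
  ultimately show ?thesis by simp
qed

text \<open>The derivative of \<open>e\<close> is \<open>- f\<close>. Only real functions are
  differentiated: one factor \<open>e \<phi>\<close> is expanded at a time, and the \<open>t\<close>
  it brings is absorbed by the arbitrary \<open>x\<close>.\<close>

lemma deriv_e_power:
  "((\<lambda>\<phi>. L (x * e \<phi> ^ m)) has_real_derivative - (real m * L (x * e \<phi> ^ (m - 1) * f \<phi>))) (at \<phi>)"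
proof (induction m arbitrary: x)
  case (Suc m)
  have eq: "L (x * e \<phi> ^ Suc m) = cos \<phi> * L (x * e \<phi> ^ m) + sin \<phi> * L (x * t * e \<phi> ^ m)" for \<phi>
  proof -
    have "x * e \<phi> ^ Suc m = e \<phi> * (x * e \<phi> ^ m)" by (simp add: ac_simps)
    also have "\<dots> = cos \<phi> *\<^sub>R (x * e \<phi> ^ m) + sin \<phi> *\<^sub>R (x * t * e \<phi> ^ m)"
      by (subst (1) e_def) (simp add: distrib_left distrib_right ac_simps)
    finally show ?thesis by (simp add: L_simps)
  qed
  have 1: "L (x * e \<phi> ^ m * f \<phi>) = sin \<phi> * L (x * e \<phi> ^ m) - cos \<phi> * L (x * t * e \<phi> ^ m)"
  proof -
    have "x * e \<phi> ^ m * f \<phi> = sin \<phi> *\<^sub>R (x * e \<phi> ^ m) - cos \<phi> *\<^sub>R (x * t * e \<phi> ^ m)"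
      by (simp add: f_def right_diff_distrib ac_simps)
    then show ?thesis by (simp add: L_simps)
  qed
  have 2: "real m * L (x * e \<phi> ^ m * f \<phi>)
      = real m * (cos \<phi> * L (x * e \<phi> ^ (m - 1) * f \<phi>) + sin \<phi> * L (x * t * e \<phi> ^ (m - 1) * f \<phi>))"
  proof (cases m)
    case (Suc k)
    have "x * e \<phi> ^ m * f \<phi> = e \<phi> * (x * e \<phi> ^ k * f \<phi>)" by (simp add: Suc ac_simps)
    also have "\<dots> = cos \<phi> *\<^sub>R (x * e \<phi> ^ k * f \<phi>) + sin \<phi> *\<^sub>R (x * t * e \<phi> ^ k * f \<phi>)"
      by (subst (1) e_def) (simp add: distrib_left distrib_right ac_simps)
    finally show ?thesis by (simp add: Suc L_simps)
  qed simp
  show ?case unfolding eq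
    by (rule derivative_eq_intros Suc.IH refl | simp)+
      (use 1 2 in \<open>simp add: algebra_simps\<close>)
qed simp

section \<open>Integrals over the angle and Wallis' recursion\<close>

definition J :: "nat \<Rightarrow> 'a \<Rightarrow> real" where
  "J n x = integral {0..2 * pi} (\<lambda>\<phi>. L (x * e \<phi> ^ (2 * n)))"

lemma e_power_integrable: "(\<lambda>\<phi>. L (x * e \<phi> ^ m)) integrable_on {0..2 * pi}"
  by (intro integrable_continuous_real continuous_at_imp_continuous_on ballI DERIV_isCont[OF deriv_e_power])

lemma J_has_integral: "((\<lambda>\<phi>. L (x * e \<phi> ^ (2 * n))) has_integral J n x) {0..2 * pi}"
  unfolding J_def by (rule integrable_integral[OF e_power_integrable])

lemma J_Suc: "real (2 * n + 2) * J (Suc n) x = real (2 * n + 1) * J n (x * W)"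
proof -
  \<comment> \<open>\<open>G \<phi>\<close> is
    \<open>L (x * f \<phi> * e \<phi> ^ (2 * n + 1))\<close> written out, the boundary term of the
    integration by parts in Wallis' recursion; it has period \<open>2 * pi\<close>.\<close>
  define G where "G \<phi> = sin \<phi> * L (x * e \<phi> ^ (2 * n + 1)) - cos \<phi> * L (x * t * e \<phi> ^ (2 * n + 1))" for \<phi>
  have 1: "sin \<phi> * L (y * f \<phi>) - cos \<phi> * L (y * t * f \<phi>) = L (y * W) - L (y * (e \<phi> * e \<phi>))" for y \<phi>
  proof -
    have "y * W - y * (e \<phi> * e \<phi>) = y * (f \<phi> * f \<phi>)"
      by (simp flip: e_sq_add_f_sq[of \<phi>] add: distrib_left)
    also have "\<dots> = sin \<phi> *\<^sub>R (y * f \<phi>) - cos \<phi> *\<^sub>R (y * t * f \<phi>)"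
      by (subst (1) f_def) (simp add: left_diff_distrib right_diff_distrib ac_simps)
    finally have "L (y * W - y * (e \<phi> * e \<phi>)) = L (sin \<phi> *\<^sub>R (y * f \<phi>) - cos \<phi> *\<^sub>R (y * t * f \<phi>))"
      by (rule arg_cong)
    then show ?thesis by (simp only: L_simps real_scaleR_def)
  qed
  have 2: "cos \<phi> * L y + sin \<phi> * L (y * t) = L (y * e \<phi>)" for y \<phi>
    by (simp add: e_def distrib_left L_simps)
  have "(G has_real_derivative
      (real (2 * n + 2) * L (x * e \<phi> ^ (2 * Suc n)) - real (2 * n + 1) * L (x * W * e \<phi> ^ (2 * n)))) (at \<phi>)" for \<phi>
  proof -
    have "(G has_real_derivative
        (cos \<phi> * L (x * e \<phi> ^ (2 * n + 1)) + sin \<phi> * L (x * e \<phi> ^ (2 * n + 1) * t))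
        - real (2 * n + 1) * (sin \<phi> * L (x * e \<phi> ^ (2 * n) * f \<phi>) - cos \<phi> * L (x * e \<phi> ^ (2 * n) * t * f \<phi>))) (at \<phi>)"
      unfolding G_def
      by (rule derivative_eq_intros deriv_e_power refl | simp)+ (simp add: algebra_simps)
    then show ?thesis unfolding 1 2 by (simp add: algebra_simps power2_eq_square)
  qed
  then have 1: "((\<lambda>\<phi>. real (2 * n + 2) * L (x * e \<phi> ^ (2 * Suc n)) - real (2 * n + 1) * L (x * W * e \<phi> ^ (2 * n)))
      has_integral (G (2 * pi) - G 0)) {0..2 * pi}"
    by (intro fundamental_theorem_of_calculus)
      (auto simp: has_real_derivative_iff_has_vector_derivative[symmetric]
        intro: has_field_derivative_at_within)
  have 2: "G (2 * pi) - G 0 = 0" by (simp add: G_def e_def)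
  have 3: "((\<lambda>\<phi>. real (2 * n + 2) * L (x * e \<phi> ^ (2 * Suc n)) - real (2 * n + 1) * L (x * W * e \<phi> ^ (2 * n)))
      has_integral (real (2 * n + 2) * J (Suc n) x - real (2 * n + 1) * J n (x * W))) {0..2 * pi}"
    by (intro has_integral_diff has_integral_mult_right J_has_integral)
  show ?thesis using has_integral_unique[OF 3 1] 2 by simp
qed

text \<open>The integral of \<open>cos \<phi> ^ (2 * n)\<close> over a full period.\<close>

definition wallis :: "nat \<Rightarrow> real" where
  "wallis n = 2 * pi * (\<Prod>i<n. real (2 * i + 1) / real (2 * i + 2))"

lemma wallis_pos: "wallis n > 0"
  unfolding wallis_def by (intro mult_pos_pos prod_pos) auto

lemma wallis_Suc: "wallis (Suc n) = wallis n * (real (2 * n + 1) / real (2 * n + 2))"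
  by (simp add: wallis_def)

lemma wallis_ratio: "(\<lambda>n. wallis (n + d) / wallis n) \<longlonglongrightarrow> 1"
proof (induction d)
  case 0
  show ?case using wallis_pos by (simp add: less_imp_neq[symmetric])
next
  case (Suc d)
  have "(\<lambda>n. 1 - 1 / 2 * inverse (real (Suc (n + d)))) \<longlonglongrightarrow> 1 - 1 / 2 * 0"
    by (intro tendsto_intros LIMSEQ_ignore_initial_segment[OF LIMSEQ_inverse_real_of_nat])
  moreover have "1 - 1 / 2 * inverse (real (Suc (n + d))) = real (2 * (n + d) + 1) / real (2 * (n + d) + 2)" for n
    by (simp add: field_simps)
  ultimately have "(\<lambda>n. real (2 * (n + d) + 1) / real (2 * (n + d) + 2)) \<longlonglongrightarrow> 1" by simp
  from tendsto_mult[OF Suc.IH this] show ?case by (simp add: wallis_Suc mult.commute)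
qed

text \<open>Formally, the kernel \<open>e \<phi> ^ (2 * n) / W ^ n\<close> has the same total mass
  as it would for a real number \<open>t\<close>.\<close>

lemma J_eq: "J n x = wallis n * L (x * W ^ n)"
proof (induction n arbitrary: x)
  case 0
  show ?case by (simp add: J_def wallis_def)
next
  case (Suc n)
  have "real (2 * n + 2) * J (Suc n) x = real (2 * n + 1) * (wallis n * L (x * W * W ^ n))"
    using J_Suc[of n x] Suc.IH[of "x * W"] by simp
  then show ?case by (simp add: wallis_Suc field_simps)
qed

text \<open>The hypothesis is used with \<open>b * e \<phi> ^ N\<close> for \<open>b\<close> and
  integrated over the angle. The mixed term is split by
  \<open>2 \<eta> f y \<le> \<eta>^2 y^2 + f^2\<close>. Then \<open>y^2\<close> is replaced by the
  constant \<open>Y\<close>, and \<open>f * f = W - e * e\<close> integrates to a quantity of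
  relative size \<open>1 / (2 * N + 2)\<close>: this is the concentration of the kernel.\<close>

lemma kernel_inequality:
  assumes nonneg: "\<And>b \<phi>. L (b * b * (e \<phi> ^ (2 * d) * q + f \<phi> * y \<phi>)) \<ge> 0"
    and Y: "\<And>\<phi>. Y - y \<phi> * y \<phi> \<in> sos"
    and "\<eta> > 0"
  shows "0 \<le> wallis (N + d) / wallis N * L (b * b * q * W ^ (N + d)) + \<eta> / 2 * L (b * b * Y * W ^ N)
     + 1 / (2 * \<eta>) * (1 / real (2 * N + 2)) * L (b * b * W ^ Suc N)"
proof -
  have pointwise: "0 \<le> L (b * b * q * e \<phi> ^ (2 * (N + d))) + \<eta> / 2 * L (b * b * Y * e \<phi> ^ (2 * N))
     + 1 / (2 * \<eta>) * (L (b * b * W * e \<phi> ^ (2 * N)) - L (b * b * e \<phi> ^ (2 * Suc N)))" for \<phi>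
  proof -
    let ?b = "b * e \<phi> ^ N"
    have bb: "?b * ?b = b * b * e \<phi> ^ (2 * N)"
      by (simp add: power_mult power2_eq_square power_mult_distrib ac_simps)
    have "0 \<le> L (?b * ?b * (e \<phi> ^ (2 * d) * q + f \<phi> * y \<phi>))" by (rule nonneg)
    then have 1: "0 \<le> L (b * b * q * e \<phi> ^ (2 * (N + d))) + L (?b * ?b * (f \<phi> * y \<phi>))"
      unfolding bb by (simp add: distrib_left L_simps power_add ac_simps)
    have "0 \<le> L ((?b * (\<eta> *\<^sub>R y \<phi> - f \<phi>)) * (?b * (\<eta> *\<^sub>R y \<phi> - f \<phi>)))" by (rule square_nonneg)
    also have "(?b * (\<eta> *\<^sub>R y \<phi> - f \<phi>)) * (?b * (\<eta> *\<^sub>R y \<phi> - f \<phi>))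
        = (\<eta> * \<eta>) *\<^sub>R (?b * ?b * (y \<phi> * y \<phi>)) + ?b * ?b * (f \<phi> * f \<phi>)
          - \<eta> *\<^sub>R (?b * ?b * (f \<phi> * y \<phi>)) - \<eta> *\<^sub>R (?b * ?b * (f \<phi> * y \<phi>))"
      by (simp add: algebra_simps)
    finally have 2: "2 * \<eta> * L (?b * ?b * (f \<phi> * y \<phi>))
        \<le> \<eta> * \<eta> * L (?b * ?b * (y \<phi> * y \<phi>)) + L (?b * ?b * (f \<phi> * f \<phi>))"
      by (simp add: L_simps)
    have "0 \<le> L (?b * ?b * (Y - y \<phi> * y \<phi>))" by (intro sos_nonneg sos_mult sos.sq Y)
    then have "L (?b * ?b * (y \<phi> * y \<phi>)) \<le> L (?b * ?b * Y)"
      by (simp add: right_diff_distrib L_simps)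
    then have "\<eta> * \<eta> * L (?b * ?b * (y \<phi> * y \<phi>)) \<le> \<eta> * \<eta> * L (?b * ?b * Y)"
      by (intro mult_left_mono) auto
    with 2 have 3: "2 * \<eta> * L (?b * ?b * (f \<phi> * y \<phi>)) \<le> \<eta> * \<eta> * L (?b * ?b * Y) + L (?b * ?b * (f \<phi> * f \<phi>))"
      by linarith
    have "L (?b * ?b * (f \<phi> * y \<phi>)) = 1 / (2 * \<eta>) * (2 * \<eta> * L (?b * ?b * (f \<phi> * y \<phi>)))"
      using \<open>\<eta> > 0\<close> by simp
    also have "\<dots> \<le> 1 / (2 * \<eta>) * (\<eta> * \<eta> * L (?b * ?b * Y) + L (?b * ?b * (f \<phi> * f \<phi>)))"
      using 3 \<open>\<eta> > 0\<close> by (intro mult_left_mono) auto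
    also have "\<dots> = \<eta> / 2 * L (?b * ?b * Y) + 1 / (2 * \<eta>) * L (?b * ?b * (f \<phi> * f \<phi>))"
      using \<open>\<eta> > 0\<close> by (simp add: field_simps)
    also have "?b * ?b * Y = b * b * Y * e \<phi> ^ (2 * N)" unfolding bb by (simp add: ac_simps)
    also have "?b * ?b * (f \<phi> * f \<phi>) = b * b * W * e \<phi> ^ (2 * N) - b * b * e \<phi> ^ (2 * Suc N)"
      unfolding bb e_sq_add_f_sq[of \<phi>, symmetric]
      by (simp add: distrib_left distrib_right power2_eq_square ac_simps)
    finally show ?thesis using 1 by (simp add: L_simps)
  qed
  have int: "((\<lambda>\<phi>. L (b * b * q * e \<phi> ^ (2 * (N + d))) + \<eta> / 2 * L (b * b * Y * e \<phi> ^ (2 * N))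
     + 1 / (2 * \<eta>) * (L (b * b * W * e \<phi> ^ (2 * N)) - L (b * b * e \<phi> ^ (2 * Suc N))))
     has_integral J (N + d) (b * b * q) + \<eta> / 2 * J N (b * b * Y)
       + 1 / (2 * \<eta>) * (J N (b * b * W) - J (Suc N) (b * b))) {0..2 * pi}"
    by (intro has_integral_add has_integral_diff has_integral_mult_right J_has_integral)
  have "0 \<le> J (N + d) (b * b * q) + \<eta> / 2 * J N (b * b * Y)
       + 1 / (2 * \<eta>) * (J N (b * b * W) - J (Suc N) (b * b))"
    by (rule has_integral_nonneg[OF int]) (rule pointwise)
  also have "\<dots> = wallis (N + d) * L (b * b * q * W ^ (N + d)) + \<eta> / 2 * (wallis N * L (b * b * Y * W ^ N))
     + 1 / (2 * \<eta>) * ((1 / real (2 * N + 2)) * wallis N * L (b * b * W ^ Suc N))"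
  proof -
    have "J N (b * b * W) - J (Suc N) (b * b) = (wallis N - wallis (Suc N)) * L (b * b * W ^ Suc N)"
      by (simp add: J_eq algebra_simps)
    also have "wallis N - wallis (Suc N) = 1 / real (2 * N + 2) * wallis N"
      by (simp add: wallis_Suc field_simps)
    finally show ?thesis by (simp add: J_eq)
  qed
  finally have "0 \<le> (1 / wallis N) * \<dots>"
    using wallis_pos[of N] by (intro mult_nonneg_nonneg) auto
  then show ?thesis using wallis_pos[of N] by (simp add: algebra_simps)
qed

text \<open>Three errors disappear one after the other: letting the kernel power grow removes the
  \<open>f * f\<close> term, \<open>\<eta>\<close> tending to 0 removes \<open>Y\<close>, and
  density cancels the remaining power of \<open>W\<close>.\<close>

lemma nonneg_of_substitutions:
  assumes dense: "resolvent_dense L t"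
    and nonneg: "\<And>b \<tau>. L (b * b * (\<Sum>j\<le>n. \<tau> ^ j *\<^sub>R p j)) \<ge> 0"
  shows "L (\<Sum>j\<le>n. t ^ j * p j) \<ge> 0"
proof -
  \<comment> \<open>The form is homogenized to degree \<open>2 * d\<close>, which exceeds
    \<open>n\<close>, so that it vanishes where \<open>cos \<phi> = 0\<close> and no real number
    \<open>tan \<phi>\<close> is available. Since \<open>d\<close> is even, \<open>W ^ d\<close> is
    the square of \<open>W ^ (n + 1)\<close>, as the final cancellation requires.\<close>
  define d where "d = 2 * (n + 1)"
  define q where "q = (\<Sum>j\<le>n. t ^ j * p j)"
  have hom: "L (b * b * (\<Sum>j\<le>n. (cos \<phi> *\<^sub>R W) ^ (2 * d - j) * (sin \<phi> *\<^sub>R W) ^ j * p j)) \<ge> 0" for b \<phi>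
  proof -
    have "(cos \<phi> *\<^sub>R W) ^ (2 * d - j) * (sin \<phi> *\<^sub>R W) ^ j * p j
        = (W ^ d * W ^ d) * ((cos \<phi> ^ (2 * d - j) * sin \<phi> ^ j) *\<^sub>R p j)" if "j \<le> n" for j
    proof -
      have "d + d = (2 * d - j) + j"
        using that by (simp add: d_def)
      then have "W ^ d * W ^ d = W ^ (2 * d - j) * W ^ j"
        by (metis power_add)
      then show ?thesis by (simp add: scaleR_power' ac_simps)
    qed
    then have eq: "(\<Sum>j\<le>n. (cos \<phi> *\<^sub>R W) ^ (2 * d - j) * (sin \<phi> *\<^sub>R W) ^ j * p j)
        = (W ^ d * W ^ d) * (\<Sum>j\<le>n. (cos \<phi> ^ (2 * d - j) * sin \<phi> ^ j) *\<^sub>R p j)"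
      by (simp add: sum_distrib_left)
    show ?thesis
    proof (cases "cos \<phi> = 0")
      case True
      then have "(\<Sum>j\<le>n. (cos \<phi> ^ (2 * d - j) * sin \<phi> ^ j) *\<^sub>R p j) = 0"
        by (intro sum.neutral) (auto simp: d_def power_0_left)
      then show ?thesis unfolding eq by (simp add: L_simps)
    next
      case False
      have "cos \<phi> ^ (2 * d - j) * sin \<phi> ^ j = cos \<phi> ^ (2 * d) * tan \<phi> ^ j" if "j \<le> n" for j
      proof -
        have "2 * d = (2 * d - j) + j"
          using that by (simp add: d_def)
        then have "cos \<phi> ^ (2 * d) = cos \<phi> ^ (2 * d - j) * cos \<phi> ^ j"
          by (metis power_add)
        then show ?thesis using False by (simp add: tan_def power_divide)
      qed
      then have "(\<Sum>j\<le>n. (cos \<phi> ^ (2 * d - j) * sin \<phi> ^ j) *\<^sub>R p j)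
          = cos \<phi> ^ (2 * d) *\<^sub>R (\<Sum>j\<le>n. tan \<phi> ^ j *\<^sub>R p j)"
        by (simp add: scaleR_sum_right)
      then have "L (b * b * (\<Sum>j\<le>n. (cos \<phi> *\<^sub>R W) ^ (2 * d - j) * (sin \<phi> *\<^sub>R W) ^ j * p j))
          = cos \<phi> ^ (2 * d) * L ((b * W ^ d) * (b * W ^ d) * (\<Sum>j\<le>n. tan \<phi> ^ j *\<^sub>R p j))"
        unfolding eq by (simp add: L_simps ac_simps)
      then show ?thesis using nonneg by simp
    qed
  qed
  have "n \<le> 2 * d" by (simp add: d_def)
  then obtain y where y: "bounded_family y"
    "\<And>\<phi>. (\<Sum>j\<le>n. (cos \<phi> *\<^sub>R W) ^ (2 * d - j) * (sin \<phi> *\<^sub>R W) ^ j * p j) = e \<phi> ^ (2 * d) * q + f \<phi> * y \<phi>"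
    using f_cong_homogenized[of n "2 * d" p] unfolding f_cong_def q_def by blast
  obtain Y where Y: "\<And>\<phi>. Y - y \<phi> * y \<phi> \<in> sos"
    using y(1) unfolding bounded_family_def by blast
  \<comment> \<open>The kernel power is \<open>2 * m\<close> because \<open>W ^ (2 * m)\<close> is a
    square: in \<open>W ^ m * b\<close>, with \<open>b\<close> arbitrary, density allows any
    \<open>g\<close> to be put instead, which amounts to dividing by
    \<open>W ^ (2 * m)\<close>.\<close>
  have step: "0 \<le> wallis (2 * m + d) / wallis (2 * m) * L (g * g * (q * W ^ d)) + \<eta> / 2 * L (g * g * Y)
     + 1 / (2 * \<eta>) * (1 / real (2 * (2 * m) + 2)) * L (g * g * W)" (is "0 \<le> ?R g") if "\<eta> > 0" for g m \<eta>
  proof -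
    let ?r = "wallis (2 * m + d) / wallis (2 * m)"
    let ?s = "1 / (2 * \<eta>) * (1 / real (2 * (2 * m) + 2))"
    let ?v = "?r *\<^sub>R (q * W ^ d) + (\<eta> / 2) *\<^sub>R Y + ?s *\<^sub>R W"
    have R: "?R g = L (?v * (g * g))" for g
      unfolding mult.commute[of ?v] by (simp only: distrib_left mult_scaleR_right L_simps real_scaleR_def)
    have "0 \<le> L (?v * (((1 + t * t) ^ m * b) * ((1 + t * t) ^ m * b)))" for b
    proof -
      have WW: "((1 + t * t) ^ m * b) * ((1 + t * t) ^ m * b) = b * b * W ^ (2 * m)"
        by (simp add: W_def[symmetric] power_mult power2_eq_square power_mult_distrib ac_simps)
      have "0 \<le> ?r * L (b * b * q * W ^ (2 * m + d)) + \<eta> / 2 * L (b * b * Y * W ^ (2 * m))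
          + ?s * L (b * b * W ^ Suc (2 * m))"
        using hom unfolding y(2) by (rule kernel_inequality[OF _ Y \<open>\<eta> > 0\<close>])
      also have "\<dots> = ?R ((1 + t * t) ^ m * b)"
        unfolding WW by (simp add: power_add ac_simps)
      finally show ?thesis unfolding R .
    qed
    then show ?thesis unfolding R by (rule nonneg_of_dense_power_multiples[OF dense])
  qed
  have limit: "0 \<le> L (g * g * (q * W ^ d)) + \<eta> / 2 * L (g * g * Y)" if "\<eta> > 0" for g \<eta>
  proof -
    have 1: "(\<lambda>m. wallis (2 * m + d) / wallis (2 * m)) \<longlonglongrightarrow> 1"
      using LIMSEQ_subseq_LIMSEQ[OF wallis_ratio[of d], of "\<lambda>m. 2 * m"]
      by (simp add: strict_mono_def o_def)
    have 2: "(\<lambda>m. 1 / real (2 * (2 * m) + 2)) \<longlonglongrightarrow> 0"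
      using LIMSEQ_subseq_LIMSEQ[OF LIMSEQ_inverse_real_of_nat, of "\<lambda>m. 2 * (2 * m) + 1"]
      by (simp add: strict_mono_def o_def divide_inverse add.commute)
    have "(\<lambda>m. wallis (2 * m + d) / wallis (2 * m) * L (g * g * (q * W ^ d)) + \<eta> / 2 * L (g * g * Y)
       + 1 / (2 * \<eta>) * (1 / real (2 * (2 * m) + 2)) * L (g * g * W))
       \<longlonglongrightarrow> 1 * L (g * g * (q * W ^ d)) + \<eta> / 2 * L (g * g * Y) + 1 / (2 * \<eta>) * 0 * L (g * g * W)"
      by (intro tendsto_intros 1 2)
    from LIMSEQ_le_const[OF this, of 0] step[OF that] show ?thesis by auto
  qed
  have "0 \<le> L (g * g * (q * W ^ d))" for g
  proof -
    have "((\<lambda>\<eta>. L (g * g * (q * W ^ d)) + \<eta> / 2 * L (g * g * Y)) \<longlongrightarrow>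
        L (g * g * (q * W ^ d)) + 0 / 2 * L (g * g * Y)) (at_right 0)"
      by (intro tendsto_intros) auto
    then have "0 \<le> L (g * g * (q * W ^ d)) + 0 / 2 * L (g * g * Y)"
      by (rule tendsto_lowerbound[OF _ eventually_mono[OF eventually_at_right_less[of 0] limit]]) auto
    then show ?thesis by simp
  qed
  then have "0 \<le> L (q * (((1 + t * t) ^ (n + 1) * k) * ((1 + t * t) ^ (n + 1) * k)))" for k
    by (simp add: d_def power_mult power2_eq_square power_mult_distrib W_def ac_simps)
  then have "0 \<le> L (q * (1 * 1))"
    by (rule nonneg_of_dense_power_multiples[OF dense])
  then show ?thesis by (simp add: q_def)
qed

end

section \<open>Polynomial functions on the algebra\<close>

text \<open>\<open>polyrel S a g\<close>: some polynomial in variables from \<open>S\<close> takes the value \<open>a\<close> in the algebra and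
  induces the function \<open>g\<close> on \<open>\<real>\<^bsup>A\<^esup>\<close>. Neither of \<open>a\<close> and \<open>g\<close> determines the other.\<close>

inductive polyrel :: "'a set \<Rightarrow> 'a::{real_algebra, comm_monoid_mult} \<Rightarrow> (('a \<Rightarrow> real) \<Rightarrow> real) \<Rightarrow> bool"
  for S where
  gen: "t \<in> S \<Longrightarrow> polyrel S t (\<lambda>y. y t)"
| const: "polyrel S (c *\<^sub>R 1) (\<lambda>_. c)"
| add: "polyrel S a g \<Longrightarrow> polyrel S b h \<Longrightarrow> polyrel S (a + b) (\<lambda>y. g y + h y)"
| mult: "polyrel S a g \<Longrightarrow> polyrel S b h \<Longrightarrow> polyrel S (a * b) (\<lambda>y. g y * h y)"

lemma polyrel_mono: "polyrel S a g \<Longrightarrow> S \<subseteq> S' \<Longrightarrow> polyrel S' a g"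
  by (induction rule: polyrel.induct) (auto intro: polyrel.intros)

lemma polyrel_finite: "polyrel S a g \<Longrightarrow> \<exists>F. finite F \<and> F \<subseteq> S \<and> polyrel F a g"
proof (induction rule: polyrel.induct)
  case (gen t)
  then show ?case by (intro exI[of _ "{t}"]) (auto intro: polyrel.gen)
next
  case (const c)
  show ?case by (intro exI[of _ "{}"]) (auto intro: polyrel.const)
next
  case (add a g b h)
  then obtain F F' where F: "finite F" "F \<subseteq> S" "polyrel F a g" "finite F'" "F' \<subseteq> S" "polyrel F' b h"
    by blast
  then have "polyrel (F \<union> F') (a + b) (\<lambda>y. g y + h y)"
    by (intro polyrel.add) (auto intro: polyrel_mono)
  with F show ?case by (intro exI[of _ "F \<union> F'"]) simp
next
  case (mult a g b h)
  then obtain F F' where F: "finite F" "F \<subseteq> S" "polyrel F a g" "finite F'" "F' \<subseteq> S" "polyrel F' b h"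
    by blast
  then have "polyrel (F \<union> F') (a * b) (\<lambda>y. g y * h y)"
    by (intro polyrel.mult) (auto intro: polyrel_mono)
  with F show ?case by (intro exI[of _ "F \<union> F'"]) simp
qed

lemma polyrel_scaleR: "polyrel S a g \<Longrightarrow> polyrel S (c *\<^sub>R a) (\<lambda>y. c * g y)"
  using polyrel.mult[OF polyrel.const[of S c]] by fastforce

lemma polyrel_sum:
  assumes "\<And>j. j \<in> J \<Longrightarrow> polyrel S (a j) (g j)"
  shows "polyrel S (\<Sum>j\<in>J. a j) (\<lambda>y. \<Sum>j\<in>J. g j y)"
  using assms
proof (induction J rule: infinite_finite_induct)
  case (insert j J)
  then show ?case by (simp add: polyrel.add)
qed (use polyrel.const[of S 0] in simp_all)

lemma polyrel_cong:
  "polyrel S a g \<Longrightarrow> (\<And>s. s \<in> S \<Longrightarrow> y s = z s) \<Longrightarrow> g y = g z"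
  by (induction rule: polyrel.induct) auto

text \<open>Polynomials in \<open>t\<close> with coefficients in the variables \<open>S\<close>. The
  coefficients are total sequences, zero beyond the degree, so that representations of different
  degrees can be added termwise.\<close>

definition polyrel_in :: "'a set \<Rightarrow> 'a \<Rightarrow> 'a::{real_algebra, comm_monoid_mult} \<Rightarrow> (('a \<Rightarrow> real) \<Rightarrow> real) \<Rightarrow> bool" where
  "polyrel_in S t a g \<longleftrightarrow> (\<exists>n p q. (\<forall>j. polyrel S (p j) (q j)) \<and> (\<forall>j>n. p j = 0 \<and> q j = (\<lambda>_. 0)) \<and>
     a = (\<Sum>j\<le>n. t ^ j * p j) \<and> g = (\<lambda>y. \<Sum>j\<le>n. y t ^ j * q j y))"

lemma polyrel_in_const:
  assumes "polyrel S a g"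
  shows "polyrel_in S t a g"
proof -
  have "polyrel S (if j = 0 then a else 0) (if j = 0 then g else (\<lambda>_. 0))" for j :: nat
    using assms polyrel.const[of S 0] by simp
  then show ?thesis
    unfolding polyrel_in_def
    by (intro exI[of _ 0] exI[of _ "\<lambda>j. if j = 0 then a else 0"]
        exI[of _ "\<lambda>j. if j = 0 then g else (\<lambda>_. 0)"]) auto
qed

lemma polyrel_in_var:
  assumes "polyrel_in S t a g"
  shows "polyrel_in S t (t * a) (\<lambda>y. y t * g y)"
proof -
  obtain n p q where pq: "\<And>j. polyrel S (p j) (q j)" "\<And>j. j > n \<Longrightarrow> p j = 0 \<and> q j = (\<lambda>_. 0)"
    "a = (\<Sum>j\<le>n. t ^ j * p j)" "g = (\<lambda>y. \<Sum>j\<le>n. y t ^ j * q j y)"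
    using assms unfolding polyrel_in_def by blast
  define p' where "p' j = (case j of 0 \<Rightarrow> 0 | Suc i \<Rightarrow> p i)" for j
  define q' where "q' j = (case j of 0 \<Rightarrow> (\<lambda>_. 0) | Suc i \<Rightarrow> q i)" for j
  have "polyrel S (p' j) (q' j)" for j
    using polyrel.const[of S 0] pq(1) by (simp add: p'_def q'_def split: nat.split)
  moreover have "p' j = 0 \<and> q' j = (\<lambda>_. 0)" if "j > Suc n" for j
    using pq(2) that by (auto simp: p'_def q'_def split: nat.split)
  moreover have "t * a = (\<Sum>j\<le>Suc n. t ^ j * p' j)"
    unfolding pq(3) by (subst sum.atMost_Suc_shift) (simp add: p'_def sum_distrib_left ac_simps)
  moreover have "(\<lambda>y. y t * g y) = (\<lambda>y. \<Sum>j\<le>Suc n. y t ^ j * q' j y)"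
    unfolding pq(4) by (subst sum.atMost_Suc_shift) (simp add: q'_def sum_distrib_left ac_simps)
  ultimately show ?thesis unfolding polyrel_in_def by blast
qed

lemma polyrel_in_add:
  assumes "polyrel_in S t a g" "polyrel_in S t b h"
  shows "polyrel_in S t (a + b) (\<lambda>y. g y + h y)"
proof -
  obtain n p q where pq: "\<And>j. polyrel S (p j) (q j)" "\<And>j. j > n \<Longrightarrow> p j = 0 \<and> q j = (\<lambda>_. 0)"
    "a = (\<Sum>j\<le>n. t ^ j * p j)" "g = (\<lambda>y. \<Sum>j\<le>n. y t ^ j * q j y)"
    using assms(1) unfolding polyrel_in_def by blast
  obtain m u v where uv: "\<And>j. polyrel S (u j) (v j)" "\<And>j. j > m \<Longrightarrow> u j = 0 \<and> v j = (\<lambda>_. 0)"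
    "b = (\<Sum>j\<le>m. t ^ j * u j)" "h = (\<lambda>y. \<Sum>j\<le>m. y t ^ j * v j y)"
    using assms(2) unfolding polyrel_in_def by blast
  have a: "a = (\<Sum>j\<le>max n m. t ^ j * p j)" unfolding pq(3)
    by (rule sum.mono_neutral_left) (use pq(2) in auto)
  have b: "b = (\<Sum>j\<le>max n m. t ^ j * u j)" unfolding uv(3)
    by (rule sum.mono_neutral_left) (use uv(2) in auto)
  have g: "g y = (\<Sum>j\<le>max n m. y t ^ j * q j y)" for y unfolding pq(4)
    by (rule sum.mono_neutral_left) (use pq(2) in auto)
  have h: "h y = (\<Sum>j\<le>max n m. y t ^ j * v j y)" for y unfolding uv(4)
    by (rule sum.mono_neutral_left) (use uv(2) in auto)
  show ?thesis unfolding polyrel_in_def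
    by (intro exI[of _ "max n m"] exI[of _ "\<lambda>j. p j + u j"] exI[of _ "\<lambda>j y. q j y + v j y"])
      (use pq(1,2) uv(1,2) in \<open>auto simp: a b g h polyrel.add sum.distrib distrib_left\<close>)
qed

lemma polyrel_in_mult:
  assumes "polyrel_in S t a g" "polyrel_in S t b h"
  shows "polyrel_in S t (a * b) (\<lambda>y. g y * h y)"
proof -
  obtain n p q where pq: "\<And>j. polyrel S (p j) (q j)"
    "a = (\<Sum>j\<le>n. t ^ j * p j)" "g = (\<lambda>y. \<Sum>j\<le>n. y t ^ j * q j y)"
    using assms(1) unfolding polyrel_in_def by blast
  obtain m u v where uv: "\<And>j. polyrel S (u j) (v j)" "\<And>j. j > m \<Longrightarrow> u j = 0 \<and> v j = (\<lambda>_. 0)"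
    "b = (\<Sum>j\<le>m. t ^ j * u j)" "h = (\<lambda>y. \<Sum>j\<le>m. y t ^ j * v j y)"
    using assms(2) unfolding polyrel_in_def by blast
  have pow: "polyrel_in S t (t ^ i * x) (\<lambda>y. y t ^ i * k y)" if "polyrel_in S t x k" for i x k
    by (induction i) (use that polyrel_in_var in \<open>auto simp: mult.assoc\<close>)
  have coeff: "polyrel_in S t (p i * b) (\<lambda>y. q i y * h y)" for i
    unfolding polyrel_in_def
    by (intro exI[of _ m] exI[of _ "\<lambda>j. p i * u j"] exI[of _ "\<lambda>j y. q i y * v j y"])
      (use uv pq(1) in \<open>auto simp: polyrel.mult sum_distrib_left ac_simps\<close>)
  have "polyrel_in S t (\<Sum>j\<le>k. t ^ j * (p j * b)) (\<lambda>y. \<Sum>j\<le>k. y t ^ j * (q j y * h y))" for k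
    by (induction k) (simp_all add: polyrel_in_add pow coeff del: power_Suc)
  from this[of n] show ?thesis
    by (simp add: pq(2,3) sum_distrib_right mult.assoc)
qed

lemma polyrel_insert: "polyrel (insert t S) a g \<Longrightarrow> polyrel_in S t a g"
proof (induction rule: polyrel.induct)
  case (gen s)
  show ?case
  proof (cases "s = t")
    case True
    then show ?thesis
      using polyrel_in_var[OF polyrel_in_const[OF polyrel.const[of S 1]], of t] by simp
  qed (use gen in \<open>auto intro: polyrel_in_const polyrel.gen\<close>)
qed (auto intro: polyrel_in_const polyrel.const polyrel_in_add polyrel_in_mult)

context positive_functional
begin

lemma resolvent_dense_shift:
  assumes "resolvent_dense L t"
  shows "resolvent_dense (\<lambda>x. L (b * b * x)) t"
  unfolding resolvent_dense_def
proof (intro allI impI)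
  fix c x :: 'a and \<delta> :: real assume "\<delta> > 0"
  then obtain k where "L (((b * c) * (x - (1 + t * t) * k)) * ((b * c) * (x - (1 + t * t) * k))) < \<delta>"
    using assms unfolding resolvent_dense_def by blast
  then show "\<exists>k. L (b * b * ((c * (x - (1 + t * t) * k)) * (c * (x - (1 + t * t) * k)))) < \<delta>"
    by (intro exI[of _ k]) (simp add: ac_simps)
qed

end

text \<open>The functional is generalized in the induction: replacing one variable by a number
  requires positivity of the result for \<open>L (b * b * x)\<close> with every \<open>b\<close>,
  and these functionals inherit both positivity and density.\<close>

lemma polyrel_nonneg_finite:
  assumes "finite F" "positive_functional L" "\<And>t. t \<in> F \<Longrightarrow> resolvent_dense L t"
    and "polyrel F a g" "\<And>y. g y \<ge> 0"
  shows "L a \<ge> 0"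
  using assms
proof (induction F arbitrary: L a g rule: finite_induct)
  case empty
  have "\<exists>c. a = c *\<^sub>R 1 \<and> g = (\<lambda>_. c)"
    using empty.prems(3)
  proof (induction rule: polyrel.induct)
    case (add a g b h)
    then show ?case by (auto simp flip: scaleR_add_left)
  next
    case (mult a g b h)
    then obtain c d where "a = c *\<^sub>R 1" "g = (\<lambda>_. c)" "b = d *\<^sub>R 1" "h = (\<lambda>_. d)" by blast
    then show ?case by (intro exI[of _ "c * d"]) simp
  qed auto
  then obtain c where c: "a = c *\<^sub>R 1" "g = (\<lambda>_. c)" by blast
  interpret positive_functional L by fact
  show ?case using c empty.prems(4) one_nonneg by (simp add: L_simps)
next
  case (insert t F)
  interpret angular_kernel L t using insert.prems(1) by (simp add: angular_kernel_def)
  obtain n p q where pq: "\<And>j. polyrel F (p j) (q j)"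
    "a = (\<Sum>j\<le>n. t ^ j * p j)" "g = (\<lambda>y. \<Sum>j\<le>n. y t ^ j * q j y)"
    using polyrel_insert[OF insert.prems(3)] unfolding polyrel_in_def by blast
  show ?case unfolding pq(2)
  proof (rule nonneg_of_substitutions)
    show "resolvent_dense L t" by (rule insert.prems(2)) simp
    fix b \<tau>
    show "0 \<le> L (b * b * (\<Sum>j\<le>n. \<tau> ^ j *\<^sub>R p j))"
    proof (rule insert.IH[of "\<lambda>x. L (b * b * x)"])
      show "positive_functional (\<lambda>x. L (b * b * x))" by (rule shift[OF sos.sq])
      show "resolvent_dense (\<lambda>x. L (b * b * x)) s" if "s \<in> F" for s
        by (rule resolvent_dense_shift) (simp add: insert.prems(2) that)
      show "polyrel F (\<Sum>j\<le>n. \<tau> ^ j *\<^sub>R p j) (\<lambda>y. \<Sum>j\<le>n. \<tau> ^ j * q j y)"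
        by (intro polyrel_sum polyrel_scaleR pq(1))
      fix y
      \<comment> \<open>Since \<open>t\<close> is not in \<open>F\<close>, the coefficient functions
        ignore the coordinate \<open>t\<close>; moving that coordinate to \<open>\<tau>\<close>
        gives precisely the substituted polynomial.\<close>
      have "q j (y(t := \<tau>)) = q j y" for j
        by (rule polyrel_cong[OF pq(1)]) (use insert.hyps in auto)
      then have "g (y(t := \<tau>)) = (\<Sum>j\<le>n. \<tau> ^ j * q j y)"
        by (simp only: pq(3) fun_upd_same)
      then show "0 \<le> (\<Sum>j\<le>n. \<tau> ^ j * q j y)"
        using insert.prems(4)[of "y(t := \<tau>)"] by (simp only:)
    qed
  qed
qed

text \<open>Density is known only on a basis. Each variable is expanded in it, and
  \<open>lift\<close> extends values on the basis linearly, so a polynomial in arbitrary elements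
  becomes one in basis elements whose function \<open>g (lift y)\<close> is still
  nonnegative.\<close>

lemma polyrel_nonneg:
  assumes "positive_functional L" "\<And>t. t \<in> B \<Longrightarrow> resolvent_dense L t"
    and "independent B" "span B = UNIV"
    and "polyrel UNIV a g" "\<And>y. g y \<ge> 0"
  shows "L a \<ge> 0"
proof -
  define lift where "lift y = (\<lambda>a. \<Sum>b | representation B a b \<noteq> 0. representation B a b * y b)"
    for y :: "'a \<Rightarrow> real"
  have "polyrel B a (\<lambda>y. g (lift y))"
    using assms(5)
  proof (induction rule: polyrel.induct)
    case (gen t)
    have "polyrel B (\<Sum>b | representation B t b \<noteq> 0. representation B t b *\<^sub>R b)
       (\<lambda>y. \<Sum>b | representation B t b \<noteq> 0. representation B t b * y b)"
      by (intro polyrel_sum polyrel_scaleR polyrel.gen) (auto dest: representation_ne_zero)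
    then show ?case
      by (simp add: sum_nonzero_representation_eq assms(3,4) lift_def)
  qed (auto intro: polyrel.intros)
  from polyrel_finite[OF this]
  obtain F where F: "finite F" "F \<subseteq> B" "polyrel F a (\<lambda>y. g (lift y))"
    by (elim exE conjE)
  show ?thesis
    by (rule polyrel_nonneg_finite[OF F(1) assms(1) _ F(3)]) (use F(2) assms(2,6) in auto)
qed

section \<open>Carleman's inequality and orthogonal polynomials\<close>

lemma carleman_inequality:
  fixes a :: "nat \<Rightarrow> real"
  assumes pos: "\<And>n. a n > 0" and "summable a"
  shows "summable (\<lambda>n. (\<Prod>k<Suc n. a k) powr (1 / real (Suc n)))"
proof (rule summableI_nonneg_bounded)
  \<comment> \<open>Polya's weights: the product of the first \<open>n + 1\<close> of them is
    \<open>(n + 2) ^ (n + 1)\<close>, so the geometric mean contributes exactly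
    \<open>n + 2\<close>, and \<open>c k / (k + 1)\<close> stays below \<open>exp 1\<close>.\<close>
  define c where "c k = real (k + 2) ^ (k + 1) / real (k + 1) ^ k" for k
  have c_pos: "c k > 0" for k by (simp add: c_def)
  have prod_c: "(\<Prod>k<Suc n. c k) = real (n + 2) ^ Suc n" for n
  proof (induction n)
    case (Suc n)
    have "(\<Prod>k<Suc (Suc n). c k) = real (n + 2) ^ Suc n * c (Suc n)"
      using Suc.IH by simp
    also have "c (Suc n) = real (n + 3) ^ (n + 2) / real (n + 2) ^ Suc n"
      by (simp add: c_def eval_nat_numeral)
    finally show ?case by (simp add: eval_nat_numeral)
  qed (simp add: c_def)
  have bound: "(\<Prod>k<Suc n. a k) powr (1 / real (Suc n))
      \<le> (\<Sum>k<Suc n. a k * c k) * (1 / real (n + 1) - 1 / real (n + 2))" for n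
  proof -
    have "(\<Prod>k<Suc n. a k * c k) powr (1 / real (card {..<Suc n})) \<le> (\<Sum>k<Suc n. a k * c k / card {..<Suc n})"
      using pos c_pos by (intro arith_geom_mean) (auto intro: less_imp_le mult_nonneg_nonneg)
    then have "((\<Prod>k<Suc n. a k) * real (n + 2) ^ Suc n) powr (1 / real (Suc n))
        \<le> (\<Sum>k<Suc n. a k * c k) / real (Suc n)"
      using prod_c[of n] by (simp only: prod.distrib card_lessThan sum_divide_distrib)
    also have "((\<Prod>k<Suc n. a k) * real (n + 2) ^ Suc n) powr (1 / real (Suc n))
        = (\<Prod>k<Suc n. a k) powr (1 / real (Suc n)) * (real (n + 2) ^ Suc n) powr (1 / real (Suc n))"
      by (rule powr_mult)
    also have "(real (n + 2) ^ Suc n) powr (1 / real (Suc n)) = real (n + 2)"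
      by (simp only: powr_realpow[symmetric] powr_powr) simp
    finally have "(\<Prod>k<Suc n. a k) powr (1 / real (Suc n)) \<le> (\<Sum>k<Suc n. a k * c k) / real (Suc n) / real (n + 2)"
      by (rule pos_le_divide_eq[THEN iffD2, rotated]) simp
    also have "\<dots> = (\<Sum>k<Suc n. a k * c k) * (1 / real (n + 1) - 1 / real (n + 2))"
      by (simp add: field_simps)
    finally show ?thesis .
  qed
  have c_le: "c k / real (k + 1) \<le> exp 1" for k
  proof -
    have "c k / real (k + 1) = (real (k + 2) / real (k + 1)) ^ (k + 1)"
      by (simp add: c_def power_divide)
    also have "real (k + 2) / real (k + 1) = 1 + 1 / real (k + 1)" by (simp add: field_simps)
    also have "(1 + 1 / real (k + 1)) ^ (k + 1) \<le> exp (1 / real (k + 1)) ^ (k + 1)"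
      by (intro power_mono exp_ge_add_one_self) auto
    also have "\<dots> = exp (real (k + 1) * (1 / real (k + 1)))" by (rule exp_of_nat_mult[symmetric])
    also have "\<dots> = exp 1" by simp
    finally show ?thesis .
  qed
  show "(\<Sum>n<N. (\<Prod>k<Suc n. a k) powr (1 / real (Suc n))) \<le> exp 1 * suminf a" for N
  proof -
    \<comment> \<open>Summation by parts; the differences of reciprocals telescope.\<close>
    have "(\<Sum>n<N. (\<Sum>k<Suc n. a k * c k) * (1 / real (n + 1) - 1 / real (n + 2)))
        = (\<Sum>k<N. a k * c k * (1 / real (k + 1))) - (\<Sum>k<N. a k * c k) * (1 / real (N + 1))"
      by (induction N) (simp_all add: algebra_simps)
    also have "\<dots> \<le> (\<Sum>k<N. a k * c k * (1 / real (k + 1)))"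
      using pos c_pos by (auto intro!: sum_nonneg mult_nonneg_nonneg divide_nonneg_nonneg intro: less_imp_le)
    also have "\<dots> \<le> (\<Sum>k<N. a k * exp 1)"
    proof (rule sum_mono)
      fix k
      have "a k * (c k / real (k + 1)) \<le> a k * exp 1"
        using c_le pos by (intro mult_left_mono) (auto intro: less_imp_le)
      then show "a k * c k * (1 / real (k + 1)) \<le> a k * exp 1" by simp
    qed
    also have "\<dots> = exp 1 * (\<Sum>k<N. a k)" by (simp add: sum_distrib_left mult.commute)
    also have "\<dots> \<le> exp 1 * suminf a"
      using pos \<open>summable a\<close> by (intro mult_left_mono sum_le_suminf) (auto intro: less_imp_le)
    finally have "(\<Sum>n<N. (\<Sum>k<Suc n. a k * c k) * (1 / real (n + 1) - 1 / real (n + 2))) \<le> exp 1 * suminf a" .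
    then show ?thesis by (rule order_trans[OF sum_mono[OF bound]])
  qed
qed (use pos in simp)

text \<open>By monotonicity each even term after the first is at most its odd predecessor. The need
  arises from Cauchy-Schwarz, which doubles the order of moments and so reaches only every second
  term of Carleman's series.\<close>

lemma summable_of_odd_subsequence:
  fixes g :: "nat \<Rightarrow> real"
  assumes nonneg: "\<And>n. g n \<ge> 0" and mono: "\<And>n. g (Suc n) \<le> g n"
    and odd: "summable (\<lambda>j. g (2 * j + 1))"
  shows "summable g"
proof (rule summableI_nonneg_bounded)
  show "(\<Sum>k<n. g k) \<le> g 0 + 2 * (\<Sum>j. g (2 * j + 1))" for n
  proof -
    have "(\<Sum>k<n. g k) \<le> (\<Sum>k<2 * n + 1. g k)"
      using nonneg by (intro sum_mono2) auto
    also have "\<dots> \<le> g 0 + 2 * (\<Sum>j<n. g (2 * j + 1))"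
    proof (induction n)
      case (Suc n)
      then show ?case using mono[of "2 * n + 1"] by simp
    qed simp
    also have "(\<Sum>j<n. g (2 * j + 1)) \<le> (\<Sum>j. g (2 * j + 1))"
      using nonneg odd by (intro sum_le_suminf) auto
    finally show ?thesis by simp
  qed
qed (rule nonneg)

section \<open>Complexification, orthogonal polynomials and their values at the imaginary
  unit\<close>

definition cscale :: "complex \<Rightarrow> 'a::real_vector \<Rightarrow> 'a \<times> 'a" where
  "cscale w x = (Re w *\<^sub>R x, Im w *\<^sub>R x)"

lemma cscale_diff_left: "cscale (v - w) x = cscale v x - cscale w x"
  and cscale_add_left: "cscale (v + w) x = cscale v x + cscale w x"
  and cscale_diff: "cscale w (x - y) = cscale w x - cscale w y"
  by (simp_all add: cscale_def algebra_simps)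

lemma cscale_scaleR_right: "cscale w (c *\<^sub>R x) = cscale (of_real c * w) x"
  by (simp add: cscale_def mult.commute)

lemma cscale_sum_left: "cscale (\<Sum>k\<in>S. w k) x = (\<Sum>k\<in>S. cscale (w k) x)"
  by (induction S rule: infinite_finite_induct)
    (simp_all add: cscale_add_left, simp_all add: cscale_def zero_prod_def)

text \<open>Pairs \<open>(p, q)\<close> stand for \<open>p + \<i> q\<close> in the complexification of the algebra; this is the
  ideal generated by \<open>t - \<i>\<close>.\<close>

definition shifted_ideal :: "'a::{real_algebra, comm_monoid_mult} \<Rightarrow> ('a \<times> 'a) set" where
  "shifted_ideal t = range (\<lambda>(x, y). (t * x + y, t * y - x))"

lemma subspace_shifted_ideal: "subspace (shifted_ideal t)"
proof -
  have "linear (\<lambda>(x, y). (t * x + y, t * y - x))"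
    by (rule linearI) (auto simp: algebra_simps)
  from linear_subspace_image[OF this subspace_UNIV] show ?thesis by (simp add: shifted_ideal_def)
qed

lemma shifted_ideal_generator: "cscale w (t * x) - cscale (\<i> * w) x \<in> shifted_ideal t"
  unfolding shifted_ideal_def
  by (rule range_eqI[of _ _ "(Re w *\<^sub>R x, Im w *\<^sub>R x)"]) (simp add: cscale_def)

locale orthogonal_polynomials = positive_functional L
  for L :: "'a::{real_algebra, comm_monoid_mult} \<Rightarrow> real" +
  fixes t :: 'a
begin

text \<open>Monic orthogonal polynomials of the functional that sends a polynomial \<open>p\<close>
  to \<open>L\<close> of \<open>p(t)\<close>, generated by their three-term recurrence and evaluated
  at \<open>t\<close>. A division by a vanishing norm yields 0; orthogonality is claimed only as
  long as the earlier norms are positive.\<close>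

fun mop :: "nat \<Rightarrow> 'a" where
  "mop 0 = 1"
| "mop (Suc 0) = t - (L t / L 1) *\<^sub>R 1"
| "mop (Suc (Suc n)) = t * mop (Suc n)
     - (L (t * mop (Suc n) * mop (Suc n)) / L (mop (Suc n) * mop (Suc n))) *\<^sub>R mop (Suc n)
     - (L (mop (Suc n) * mop (Suc n)) / L (mop n * mop n)) *\<^sub>R mop n"

definition h :: "nat \<Rightarrow> real" where "h n = L (mop n * mop n)"

definition \<alpha> :: "nat \<Rightarrow> real" where "\<alpha> n = L (t * mop n * mop n) / h n"

text \<open>With value 0 at index 0 the recurrence has one form for all \<open>n\<close>: there
  \<open>n - 1\<close> is again 0, and the spurious term drops out.\<close>

definition \<beta> :: "nat \<Rightarrow> real" where "\<beta> n = (case n of 0 \<Rightarrow> 0 | Suc m \<Rightarrow> h (Suc m) / h m)"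

lemma mop_Suc: "mop (Suc n) = t * mop n - \<alpha> n *\<^sub>R mop n - \<beta> n *\<^sub>R mop (n - 1)"
  by (cases n) (simp_all add: \<alpha>_def \<beta>_def h_def)

declare mop.simps(2,3) [simp del]

lemma t_mop: "t * mop n = mop (Suc n) + \<alpha> n *\<^sub>R mop n + \<beta> n *\<^sub>R mop (n - 1)"
  by (simp add: mop_Suc)

lemma h_nonneg: "h n \<ge> 0"
  unfolding h_def by (rule square_nonneg)

text \<open>For \<open>k < m\<close>, moving \<open>t\<close> from \<open>mop m\<close> to
  \<open>mop k\<close> and expanding leaves only the case \<open>Suc k = m\<close>, which the choice
  of \<open>\<beta> m\<close> cancels; for \<open>k = m\<close> the choice of
  \<open>\<alpha> m\<close> does. The last norm \<open>h n\<close> may vanish, which the degenerate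
  case relies on.\<close>

lemma orthogonal:
  assumes "\<And>k. k < n \<Longrightarrow> h k > 0" and "m \<le> n" and "k < m"
  shows "L (mop m * mop k) = 0"
  using assms(2,3)
proof (induction m arbitrary: k rule: less_induct)
  case (less m')
  then obtain m where m': "m' = Suc m" by (cases m') auto
  have hm: "h m > 0" using assms(1)[of m] less.prems m' by simp
  have IH: "L (mop i * mop j) = 0" if "j < i" "i \<le> m" for i j
    using less.IH[of i j] that less.prems m' by simp
  have expand: "L (mop (Suc m) * mop k) = L (t * mop m * mop k) - \<alpha> m * L (mop m * mop k) - \<beta> m * L (mop (m - 1) * mop k)"
    unfolding mop_Suc by (simp add: left_diff_distrib L_simps)
  consider "k = m" | "k < m" using less.prems m' by linarith
  then show ?case
  proof cases
    case 1
    have "\<beta> m * L (mop (m - 1) * mop m) = 0"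
      using IH[of "m - 1" m] by (cases m) (simp_all add: \<beta>_def mult.commute)
    moreover have "L (t * mop m * mop m) = \<alpha> m * L (mop m * mop m)"
      using hm by (simp add: \<alpha>_def flip: h_def)
    ultimately show ?thesis using expand 1 m' by simp
  next
    case 2
    have k1: "\<beta> k * L (mop m * mop (k - 1)) = 0"
      using IH[of "k - 1" m] 2 by (cases k) (simp_all add: \<beta>_def)
    have "t * mop m * mop k = mop m * (t * mop k)" by (simp add: ac_simps)
    also have "L \<dots> = L (mop m * mop (Suc k)) + \<alpha> k * L (mop m * mop k) + \<beta> k * L (mop m * mop (k - 1))"
      unfolding t_mop by (simp add: distrib_left L_simps)
    finally have "L (t * mop m * mop k) = L (mop m * mop (Suc k))"
      using k1 IH[OF 2] by simp
    moreover have "L (mop m * mop (Suc k)) = \<beta> m * L (mop (m - 1) * mop k)"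
    proof (cases "Suc k = m")
      case True
      have "h k > 0" using assms(1)[of k] less.prems m' by simp
      then show ?thesis using True by (auto simp: \<beta>_def h_def)
    next
      case False
      then show ?thesis using 2 IH[of "Suc k" m] IH[of k "m - 1"] by simp
    qed
    ultimately show ?thesis using expand IH[OF 2] m' by simp
  qed
qed

text \<open>\<open>t ^ k * mop j\<close> is monic of degree \<open>j + k\<close>, and
  \<open>mop n\<close> is orthogonal to lower degrees.\<close>

lemma L_power_mop:
  assumes "\<And>k. k < n \<Longrightarrow> h k > 0" and "j + k \<le> n"
  shows "L (t ^ k * mop j * mop n) = (if j + k = n then h n else 0)"
  using assms(2)
proof (induction k arbitrary: j)
  case 0
  then show ?case
    using orthogonal[OF assms(1), of n n j] by (auto simp: h_def mult.commute)
next
  case (Suc k)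
  have "t ^ Suc k * mop j * mop n = t ^ k * (t * mop j) * mop n" by (simp add: ac_simps)
  also have "L \<dots> = L (t ^ k * mop (Suc j) * mop n) + \<alpha> j * L (t ^ k * mop j * mop n)
      + \<beta> j * L (t ^ k * mop (j - 1) * mop n)"
    unfolding t_mop by (simp add: distrib_left distrib_right L_simps)
  also have "\<dots> = (if j + Suc k = n then h n else 0)"
    using Suc.prems Suc.IH[of "Suc j"] Suc.IH[of j] Suc.IH[of "j - 1"] by auto
  finally show ?case .
qed

text \<open>Among monic polynomials of degree \<open>n\<close>, \<open>mop n\<close> has the least
  norm; Cauchy-Schwarz against \<open>t ^ n\<close> shows it, as their product has value
  \<open>h n\<close>.\<close>

lemma h_le_moment:
  assumes "\<And>k. k < n \<Longrightarrow> h k > 0"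
  shows "h n \<le> L (t ^ n * t ^ n)"
proof -
  have "L (t ^ n * mop n) = h n" using L_power_mop[OF assms, of n 0 n] by simp
  then have "h n * h n \<le> L (t ^ n * t ^ n) * h n"
    using cauchy_schwarz[of "t ^ n" "mop n"] by (simp add: h_def power2_eq_square)
  then show ?thesis
    using h_nonneg[of n] square_nonneg[of "t ^ n"] by (cases "h n = 0") simp_all
qed

text \<open>The recurrence of \<open>mop\<close> with \<open>\<i>\<close> in place of
  \<open>t\<close>: values of the same polynomials at \<open>\<i>\<close>.\<close>

fun z :: "nat \<Rightarrow> complex" where
  "z 0 = 1"
| "z (Suc 0) = \<i> - of_real (\<alpha> 0)"
| "z (Suc (Suc n)) = (\<i> - of_real (\<alpha> (Suc n))) * z (Suc n) - of_real (\<beta> (Suc n)) * z n"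

lemma z_Suc: "z (Suc n) = (\<i> - of_real (\<alpha> n)) * z n - of_real (\<beta> n) * z (n - 1)"
  by (cases n) (simp_all add: \<beta>_def)

declare z.simps(2,3) [simp del]

lemma mop_congruent_z: "cscale w (mop n) - cscale (w * z n) 1 \<in> shifted_ideal t"
proof (induction n arbitrary: w rule: less_induct)
  case (less n)
  note sub = subspace_shifted_ideal[of t]
  show ?case
  proof (cases n)
    case 0
    then show ?thesis using subspace_0[OF sub] by simp
  next
    case (Suc m)
    have 1: "cscale w (t * mop m) - cscale (\<i> * w) (mop m) \<in> shifted_ideal t"
      by (rule shifted_ideal_generator)
    have 2: "cscale v (mop m) - cscale (v * z m) 1 \<in> shifted_ideal t"
      "cscale v (mop (m - 1)) - cscale (v * z (m - 1)) 1 \<in> shifted_ideal t" for v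
      using Suc by (auto intro: less)
    have "cscale w (mop n) - cscale (w * z n) 1 =
        (cscale w (t * mop m) - cscale (\<i> * w) (mop m))
        + (cscale (\<i> * w) (mop m) - cscale (\<i> * w * z m) 1)
        - (cscale (of_real (\<alpha> m) * w) (mop m) - cscale (of_real (\<alpha> m) * w * z m) 1)
        - (cscale (of_real (\<beta> m) * w) (mop (m - 1)) - cscale (of_real (\<beta> m) * w * z (m - 1)) 1)"
      unfolding Suc mop_Suc z_Suc
      by (simp add: cscale_diff cscale_scaleR_right right_diff_distrib left_diff_distrib
          cscale_diff_left mult.assoc mult.left_commute mult.commute)
    then show ?thesis
      by (simp only:)
        (rule subspace_diff[OF sub subspace_diff[OF sub subspace_add[OF sub 1 2(1)] 2(1)] 2(2)])
  qed
qed

text \<open>The Christoffel-Darboux kernel at \<open>\<i>\<close>, a sum of squared moduli of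
  orthonormal polynomials. If all norms are positive, \<open>1 / K n\<close> is the least squared
  norm of a polynomial of degree at most \<open>n\<close> with value 1 at
  \<open>\<i>\<close>.\<close>

definition K :: "nat \<Rightarrow> real" where "K n = (\<Sum>k\<le>n. (cmod (z k))\<^sup>2 / h k)"

text \<open>Multiplying the recurrence by the conjugate of \<open>z (Suc n)\<close> and taking
  imaginary parts eliminates the real coefficient \<open>\<alpha>\<close>, and
  \<open>\<beta> (Suc n) * h n = h (Suc n)\<close> closes the induction.\<close>

lemma christoffel_darboux:
  assumes "\<And>k. k \<le> n \<Longrightarrow> h k > 0"
  shows "Im (z (Suc n) * cnj (z n)) = h n * K n"
  using assms
proof (induction n)
  case 0
  then show ?case by (simp add: z_Suc \<beta>_def K_def)
next
  case (Suc n)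
  have IH: "Im (z (Suc n) * cnj (z n)) = h n * K n"
    using Suc by simp
  have "Im (z (Suc (Suc n)) * cnj (z (Suc n)))
      = (cmod (z (Suc n)))\<^sup>2 + \<beta> (Suc n) * Im (z (Suc n) * cnj (z n))"
    unfolding z_Suc[of "Suc n"]
    by (simp add: algebra_simps power2_eq_square cmod_power2[unfolded power2_eq_square])
  then show ?case unfolding IH
    using Suc.prems[of n] Suc.prems[of "Suc n"] by (simp add: \<beta>_def K_def field_simps)
qed

lemma K_lower_bound:
  assumes "h 0 > 0"
  shows "K n \<ge> 1 / h 0"
proof -
  have "(\<Sum>k\<in>{0}. (cmod (z k))\<^sup>2 / h k) \<le> K n"
    unfolding K_def by (rule sum_mono2) (auto simp: h_nonneg)
  then show ?thesis by simp
qed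

lemma L_sum_square:
  assumes "\<And>k. k < n \<Longrightarrow> h k > 0"
  shows "L ((\<Sum>k\<le>n. c k *\<^sub>R mop k) * (\<Sum>k\<le>n. c k *\<^sub>R mop k)) = (\<Sum>k\<le>n. (c k)\<^sup>2 * h k)"
proof -
  have "L ((\<Sum>k\<le>m. c k *\<^sub>R mop k) * (\<Sum>k\<le>m. c k *\<^sub>R mop k)) = (\<Sum>k\<le>m. (c k)\<^sup>2 * h k)"
    if "m \<le> n" for m using that
  proof (induction m)
    case 0
    then show ?case by (simp add: h_def L_simps power2_eq_square)
  next
    case (Suc m)
    let ?s = "\<Sum>k\<le>m. c k *\<^sub>R mop k"
    have "L (mop (Suc m) * ?s) = (\<Sum>k\<le>m. c k * L (mop (Suc m) * mop k))"
      by (simp add: sum_distrib_left linear_sum[OF linear] L_simps)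
    also have "\<dots> = 0"
      using orthogonal[OF assms Suc.prems] by (intro sum.neutral) auto
    finally have 0: "L (mop (Suc m) * ?s) = 0" .
    have "(?s + c (Suc m) *\<^sub>R mop (Suc m)) * (?s + c (Suc m) *\<^sub>R mop (Suc m))
        = ?s * ?s + (c (Suc m))\<^sup>2 *\<^sub>R (mop (Suc m) * mop (Suc m))
          + c (Suc m) *\<^sub>R (mop (Suc m) * ?s) + c (Suc m) *\<^sub>R (mop (Suc m) * ?s)"
      by (simp only: distrib_left distrib_right mult_scaleR_left mult_scaleR_right power2_eq_square
          scaleR_scaleR add_ac mult_ac)
    then show ?case using Suc 0 by (simp add: L_simps h_def)
  qed
  then show ?thesis by simp
qed

text \<open>A complex combination of the \<open>mop k\<close> with value 1 at \<open>\<i>\<close>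
  has the form \<open>1 - (t - \<i>) * (x + \<i> * y)\<close>. The two squares belong to its real
  and imaginary parts, and orthogonality evaluates their sum.\<close>

lemma approximate_of_combination:
  assumes "\<And>k. k < n \<Longrightarrow> h k > 0" and "(\<Sum>k\<le>n. w k * z k) = 1"
  shows "\<exists>x y. L ((1 - (t * x + y)) * (1 - (t * x + y))) + L ((x - t * y) * (x - t * y))
     = (\<Sum>k\<le>n. (cmod (w k))\<^sup>2 * h k)"
proof -
  note sub = subspace_shifted_ideal[of t]
  have "(\<Sum>k\<le>n. cscale (w k) (mop k) - cscale (w k * z k) 1) \<in> shifted_ideal t"
    by (rule subspace_sum[OF sub]) (rule mop_congruent_z)
  moreover have "(\<Sum>k\<le>n. cscale (w k * z k) 1) = (1, 0 :: 'a)"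
    by (simp flip: cscale_sum_left add: assms(2)) (simp add: cscale_def)
  ultimately have "(\<Sum>k\<le>n. cscale (w k) (mop k)) - (1, 0) \<in> shifted_ideal t"
    by (simp add: sum_subtractf)
  then have "- ((\<Sum>k\<le>n. cscale (w k) (mop k)) - (1, 0)) \<in> shifted_ideal t"
    by (rule subspace_neg[OF sub])
  then obtain x y where "- ((\<Sum>k\<le>n. cscale (w k) (mop k)) - (1, 0)) = (t * x + y, t * y - x)"
    unfolding shifted_ideal_def by auto
  then have "(\<Sum>k\<le>n. cscale (w k) (mop k)) = (1, 0) - (t * x + y, t * y - x)"
    by (simp flip: \<open>_ = (t * x + y, t * y - x)\<close>)
  then have sum: "(\<Sum>k\<le>n. cscale (w k) (mop k)) = (1 - (t * x + y), x - t * y)"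
    by simp
  have "1 - (t * x + y) = (\<Sum>k\<le>n. Re (w k) *\<^sub>R mop k)" "x - t * y = (\<Sum>k\<le>n. Im (w k) *\<^sub>R mop k)"
    using arg_cong[OF sum, of fst] arg_cong[OF sum, of snd]
    by (simp_all add: fst_sum snd_sum cscale_def)
  then have "L ((1 - (t * x + y)) * (1 - (t * x + y))) + L ((x - t * y) * (x - t * y))
      = (\<Sum>k\<le>n. (Re (w k))\<^sup>2 * h k) + (\<Sum>k\<le>n. (Im (w k))\<^sup>2 * h k)"
    by (simp only: L_sum_square[OF assms(1)])
  then show ?thesis
    by (intro exI[of _ x] exI[of _ y]) (simp add: cmod_power2 distrib_right sum.distrib)
qed

end

section \<open>Carleman's condition\<close>

context orthogonal_polynomials
begin

text \<open>The first polynomial of norm zero, divided by its value at \<open>\<i>\<close>, gives an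
  exact solution. That value is nonzero because its product with the conjugate of the preceding one
  has positive imaginary part.\<close>

lemma approximate_of_degenerate:
  assumes "\<And>k. k < n \<Longrightarrow> h k > 0" "h n = 0"
  shows "\<exists>x y. L ((1 - (t * x + y)) * (1 - (t * x + y))) + L ((x - t * y) * (x - t * y)) = 0"
proof -
  have "z n \<noteq> 0"
  proof (cases n)
    case (Suc m)
    have "Im (z n * cnj (z m)) = h m * K m"
      using christoffel_darboux[of m] assms(1) Suc by simp
    moreover have "h m * K m > 0"
      using K_lower_bound[of m] assms(1)[of m] assms(1)[of 0] Suc
      by (intro mult_pos_pos) (auto intro: less_le_trans[of 0 "1 / h 0"])
    ultimately show ?thesis by auto
  qed simp
  then have "(\<Sum>k\<le>n. (if k = n then 1 / z n else 0) * z k) = 1"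
    by (subst sum.remove[of _ n]) auto
  from approximate_of_combination[OF assms(1) this]
  show ?thesis using assms(2) by (simp add: if_distrib[of cmod] if_distrib[of "\<lambda>x. x\<^sup>2"] if_distrib[of "\<lambda>x. x * _"] cong: if_cong)
qed

lemma approximate_of_nondegenerate:
  assumes "\<And>k. h k > 0"
  shows "\<exists>x y. L ((1 - (t * x + y)) * (1 - (t * x + y))) + L ((x - t * y) * (x - t * y)) = 1 / K n"
proof -
  have K: "K n > 0" using K_lower_bound[of n] assms[of 0] by (auto intro: less_le_trans[of 0 "1 / h 0"])
  \<comment> \<open>The equality case of Cauchy-Schwarz: these coefficients minimize the weighted
    sum of \<open>(cmod (w k))^2\<close> under the constraint that the value at \<open>\<i>\<close>
    is 1.\<close>
  define w where "w k = cnj (z k) / of_real (h k * K n)" for k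
  have "w k * z k = of_real ((cmod (z k))\<^sup>2 / h k / K n)" for k
  proof -
    have "cnj (z k) * z k = of_real ((cmod (z k))\<^sup>2)"
      by (metis complex_norm_square mult.commute)
    then show ?thesis by (simp add: w_def)
  qed
  then have "(\<Sum>k\<le>n. w k * z k) = of_real ((\<Sum>k\<le>n. (cmod (z k))\<^sup>2 / h k) / K n)"
    by (simp add: sum_divide_distrib)
  then have "(\<Sum>k\<le>n. w k * z k) = 1" using K by (simp flip: K_def)
  from approximate_of_combination[OF assms this]
  have "\<exists>x y. L ((1 - (t * x + y)) * (1 - (t * x + y))) + L ((x - t * y) * (x - t * y))
      = (\<Sum>k\<le>n. (cmod (w k))\<^sup>2 * h k)" .
  moreover have "(cmod (w k))\<^sup>2 * h k = (cmod (z k))\<^sup>2 / h k / (K n)\<^sup>2" for k :: nat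
    using assms[of k] K
    by (simp add: w_def norm_divide norm_mult power_divide power_mult_distrib power2_eq_square)
  then have "(\<Sum>k\<le>n. (cmod (w k))\<^sup>2 * h k) = K n / (K n)\<^sup>2"
    by (simp add: K_def sum_divide_distrib)
  then have "(\<Sum>k\<le>n. (cmod (w k))\<^sup>2 * h k) = 1 / K n"
    using K by (simp add: power2_eq_square)
  ultimately show ?thesis by simp
qed

text \<open>Since \<open>K n \<ge> 1 / h 0\<close>, the Christoffel-Darboux identity bounds
  \<open>sqrt (h n / h (Suc n))\<close> by \<open>h 0\<close> times a product of neighbouring terms
  of a square-summable sequence. Products of these ratios telescope, Carleman's inequality makes
  their roots summable, and the moments dominate \<open>h\<close>.\<close>

lemma summable_moments_of_bounded_K:
  assumes "\<And>k. h k > 0" and bdd: "\<And>n. K n \<le> C"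
  shows "summable (\<lambda>n. L (t ^ Suc n * t ^ Suc n) powr (- 1 / (2 * real (Suc n))))"
proof -
  define u where "u n = cmod (z n) / sqrt (h n)" for n
  have "summable (\<lambda>n. (u n)\<^sup>2)"
  proof (rule summableI_nonneg_bounded)
    show "(\<Sum>k<n. (u k)\<^sup>2) \<le> C" for n
    proof -
      have "(\<Sum>k<n. (u k)\<^sup>2) \<le> (\<Sum>k\<le>n. (u k)\<^sup>2)" by (intro sum_mono2) auto
      also have "\<dots> = K n" using h_nonneg by (simp add: u_def K_def power_divide)
      finally show ?thesis using bdd[of n] by simp
    qed
  qed simp
  then have S: "summable (\<lambda>n. h 0 / 2 * ((u n)\<^sup>2 + (u (Suc n))\<^sup>2))"
    by (intro summable_mult summable_add summable_Suc_iff[of "\<lambda>n. (u n)\<^sup>2", THEN iffD2])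
  have ratio: "sqrt (h n / h (Suc n)) \<le> h 0 / 2 * ((u n)\<^sup>2 + (u (Suc n))\<^sup>2)" for n
  proof -
    have "h n * (1 / h 0) \<le> h n * K n"
      using assms(1)[of n] K_lower_bound[OF assms(1)] by (intro mult_left_mono) auto
    also have "h n * K n = Im (z (Suc n) * cnj (z n))"
      using christoffel_darboux assms(1) by simp
    also have "\<dots> \<le> cmod (z (Suc n)) * cmod (z n)"
      by (metis abs_Im_le_cmod abs_le_D1 complex_mod_cnj norm_mult)
    also have "\<dots> = u (Suc n) * u n * (sqrt (h (Suc n)) * sqrt (h n))"
      using assms(1)[of n] assms(1)[of "Suc n"] by (simp add: u_def)
    finally have "sqrt (h n) * sqrt (h n) * (1 / h 0) \<le> u (Suc n) * u n * (sqrt (h (Suc n)) * sqrt (h n))"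
      using assms(1)[of n] by simp
    then have "sqrt (h n) * sqrt (h n) \<le> h 0 * (u (Suc n) * u n) * sqrt (h (Suc n)) * sqrt (h n)"
      using assms(1)[of 0] by (simp add: field_simps)
    then have "sqrt (h n) \<le> h 0 * (u (Suc n) * u n) * sqrt (h (Suc n))"
      using assms(1)[of n] by (meson mult_right_le_imp_le real_sqrt_gt_zero)
    then have "sqrt (h n / h (Suc n)) \<le> h 0 * (u (Suc n) * u n)"
      using assms(1)[of "Suc n"] by (simp add: real_sqrt_divide pos_divide_le_eq)
    also have "\<dots> \<le> h 0 * (((u n)\<^sup>2 + (u (Suc n))\<^sup>2) / 2)"
      using assms(1)[of 0] sum_squares_bound[of "u n" "u (Suc n)"]
      by (intro mult_left_mono) (auto simp: algebra_simps)
    finally show ?thesis by simp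
  qed
  have "norm (sqrt (h n / h (Suc n))) \<le> h 0 / 2 * ((u n)\<^sup>2 + (u (Suc n))\<^sup>2)" for n
    using ratio[of n] h_nonneg by simp
  then have "summable (\<lambda>n. sqrt (h n / h (Suc n)))"
    by (rule summable_comparison_test'[OF S])
  then have "summable (\<lambda>n. (\<Prod>k<Suc n. sqrt (h k / h (Suc k))) powr (1 / real (Suc n)))"
    using assms(1) by (intro carleman_inequality) auto
  moreover have prod: "(\<Prod>k<n. sqrt (h k / h (Suc k))) = sqrt (h 0 / h n)" for n
  proof (induction n)
    case (Suc n)
    then show ?case using assms(1)[of n] by (simp add: real_sqrt_divide)
  qed (use assms(1)[of 0] in simp)
  ultimately have 1: "summable (\<lambda>n. sqrt (h 0 / h (Suc n)) powr (1 / real (Suc n)))"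
    by (simp only:)
  \<comment> \<open>For exponents \<open>r\<close> in \<open>(0, 1]\<close> this gives
    \<open>c \<le> c powr r \<le> h 0 powr r\<close>, hence one constant for all
    \<open>n\<close>.\<close>
  define c where "c = min 1 (h 0)"
  have c: "0 < c" "c \<le> 1" "c \<le> h 0" using assms(1)[of 0] by (auto simp: c_def)
  have "c * L (t ^ Suc n * t ^ Suc n) powr (- 1 / (2 * real (Suc n)))
      \<le> sqrt (h 0 / h (Suc n)) powr (1 / real (Suc n))" for n
  proof -
    let ?r = "1 / (2 * real (Suc n))"
    have le: "h (Suc n) \<le> L (t ^ Suc n * t ^ Suc n)" using assms(1) by (intro h_le_moment)
    then have pos: "0 < L (t ^ Suc n * t ^ Suc n)" using assms(1)[of "Suc n"] by linarith
    have "c powr 1 \<le> c powr ?r" using c by (intro powr_mono') auto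
    also have "\<dots> \<le> h 0 powr ?r" using c by (intro powr_mono2) auto
    finally have "c \<le> h 0 powr ?r" using c by simp
    then have "c * L (t ^ Suc n * t ^ Suc n) powr (- ?r) \<le> h 0 powr ?r * L (t ^ Suc n * t ^ Suc n) powr (- ?r)"
      by (intro mult_right_mono) auto
    also have "\<dots> \<le> h 0 powr ?r * h (Suc n) powr (- ?r)"
      using le assms(1)[of "Suc n"] by (intro mult_left_mono powr_mono2') auto
    also have "\<dots> = (h 0 / h (Suc n)) powr ?r"
      using assms(1)[of 0] assms(1)[of "Suc n"] by (simp add: powr_divide powr_minus_divide)
    also have "\<dots> = sqrt (h 0 / h (Suc n)) powr (1 / real (Suc n))"
      using assms(1)[of 0] assms(1)[of "Suc n"] by (simp add: powr_half_sqrt[symmetric] powr_powr)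
    finally show ?thesis by simp
  qed
  then have "summable (\<lambda>n. c * L (t ^ Suc n * t ^ Suc n) powr (- 1 / (2 * real (Suc n))))"
    by (intro summable_comparison_test'[OF 1, of 0]) (use c in auto)
  then show ?thesis using c by (simp add: summable_cmult_iff)
qed

text \<open>Either some norm vanishes and the error can be made 0, or all norms are positive; in the
  latter case so are the moments, and divergence of the series makes \<open>K\<close>
  unbounded.\<close>

lemma resolvent_approximate:
  assumes nonsummable: "(\<And>n. L (t ^ Suc n * t ^ Suc n) > 0) \<Longrightarrow>
      \<not> summable (\<lambda>n. L (t ^ Suc n * t ^ Suc n) powr (- 1 / (2 * real (Suc n))))"
    and "\<delta> > 0"
  shows "\<exists>x y. L ((1 - (t * x + y)) * (1 - (t * x + y))) + L ((x - t * y) * (x - t * y)) < \<delta>"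
proof (cases "\<exists>n. h n = 0")
  case True
  define n where "n = (LEAST n. h n = 0)"
  have "h n = 0" using True unfolding n_def by (rule LeastI_ex)
  moreover have "h k > 0" if "k < n" for k
    using not_less_Least[of k "\<lambda>n. h n = 0"] that h_nonneg[of k] by (simp add: n_def)
  ultimately show ?thesis using approximate_of_degenerate \<open>\<delta> > 0\<close> by metis
next
  case False
  then have pos: "h k > 0" for k using h_nonneg[of k] by (metis less_eq_real_def)
  then have "L (t ^ Suc n * t ^ Suc n) > 0" for n
    using h_le_moment[of "Suc n"] by (meson less_le_trans)
  then have "\<exists>n. K n > 1 / \<delta>"
    using nonsummable summable_moments_of_bounded_K[OF pos, of "1 / \<delta>"] by (meson not_le)
  then obtain n where n: "K n > 1 / \<delta>" ..
  have "0 < 1 / \<delta>" using \<open>\<delta> > 0\<close> by simp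
  then have "0 < K n" using n by linarith
  then have less: "1 / K n < \<delta>"
    using n \<open>\<delta> > 0\<close> by (simp add: pos_divide_less_eq mult.commute)
  obtain x y where eq: "L ((1 - (t * x + y)) * (1 - (t * x + y))) + L ((x - t * y) * (x - t * y)) = 1 / K n"
    using approximate_of_nondegenerate[OF pos, of n] by blast
  show ?thesis using less unfolding eq[symmetric] by (intro exI)
qed

end

section \<open>Passing Carleman's condition on to weighted functionals\<close>

context positive_functional
begin

lemma carleman_imp_not_summable:
  assumes "carleman L t" "\<And>n. L (t ^ (2 * Suc n)) > 0"
  shows "\<not> summable (\<lambda>n. L (t ^ (2 * Suc n)) powr (- 1 / (2 * real (Suc n))))"
proof
  assume summable: "summable (\<lambda>n. L (t ^ (2 * Suc n)) powr (- 1 / (2 * real (Suc n))))"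
  have "(\<Sum>k. ennreal (L (t ^ (2 * Suc k)) powr (- 1 / (2 * real (Suc k))))) = \<infinity>"
    using assms(1) unfolding carleman_def Let_def
    by (simp only: less_imp_neq[OF assms(2), symmetric] if_False)
  moreover have "(\<Sum>k. ennreal (L (t ^ (2 * Suc k)) powr (- 1 / (2 * real (Suc k))))) < \<infinity>"
    unfolding suminf_ennreal2[OF powr_ge_zero summable] by simp
  ultimately show False by simp
qed

lemma power_double: "x ^ (2 * n) = x ^ n * x ^ n" for x :: 'a
  by (simp add: mult_2 power_add)

text \<open>Lyapunov's inequality: Cauchy-Schwarz makes the even moments log-convex, and the
  normalization of the zeroth moment turns this into monotonicity of the roots.\<close>

lemma moment_root_mono:
  assumes pos: "\<And>n. L (t ^ (2 * n)) > 0" and one: "L 1 = 1"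
  shows "L (t ^ (2 * Suc (Suc n))) powr (- 1 / (2 * real (Suc (Suc n))))
    \<le> L (t ^ (2 * Suc n)) powr (- 1 / (2 * real (Suc n)))"
proof -
  define s where "s n = L (t ^ (2 * n))" for n
  have s_pos: "s n > 0" for n using pos by (simp add: s_def)
  have convex: "s (Suc n) * s (Suc n) \<le> s n * s (Suc (Suc n))" for n
  proof -
    have "t ^ n * t ^ Suc (Suc n) = t ^ (2 * Suc n)"
      unfolding power_double by (simp add: ac_simps)
    with cauchy_schwarz[of "t ^ n" "t ^ Suc (Suc n)"] show ?thesis
      unfolding s_def power_double power2_eq_square by (simp only:)
  qed
  have mono: "s n ^ Suc n \<le> s (Suc n) ^ n" for n
  proof (induction n)
    case 0
    then show ?case using one by (simp add: s_def)
  next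
    case (Suc n)
    have "s (Suc n) ^ Suc (Suc n) * s (Suc n) ^ n = (s (Suc n) * s (Suc n)) ^ Suc n"
      by (simp add: power_mult_distrib)
    also have "\<dots> \<le> (s n * s (Suc (Suc n))) ^ Suc n"
      using convex s_pos by (intro power_mono) (auto intro: less_imp_le)
    also have "\<dots> \<le> s (Suc n) ^ n * s (Suc (Suc n)) ^ Suc n"
      unfolding power_mult_distrib using Suc.IH s_pos
      by (intro mult_right_mono) (auto intro: less_imp_le)
    finally show ?case using s_pos[of "Suc n"] by (simp add: mult.commute)
  qed
  have "s (Suc n) powr (1 / (2 * real (Suc n)))
      = (s (Suc n) ^ Suc (Suc n)) powr (1 / (2 * real (Suc n) * real (Suc (Suc n))))"
    using s_pos[of "Suc n"] by (simp only: powr_realpow[symmetric] powr_powr) simp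
  also have "\<dots> \<le> (s (Suc (Suc n)) ^ Suc n) powr (1 / (2 * real (Suc n) * real (Suc (Suc n))))"
    using mono[of "Suc n"] s_pos by (intro powr_mono2) (auto intro!: zero_le_power less_imp_le)
  also have "\<dots> = s (Suc (Suc n)) powr (1 / (2 * real (Suc (Suc n))))"
  proof -
    have "real (Suc n) * (1 / (2 * real (Suc n) * real (Suc (Suc n)))) = 1 / (2 * real (Suc (Suc n)))"
      by (simp add: divide_simps del: of_nat_Suc)
    then show ?thesis
      using s_pos[of "Suc (Suc n)"] by (simp only: powr_realpow[symmetric] powr_powr)
  qed
  finally have "s (Suc n) powr (1 / (2 * real (Suc n))) \<le> s (Suc (Suc n)) powr (1 / (2 * real (Suc (Suc n))))" .
  then have "inverse (s (Suc (Suc n)) powr (1 / (2 * real (Suc (Suc n)))))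
      \<le> inverse (s (Suc n) powr (1 / (2 * real (Suc n))))"
    using s_pos[of "Suc n"] by (intro le_imp_inverse_le) auto
  then show ?thesis unfolding s_def by (simp only: powr_minus[symmetric] minus_divide_left)
qed

text \<open>Cauchy-Schwarz bounds the moment of order \<open>2 * n\<close> of the weighted
  functional by the square root of the moment of order \<open>4 * n\<close> of \<open>L\<close>, up
  to a factor. Convergence for the weighted functional would thus give convergence along every
  second term for \<open>L\<close>; monotonicity, after normalizing \<open>L\<close>, fills the gaps
  and contradicts Carleman's condition.\<close>

lemma carleman_approximate:
  assumes carleman: "carleman L t" and "v \<in> sos" "\<delta> > 0"
  shows "\<exists>x y. L (v * ((1 - (t * x + y)) * (1 - (t * x + y)))) + L (v * ((x - t * y) * (x - t * y))) < \<delta>"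
proof -
  define M where "M x = L (v * x)" for x
  interpret M: orthogonal_polynomials M t
    unfolding M_def orthogonal_polynomials_def by (rule shift) fact
  have "\<not> summable (\<lambda>n. M (t ^ Suc n * t ^ Suc n) powr (- 1 / (2 * real (Suc n))))"
    if M_pos: "\<And>n. M (t ^ Suc n * t ^ Suc n) > 0"
  proof
    assume summable_M: "summable (\<lambda>n. M (t ^ Suc n * t ^ Suc n) powr (- 1 / (2 * real (Suc n))))"
    have L1: "L 1 > 0"
    proof (rule ccontr)
      assume "\<not> L 1 > 0"
      then have "L 1 = 0" using one_nonneg by simp
      then have "L x = 0" for x using cauchy_schwarz[of x 1] by simp
      then show False using M_pos[of 0] by (simp add: M_def)
    qed
    \<comment> \<open>A vanishing moment of \<open>L\<close> would force one of \<open>M\<close> to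
      vanish, so terms read as infinite in Carleman's condition do not occur here.\<close>
    have L_pos: "L (t ^ (2 * n)) > 0" for n
    proof (cases n)
      case (Suc m)
      have "L (t ^ n * t ^ n) \<noteq> 0"
      proof
        assume "L (t ^ n * t ^ n) = 0"
        then have "L ((v * t ^ n) * t ^ n) = 0" using cauchy_schwarz[of "v * t ^ n" "t ^ n"] by simp
        then show False using M_pos[of m] by (simp add: M_def Suc ac_simps)
      qed
      then show ?thesis using square_nonneg[of "t ^ n"] by (simp add: power_double)
    qed (use L1 in simp)
    define N where "N x = L x / L 1" for x
    interpret N: positive_functional N
    proof (rule positive_functional.intro)
      show "linear N" unfolding N_def by (rule linearI) (simp_all add: L_simps add_divide_distrib)
      show "0 \<le> N (a * a)" for a using square_nonneg[of a] L1 by (simp add: N_def)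
    qed
    define g where "g k = N (t ^ (2 * Suc k)) powr (- 1 / (2 * real (Suc k)))" for k
    have N_pos: "N (t ^ (2 * n)) > 0" for n using L_pos[of n] L1 by (simp add: N_def)
    \<comment> \<open>The maximum with 1 gives \<open>1 / C \<le> C powr (- r)\<close> for all
      \<open>r \<le> 1\<close>, a factor independent of \<open>j\<close>.\<close>
    define C where "C = max 1 (sqrt (L (v * v)) * sqrt (L 1))"
    have "1 / C * g (2 * j + 1) \<le> M (t ^ Suc j * t ^ Suc j) powr (- 1 / (2 * real (Suc j)))" for j
    proof -
      let ?r = "1 / (2 * real (Suc j))"
      have "M (t ^ Suc j * t ^ Suc j) = L (v * t ^ (2 * Suc j))"
        by (simp only: M_def power_double)
      also have "\<dots> \<le> sqrt (L (v * v)) * sqrt (L (t ^ (2 * Suc j) * t ^ (2 * Suc j)))"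
        using abs_le_sqrt by (rule order_trans[OF abs_ge_self])
      also have "\<dots> = sqrt (L (v * v)) * sqrt (L 1) * sqrt (N (t ^ (2 * Suc (2 * j + 1))))"
      proof -
        have "t ^ (2 * Suc j) * t ^ (2 * Suc j) = t ^ (2 * Suc (2 * j + 1))"
          by (subst power_add[symmetric], rule arg_cong[of _ _ "\<lambda>n. t ^ n"]) simp
        then show ?thesis using L1 by (simp only: N_def real_sqrt_divide) simp
      qed
      also have "\<dots> \<le> C * sqrt (N (t ^ (2 * Suc (2 * j + 1))))"
        unfolding C_def
        by (rule mult_right_mono[OF max.cobounded2 real_sqrt_ge_zero[OF less_imp_le[OF N_pos]]])
      finally have le: "M (t ^ Suc j * t ^ Suc j) \<le> C * sqrt (N (t ^ (2 * Suc (2 * j + 1))))" .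
      have "g (2 * j + 1) = sqrt (N (t ^ (2 * Suc (2 * j + 1)))) powr (- ?r)"
        unfolding g_def using N_pos[of "Suc (2 * j + 1)"]
        by (simp add: powr_half_sqrt[symmetric] powr_powr del: power_Suc mult_Suc_right)
      then have "C powr (- ?r) * g (2 * j + 1) = (C * sqrt (N (t ^ (2 * Suc (2 * j + 1))))) powr (- ?r)"
        by (simp only: powr_mult)
      also have "\<dots> \<le> M (t ^ Suc j * t ^ Suc j) powr (- ?r)"
        using le M_pos[of j] by (intro powr_mono2') auto
      finally have 1: "C powr (- ?r) * g (2 * j + 1) \<le> M (t ^ Suc j * t ^ Suc j) powr (- ?r)" .
      have "C powr (- 1) \<le> C powr (- ?r)" by (intro powr_mono) (auto simp: C_def)
      then have "1 / C \<le> C powr (- ?r)" by (simp add: powr_minus_divide C_def)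
      then have "1 / C * g (2 * j + 1) \<le> C powr (- ?r) * g (2 * j + 1)"
        by (intro mult_right_mono) (auto simp: g_def)
      with 1 show ?thesis by simp
    qed
    moreover have "norm (1 / C * g (2 * j + 1)) = 1 / C * g (2 * j + 1)" for j
      by (simp add: C_def g_def)
    ultimately have "norm (1 / C * g (2 * j + 1)) \<le> M (t ^ Suc j * t ^ Suc j) powr (- 1 / (2 * real (Suc j)))" for j
      by (simp only:)
    then have "summable (\<lambda>j. 1 / C * g (2 * j + 1))"
      by (rule summable_comparison_test'[OF summable_M])
    moreover have "1 / C \<noteq> 0" unfolding C_def by simp
    ultimately have odd: "summable (\<lambda>j. g (2 * j + 1))" by (simp only: summable_cmult_iff simp_thms)
    have "N 1 = 1" using L1 by (simp add: N_def)
    then have mono: "g (Suc n) \<le> g n" for n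
      unfolding g_def by (rule N.moment_root_mono[OF N_pos])
    have "summable g"
      by (rule summable_of_odd_subsequence[OF _ mono odd]) (simp add: g_def)
    then have sum: "summable (\<lambda>k. 1 / min 1 (L 1) * g k)" by (rule summable_mult)
    have "L (t ^ (2 * Suc k)) powr (- 1 / (2 * real (Suc k))) \<le> 1 / min 1 (L 1) * g k" for k
    proof -
      let ?r = "1 / (2 * real (Suc k))"
      let ?c = "min 1 (L 1)"
      have c: "0 < ?c" "?c \<le> 1" "?c \<le> L 1" using L1 by auto
      have "?c powr 1 \<le> ?c powr ?r" using c by (intro powr_mono') auto
      also have "\<dots> \<le> L 1 powr ?r" using c by (intro powr_mono2) auto
      finally have "?c \<le> L 1 powr ?r" using c by simp
      then have "?c * L (t ^ (2 * Suc k)) powr (- ?r) \<le> L 1 powr ?r * L (t ^ (2 * Suc k)) powr (- ?r)"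
        by (intro mult_right_mono) auto
      also have "\<dots> = g k"
        using L1 L_pos[of "Suc k"]
        by (simp add: g_def N_def powr_divide powr_minus_divide del: power_Suc mult_Suc_right)
      finally have "?c * L (t ^ (2 * Suc k)) powr (- 1 / (2 * real (Suc k))) \<le> g k" by simp
      then show ?thesis using c(1) by (simp add: pos_le_divide_eq mult.commute)
    qed
    then have "norm (L (t ^ (2 * Suc k)) powr (- 1 / (2 * real (Suc k)))) \<le> 1 / min 1 (L 1) * g k" for k
      by (simp only: real_norm_def abs_of_nonneg[OF powr_ge_zero])
    then have "summable (\<lambda>k. L (t ^ (2 * Suc k)) powr (- 1 / (2 * real (Suc k))))"
      by (rule summable_comparison_test'[OF sum])
    then show False using carleman_imp_not_summable[OF carleman L_pos] by blast
  qed
  from M.resolvent_approximate[OF this \<open>\<delta> > 0\<close>] show ?thesis by (simp add: M_def)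
qed

text \<open>As \<open>1 + t * t = (t - \<i>) * (t + \<i>)\<close>, an approximation through
  \<open>t - \<i>\<close> is composed with the conjugate of another one. The witness is
  \<open>a\<close> times the real part of \<open>(x + \<i> * y) * (u - \<i> * w)\<close>.\<close>

lemma carleman_imp_resolvent_dense:
  assumes "carleman L t"
  shows "resolvent_dense L t"
  unfolding resolvent_dense_def
proof (intro allI impI)
  fix b a :: 'a and \<delta> :: real assume "\<delta> > 0"
  define v where "v = (b * a) * (b * a)"
  obtain x y where "L (v * ((1 - (t * x + y)) * (1 - (t * x + y)))) + L (v * ((x - t * y) * (x - t * y))) < \<delta> / 4"
    using carleman_approximate[OF assms, of v "\<delta> / 4"] \<open>\<delta> > 0\<close> by (auto simp: v_def sos.sq)
  moreover have "L (v * ((x - t * y) * (x - t * y))) \<ge> 0"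
    unfolding v_def by (intro sos_nonneg sos_mult[OF sos.sq sos.sq])
  ultimately have 1: "L (v * ((1 - (t * x + y)) * (1 - (t * x + y)))) < \<delta> / 4" by linarith
  define \<gamma> where "\<gamma> = t * x + y"
  define \<epsilon> where "\<epsilon> = t * y - x"
  \<comment> \<open>The second error gets multiplied by the first approximation
    \<open>\<gamma> + \<i> * \<epsilon>\<close>; its squared modulus therefore enters the weight of
    the second approximation.\<close>
  define v' where "v' = v * (\<gamma> * \<gamma> + \<epsilon> * \<epsilon>)"
  have "v' \<in> sos" unfolding v'_def v_def by (intro sos_mult sos.intros)
  then obtain u w where "L (v' * ((1 - (t * u + w)) * (1 - (t * u + w)))) + L (v' * ((u - t * w) * (u - t * w))) < \<delta> / 4"
    using carleman_approximate[OF assms, of v' "\<delta> / 4"] \<open>\<delta> > 0\<close> by auto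
  then have 2: "L (v' * ((1 - (t * u + w)) * (1 - (t * u + w)) + (u - t * w) * (u - t * w))) < \<delta> / 4"
    by (simp add: distrib_left L_simps)
  define \<rho> where "\<rho> = 1 - (t * u + w)"
  define \<sigma> where "\<sigma> = u - t * w"
  let ?c = "b * a"
  have "?c * (\<gamma> * \<rho> + \<epsilon> * \<sigma>) * (?c * (\<gamma> * \<rho> + \<epsilon> * \<sigma>)) + ?c * (\<gamma> * \<sigma> - \<epsilon> * \<rho>) * (?c * (\<gamma> * \<sigma> - \<epsilon> * \<rho>))
      = v' * (\<rho> * \<rho> + \<sigma> * \<sigma>)"
    by (simp add: v'_def v_def algebra_simps)
  then have "L (?c * (\<gamma> * \<rho> + \<epsilon> * \<sigma>) * (?c * (\<gamma> * \<rho> + \<epsilon> * \<sigma>)))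
      + L (?c * (\<gamma> * \<sigma> - \<epsilon> * \<rho>) * (?c * (\<gamma> * \<sigma> - \<epsilon> * \<rho>))) = L (v' * (\<rho> * \<rho> + \<sigma> * \<sigma>))"
    by (metis L_simps(1))
  then have 3: "L (?c * (\<gamma> * \<rho> + \<epsilon> * \<sigma>) * (?c * (\<gamma> * \<rho> + \<epsilon> * \<sigma>))) < \<delta> / 4"
    using 2 square_nonneg[of "?c * (\<gamma> * \<sigma> - \<epsilon> * \<rho>)"] by (simp add: \<rho>_def \<sigma>_def)
  have 4: "L (?c * (1 - \<gamma>) * (?c * (1 - \<gamma>))) < \<delta> / 4"
    using 1 by (simp add: v_def \<gamma>_def ac_simps)
  have "b * (a - (1 + t * t) * (a * (u * x + w * y))) = ?c * (1 - \<gamma>) + ?c * (\<gamma> * \<rho> + \<epsilon> * \<sigma>)"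
    by (simp add: \<gamma>_def \<rho>_def \<epsilon>_def \<sigma>_def algebra_simps)
  then have "L ((b * (a - (1 + t * t) * (a * (u * x + w * y)))) * (b * (a - (1 + t * t) * (a * (u * x + w * y))))) < \<delta>"
    using add_square_le[of "?c * (1 - \<gamma>)" "?c * (\<gamma> * \<rho> + \<epsilon> * \<sigma>)"] 3 4 by simp
  then show "\<exists>k. L ((b * (a - (1 + t * t) * k)) * (b * (a - (1 + t * t) * k))) < \<delta>" by blast
qed

end

section \<open>Positive extension\<close>

text \<open>A positive linear functional given by its graph. Applied to a difference of two pairs
  with the same function, \<open>R_nonneg\<close> yields uniqueness of the value.\<close>

locale dominated_extension =
  fixes R :: "('x \<Rightarrow> real) \<Rightarrow> real \<Rightarrow> bool"
  assumes R_add: "R f r \<Longrightarrow> R g s \<Longrightarrow> R (\<lambda>x. f x + g x) (r + s)"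
    and R_scale: "R f r \<Longrightarrow> R (\<lambda>x. c * f x) (c * r)"
    and R_nonneg: "R f r \<Longrightarrow> (\<And>x. f x \<ge> 0) \<Longrightarrow> r \<ge> 0"
    and R_zero: "R (\<lambda>_. 0) 0"
begin

definition D :: "('x \<Rightarrow> real) set" where
  "D = {F. \<exists>f r. R f r \<and> (\<forall>x. \<bar>F x\<bar> \<le> f x)}"

lemma D_add: "F \<in> D \<Longrightarrow> G \<in> D \<Longrightarrow> (\<lambda>x. F x + G x) \<in> D"
proof -
  assume "F \<in> D" "G \<in> D"
  then obtain f r g s where "R f r" "\<And>x. \<bar>F x\<bar> \<le> f x" "R g s" "\<And>x. \<bar>G x\<bar> \<le> g x"
    unfolding D_def by blast
  moreover from this have "\<bar>F x + G x\<bar> \<le> f x + g x" for x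
    by (meson abs_triangle_ineq add_mono order_trans)
  ultimately show ?thesis unfolding D_def using R_add by blast
qed

lemma D_scale: "F \<in> D \<Longrightarrow> (\<lambda>x. c * F x) \<in> D"
proof -
  assume "F \<in> D"
  then obtain f r where "R f r" "\<And>x. \<bar>F x\<bar> \<le> f x" unfolding D_def by blast
  moreover from this have "\<bar>c * F x\<bar> \<le> \<bar>c\<bar> * f x" for x
    by (simp add: abs_mult mult_left_mono)
  ultimately show ?thesis unfolding D_def using R_scale[of f r "\<bar>c\<bar>"] by blast
qed

lemma D_zero: "(\<lambda>_. 0) \<in> D"
  unfolding D_def using R_zero by force

lemma D_neg: "F \<in> D \<Longrightarrow> (\<lambda>x. - F x) \<in> D"
  using D_scale[of F "- 1"] by simp

text \<open>The clause on \<open>R\<close> encodes domination and positivity together: for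
  \<open>F \<ge> 0\<close> it applies to \<open>- F\<close> and the zero function. The value 0
  outside \<open>D\<close> makes the pointwise order on all functions agree with the order on
  \<open>D\<close>, as minimality requires.\<close>

definition sublinear :: "(('x \<Rightarrow> real) \<Rightarrow> real) \<Rightarrow> bool" where
  "sublinear q \<longleftrightarrow>
     (\<forall>F\<in>D. \<forall>G\<in>D. q (\<lambda>x. F x + G x) \<le> q F + q G) \<and>
     (\<forall>F\<in>D. \<forall>c>0. q (\<lambda>x. c * F x) \<le> c * q F) \<and>
     (\<forall>F\<in>D. \<forall>f r. R f r \<longrightarrow> (\<forall>x. F x \<le> f x) \<longrightarrow> q F \<le> r) \<and>
     (\<forall>F. F \<notin> D \<longrightarrow> q F = 0)"

lemma sublinear_add: "sublinear q \<Longrightarrow> F \<in> D \<Longrightarrow> G \<in> D \<Longrightarrow> q (\<lambda>x. F x + G x) \<le> q F + q G"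
  and sublinear_scale_le: "sublinear q \<Longrightarrow> F \<in> D \<Longrightarrow> c > 0 \<Longrightarrow> q (\<lambda>x. c * F x) \<le> c * q F"
  and sublinear_le: "sublinear q \<Longrightarrow> F \<in> D \<Longrightarrow> R f r \<Longrightarrow> (\<And>x. F x \<le> f x) \<Longrightarrow> q F \<le> r"
  and sublinear_off: "sublinear q \<Longrightarrow> F \<notin> D \<Longrightarrow> q F = 0"
  unfolding sublinear_def by blast+

lemma sublinear_zero: "sublinear q \<Longrightarrow> q (\<lambda>_. 0) = 0"
  using sublinear_scale_le[of q "\<lambda>_. 0" 2] sublinear_scale_le[of q "\<lambda>_. 0" "1 / 2"] D_zero by simp

lemma sublinear_scale:
  assumes "sublinear q" "F \<in> D" "c > 0"
  shows "q (\<lambda>x. c * F x) = c * q F"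
proof (rule antisym)
  have "q (\<lambda>x. 1 / c * (c * F x)) \<le> 1 / c * q (\<lambda>x. c * F x)"
    using assms by (intro sublinear_scale_le D_scale) auto
  then show "c * q F \<le> q (\<lambda>x. c * F x)" using assms(3) by (simp add: field_simps)
qed (use assms in \<open>rule sublinear_scale_le\<close>)

lemma sublinear_ge_neg:
  assumes "sublinear q" "F \<in> D"
  shows "- q (\<lambda>x. - F x) \<le> q F"
  using sublinear_add[OF assms(1,2) D_neg[OF assms(2)]] sublinear_zero[OF assms(1)] by simp

lemma sublinear_ge:
  assumes "sublinear q" "F \<in> D" "R f r" "\<And>x. - F x \<le> f x"
  shows "- r \<le> q F"
  using sublinear_ge_neg[OF assms(1,2)] sublinear_le[OF assms(1) D_neg[OF assms(2)] assms(3,4)]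
  by linarith

definition upper :: "('x \<Rightarrow> real) \<Rightarrow> real" where
  "upper F = (if F \<in> D then Inf {r. \<exists>f. R f r \<and> (\<forall>x. F x \<le> f x)} else 0)"

lemma upper_le: "F \<in> D \<Longrightarrow> R f r \<Longrightarrow> (\<And>x. F x \<le> f x) \<Longrightarrow> upper F \<le> r"
proof -
  assume F: "F \<in> D" and fr: "R f r" "\<And>x. F x \<le> f x"
  obtain g s where gs: "R g s" "\<And>x. \<bar>F x\<bar> \<le> g x" using F unfolding D_def by blast
  have "bdd_below {r. \<exists>f. R f r \<and> (\<forall>x. F x \<le> f x)}"
  proof (rule bdd_belowI)
    fix r assume "r \<in> {r. \<exists>f. R f r \<and> (\<forall>x. F x \<le> f x)}"
    then obtain f where f: "R f r" "\<And>x. F x \<le> f x" by blast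
    have "f x + g x \<ge> 0" for x using f(2)[of x] gs(2)[of x] by linarith
    then show "- s \<le> r" using R_nonneg[OF R_add[OF f(1) gs(1)]] by simp
  qed
  then have "Inf {r. \<exists>f. R f r \<and> (\<forall>x. F x \<le> f x)} \<le> r" using fr by (intro cInf_lower) auto
  then show ?thesis using F by (simp add: upper_def)
qed

lemma le_upper: "F \<in> D \<Longrightarrow> (\<And>f r. R f r \<Longrightarrow> (\<forall>x. F x \<le> f x) \<Longrightarrow> c \<le> r) \<Longrightarrow> c \<le> upper F"
proof -
  assume F: "F \<in> D" and le: "\<And>f r. R f r \<Longrightarrow> (\<forall>x. F x \<le> f x) \<Longrightarrow> c \<le> r"
  obtain g s where gs: "R g s" "\<And>x. \<bar>F x\<bar> \<le> g x" using F unfolding D_def by blast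
  then have "F x \<le> g x" for x by (meson abs_le_D1)
  then have "{r. \<exists>f. R f r \<and> (\<forall>x. F x \<le> f x)} \<noteq> {}" using gs(1) by blast
  then have "c \<le> Inf {r. \<exists>f. R f r \<and> (\<forall>x. F x \<le> f x)}"
    using le by (intro cInf_greatest) auto
  then show ?thesis using F by (simp add: upper_def)
qed

lemma sublinear_upper: "sublinear upper"
  unfolding sublinear_def
proof (intro conjI ballI allI impI)
  fix F G assume F: "F \<in> D" and G: "G \<in> D"
  have "upper (\<lambda>x. F x + G x) - r \<le> upper G" if fr: "R f r" "\<forall>x. F x \<le> f x" for f r
  proof (rule le_upper[OF G])
    fix g s assume "R g s" "\<forall>x. G x \<le> g x"
    then have "upper (\<lambda>x. F x + G x) \<le> r + s"
      using fr by (intro upper_le[OF D_add[OF F G] R_add]) (auto intro: add_mono)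
    then show "upper (\<lambda>x. F x + G x) - r \<le> s" by simp
  qed
  then have "upper (\<lambda>x. F x + G x) - upper G \<le> r" if "R f r" "\<forall>x. F x \<le> f x" for f r
    using that by force
  then have "upper (\<lambda>x. F x + G x) - upper G \<le> upper F"
    by (rule le_upper[OF F])
  then show "upper (\<lambda>x. F x + G x) \<le> upper F + upper G" by simp
next
  fix F and c :: real assume F: "F \<in> D" and c: "c > 0"
  have "upper (\<lambda>x. c * F x) / c \<le> upper F"
  proof (rule le_upper[OF F])
    fix f r assume "R f r" "\<forall>x. F x \<le> f x"
    then have "upper (\<lambda>x. c * F x) \<le> c * r"
      using c by (intro upper_le[OF D_scale[OF F] R_scale]) auto
    then show "upper (\<lambda>x. c * F x) / c \<le> r" using c by (simp add: field_simps)
  qed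
  then show "upper (\<lambda>x. c * F x) \<le> c * upper F" using c by (simp add: field_simps)
next
  fix F f r assume "F \<in> D" "R f r" "\<forall>x. F x \<le> f x"
  then show "upper F \<le> r" using upper_le by blast
qed (simp add: upper_def)

text \<open>A chain is bounded by its pointwise infimum, which is finite because a bound
  \<open>g\<close> for the modulus of \<open>F\<close>, with value \<open>s\<close>, gives
  \<open>- s \<le> q F\<close> for every member.\<close>

lemma minimal_sublinear: "\<exists>m. sublinear m \<and> (\<forall>q. sublinear q \<longrightarrow> q \<le> m \<longrightarrow> q = m)"
proof -
  let ?P = "\<lambda>q q' :: ('x \<Rightarrow> real) \<Rightarrow> real. q' \<le> q"
  let ?A = "{q. sublinear q}"
  have "\<exists>m\<in>?A. \<forall>a\<in>?A. ?P m a \<longrightarrow> a = m"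
  proof (rule predicate_Zorn)
    show "partial_order_on ?A (relation_of ?P ?A)"
      by (rule partial_order_on_relation_ofI) auto
    fix C assume C: "C \<in> Chains (relation_of ?P ?A)"
    show "\<exists>u\<in>?A. \<forall>a\<in>C. ?P a u"
    proof (cases "C = {}")
      case True
      then show ?thesis using sublinear_upper by auto
    next
      case False
      have sub: "sublinear q" if "q \<in> C" for q using Chains_relation_of[OF C] that by auto
      have chain: "q \<le> q' \<or> q' \<le> q" if "q \<in> C" "q' \<in> C" for q q'
        using C that unfolding Chains_def relation_of_def by auto
      define u where "u F = (INF q\<in>C. q F)" for F
      have bdd: "bdd_below ((\<lambda>q. q F) ` C)" for F
      proof (cases "F \<in> D")
        case True
        then obtain g s where gs: "R g s" "\<And>x. \<bar>F x\<bar> \<le> g x" unfolding D_def by blast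
        then have "- F x \<le> g x" for x by (meson abs_le_D2)
        then show ?thesis by (intro bdd_belowI2[of _ "- s"] sublinear_ge[OF sub True gs(1)])
      next
        case False
        show ?thesis
          by (rule bdd_belowI2[of _ 0]) (rule eq_refl[OF sublinear_off[OF sub False, symmetric]])
      qed
      have u_le: "u F \<le> q F" if "q \<in> C" for q F
        unfolding u_def using bdd that by (rule cINF_lower)
      have le_u: "c \<le> u F" if "\<And>q. q \<in> C \<Longrightarrow> c \<le> q F" for c F
        unfolding u_def using False that by (rule cINF_greatest)
      have "sublinear u" unfolding sublinear_def
      proof (intro conjI ballI allI impI)
        fix F G assume F: "F \<in> D" and G: "G \<in> D"
        have step: "u (\<lambda>x. F x + G x) \<le> q F + q' G" if q: "q \<in> C" "q' \<in> C" for q q'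
        proof -
          obtain p where p: "p \<in> C" "p \<le> q" "p \<le> q'" using chain[OF q] q by auto
          have "u (\<lambda>x. F x + G x) \<le> p (\<lambda>x. F x + G x)" by (rule u_le[OF p(1)])
          also have "\<dots> \<le> p F + p G" by (rule sublinear_add[OF sub[OF p(1)] F G])
          also have "\<dots> \<le> q F + q' G" using p(2,3) by (intro add_mono) (auto simp: le_fun_def)
          finally show ?thesis .
        qed
        have step': "u (\<lambda>x. F x + G x) - q F \<le> u G" if "q \<in> C" for q
        proof (rule le_u)
          fix q' assume "q' \<in> C"
          from step[OF that this] show "u (\<lambda>x. F x + G x) - q F \<le> q' G" by linarith
        qed
        have "u (\<lambda>x. F x + G x) - u G \<le> u F"
        proof (rule le_u)
          fix q assume "q \<in> C"
          from step'[OF this] show "u (\<lambda>x. F x + G x) - u G \<le> q F" by linarith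
        qed
        then show "u (\<lambda>x. F x + G x) \<le> u F + u G" by simp
      next
        fix F and c :: real assume F: "F \<in> D" and c: "c > 0"
        have "u (\<lambda>x. c * F x) / c \<le> u F"
        proof (rule le_u)
          fix q assume q: "q \<in> C"
          have "u (\<lambda>x. c * F x) \<le> c * q F"
            using u_le[OF q, of "\<lambda>x. c * F x"] sublinear_scale_le[OF sub[OF q] F c] by linarith
          then show "u (\<lambda>x. c * F x) / c \<le> q F" using c by (simp add: field_simps)
        qed
        then show "u (\<lambda>x. c * F x) \<le> c * u F" using c by (simp add: field_simps)
      next
        fix F f r assume "F \<in> D" "R f r" "\<forall>x. F x \<le> f x"
        moreover obtain q where "q \<in> C" using False by blast
        ultimately show "u F \<le> r" using u_le[of q F] sublinear_le[OF sub, of q F f r] by fastforce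
      next
        fix F assume "F \<notin> D"
        then have "(\<lambda>q. q F) ` C = {0}" using False sublinear_off[OF sub] by force
        then show "u F = 0" by (simp add: u_def)
      qed
      then show ?thesis using u_le by (auto simp: le_fun_def)
    qed
  qed
  then show ?thesis by auto
qed

lemma positive_extension:
  "\<exists>Q. (\<forall>F\<in>D. \<forall>G\<in>D. Q (\<lambda>x. F x + G x) = Q F + Q G) \<and>
     (\<forall>F\<in>D. \<forall>c. Q (\<lambda>x. c * F x) = c * Q F) \<and>
     (\<forall>F\<in>D. (\<forall>x. F x \<ge> 0) \<longrightarrow> Q F \<ge> 0) \<and>
     (\<forall>F\<in>D. \<forall>r. R F r \<longrightarrow> Q F = r)"
proof -
  obtain m where m: "sublinear m" and minimal: "\<And>q. sublinear q \<Longrightarrow> q \<le> m \<Longrightarrow> q = m"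
    using minimal_sublinear by blast
  have superadd: "m F \<le> m (\<lambda>x. F x + G x) - m G" if F: "F \<in> D" and G: "G \<in> D" for F G
  proof -
    \<comment> \<open>The usual modification of \<open>m\<close> in the direction \<open>G\<close>:
      it is sublinear and below \<open>m\<close>, hence equal to \<open>m\<close> by minimality, and
      its term at \<open>t = 1\<close> is superadditivity of \<open>m\<close>.\<close>
    define q where "q F = (if F \<in> D then INF t\<in>{0<..}. m (\<lambda>x. F x + t * G x) - t * m G else 0)" for F
    have bound: "- m (\<lambda>x. - F x) \<le> m (\<lambda>x. F x + t * G x) - t * m G" if F: "F \<in> D" and "t > 0" for F t
    proof -
      have "t * m G = m (\<lambda>x. (F x + t * G x) + - F x)"
        using sublinear_scale[OF m G \<open>t > 0\<close>] by simp
      also have "\<dots> \<le> m (\<lambda>x. F x + t * G x) + m (\<lambda>x. - F x)"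
        by (intro sublinear_add[OF m] D_add D_neg D_scale F G)
      finally show ?thesis by simp
    qed
    then have bdd: "bdd_below ((\<lambda>t. m (\<lambda>x. F x + t * G x) - t * m G) ` {0<..})" if "F \<in> D" for F
      using that by (intro bdd_belowI[of _ "- m (\<lambda>x. - F x)"]) auto
    have q_le: "q F \<le> m (\<lambda>x. F x + t * G x) - t * m G" if "F \<in> D" "t > 0" for F t
      using cINF_lower[OF bdd[OF that(1)], of t] that by (simp add: q_def)
    have le_q: "c \<le> q F" if "F \<in> D" "\<And>t. t > 0 \<Longrightarrow> c \<le> m (\<lambda>x. F x + t * G x) - t * m G" for c F
      using that by (auto simp: q_def intro!: cINF_greatest)
    have q_m: "q F \<le> m F" if F: "F \<in> D" for F
    proof -
      have "q F \<le> m F + t * m G - t * m G" if "t > 0" for t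
        using q_le[OF F that] sublinear_add[OF m F D_scale[OF G], of t] sublinear_scale[OF m G that]
        by linarith
      from this[of 1] show ?thesis by simp
    qed
    have "sublinear q" unfolding sublinear_def
    proof (intro conjI ballI allI impI)
      fix F1 F2 assume F: "F1 \<in> D" "F2 \<in> D"
      have step: "q (\<lambda>x. F1 x + F2 x) \<le> (m (\<lambda>x. F1 x + t1 * G x) - t1 * m G) + (m (\<lambda>x. F2 x + t2 * G x) - t2 * m G)"
        if t: "t1 > 0" "t2 > 0" for t1 t2
      proof -
        have "q (\<lambda>x. F1 x + F2 x) \<le> m (\<lambda>x. (F1 x + F2 x) + (t1 + t2) * G x) - (t1 + t2) * m G"
          using t by (intro q_le D_add F) simp
        also have "(\<lambda>x. (F1 x + F2 x) + (t1 + t2) * G x) = (\<lambda>x. (F1 x + t1 * G x) + (F2 x + t2 * G x))"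
          by (simp add: algebra_simps)
        also have "m \<dots> \<le> m (\<lambda>x. F1 x + t1 * G x) + m (\<lambda>x. F2 x + t2 * G x)"
          by (intro sublinear_add[OF m] D_add D_scale F G)
        finally show ?thesis by (simp add: algebra_simps)
      qed
      have step': "q (\<lambda>x. F1 x + F2 x) - (m (\<lambda>x. F1 x + t1 * G x) - t1 * m G) \<le> q F2" if "t1 > 0" for t1
      proof (rule le_q[OF F(2)])
        fix t2 :: real assume "t2 > 0"
        from step[OF that this]
        show "q (\<lambda>x. F1 x + F2 x) - (m (\<lambda>x. F1 x + t1 * G x) - t1 * m G) \<le> m (\<lambda>x. F2 x + t2 * G x) - t2 * m G"
          by linarith
      qed
      have "q (\<lambda>x. F1 x + F2 x) - q F2 \<le> q F1"
      proof (rule le_q[OF F(1)])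
        fix t1 :: real assume "t1 > 0"
        from step'[OF this]
        show "q (\<lambda>x. F1 x + F2 x) - q F2 \<le> m (\<lambda>x. F1 x + t1 * G x) - t1 * m G" by linarith
      qed
      then show "q (\<lambda>x. F1 x + F2 x) \<le> q F1 + q F2" by simp
    next
      fix F and c :: real assume F: "F \<in> D" and c: "c > 0"
      have "q (\<lambda>x. c * F x) / c \<le> q F"
      proof (rule le_q[OF F])
        fix t :: real assume t: "t > 0"
        have "q (\<lambda>x. c * F x) \<le> m (\<lambda>x. c * F x + (c * t) * G x) - (c * t) * m G"
          using c t by (intro q_le D_scale F) simp
        also have "(\<lambda>x. c * F x + (c * t) * G x) = (\<lambda>x. c * (F x + t * G x))"
          by (simp add: algebra_simps)
        also have "m \<dots> = c * m (\<lambda>x. F x + t * G x)"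
          by (intro sublinear_scale[OF m] D_add D_scale F G c)
        finally show "q (\<lambda>x. c * F x) / c \<le> m (\<lambda>x. F x + t * G x) - t * m G"
          using c by (simp add: field_simps)
      qed
      then show "q (\<lambda>x. c * F x) \<le> c * q F" using c by (simp add: field_simps)
    next
      fix F f r assume "F \<in> D" "R f r" "\<forall>x. F x \<le> f x"
      then show "q F \<le> r" using q_m[of F] sublinear_le[OF m, of F f r] by fastforce
    qed (simp add: q_def)
    moreover have "q \<le> m"
      unfolding le_fun_def using q_m sublinear_off[OF m] by (metis order_refl q_def)
    ultimately have "q = m" by (rule minimal)
    then show ?thesis using q_le[OF F, of 1] by simp
  qed
  have add: "m (\<lambda>x. F x + G x) = m F + m G" if "F \<in> D" "G \<in> D" for F G
    using superadd[OF that] sublinear_add[OF m that] by linarith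
  have neg: "m (\<lambda>x. - F x) = - m F" if "F \<in> D" for F
    using add[OF that D_neg[OF that]] sublinear_zero[OF m] by simp
  have scale: "m (\<lambda>x. c * F x) = c * m F" if F: "F \<in> D" for F c
  proof (cases c "0 :: real" rule: linorder_cases)
    case less
    then have "m (\<lambda>x. - c * - F x) = - c * m (\<lambda>x. - F x)"
      by (intro sublinear_scale[OF m] D_neg F) simp
    then show ?thesis using neg[OF F] by simp
  qed (use sublinear_zero[OF m] sublinear_scale[OF m F] in auto)
  have pos: "m F \<ge> 0" if "F \<in> D" "\<forall>x. F x \<ge> 0" for F
    using sublinear_ge[OF m that(1) R_zero] that(2) by simp
  have ext: "m F = r" if "F \<in> D" "R F r" for F r
  proof (rule antisym)
    show "m F \<le> r" using sublinear_le[OF m that] by simp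
    show "r \<le> m F" using sublinear_ge[OF m that(1) R_scale[OF that(2), of "- 1"]] by simp
  qed
  show ?thesis using add scale pos ext by (intro exI[of _ m]) blast
qed

end

section \<open>Contents and ultrafilters\<close>

definition ultrafilter :: "'x filter \<Rightarrow> bool" where
  "ultrafilter U \<longleftrightarrow> U \<noteq> bot \<and> (\<forall>P. eventually P U \<or> eventually (\<lambda>x. \<not> P x) U)"

lemma ultrafilter_not_iff:
  assumes "ultrafilter U"
  shows "eventually (\<lambda>x. \<not> P x) U \<longleftrightarrow> \<not> eventually P U"
  using assms eventually_conj[of P U "\<lambda>x. \<not> P x"] by (auto simp: ultrafilter_def trivial_limit_def)

lemma ultrafilter_exists:
  assumes "F \<noteq> bot"
  shows "\<exists>U\<le>F. ultrafilter U"
proof -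
  let ?A = "{G. G \<noteq> bot \<and> G \<le> F}"
  let ?P = "\<lambda>G H :: 'a filter. H \<le> G"
  have "\<exists>m\<in>?A. \<forall>a\<in>?A. ?P m a \<longrightarrow> a = m"
  proof (rule predicate_Zorn)
    show "partial_order_on ?A (relation_of ?P ?A)"
      by (rule partial_order_on_relation_ofI) auto
    fix C assume C: "C \<in> Chains (relation_of ?P ?A)"
    show "\<exists>u\<in>?A. \<forall>a\<in>C. ?P a u"
    proof (cases "C = {}")
      case True
      then show ?thesis using assms by auto
    next
      case False
      have sub: "C \<subseteq> ?A" using Chains_relation_of[OF C] .
      have base: "\<exists>x\<in>C. x \<le> inf G H" if "G \<in> C" "H \<in> C" for G H
        using C that unfolding Chains_def relation_of_def by auto
      have "eventually P (Inf C) \<longleftrightarrow> (\<exists>b\<in>C. eventually P b)" for P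
        by (rule eventually_Inf_base[OF False]) (rule base)
      then have "Inf C \<noteq> bot" using sub by (auto simp: trivial_limit_def)
      moreover have "Inf C \<le> F"
      proof -
        obtain G where "G \<in> C" using False by auto
        then show ?thesis using sub by (auto intro: Inf_lower2)
      qed
      ultimately show ?thesis by (intro bexI[of _ "Inf C"] ballI Inf_lower) auto
    qed
  qed
  then obtain m where m: "m \<noteq> bot" "m \<le> F" and min: "\<And>G. G \<noteq> bot \<Longrightarrow> G \<le> F \<Longrightarrow> G \<le> m \<Longrightarrow> G = m"
    by auto
  have "eventually P m \<or> eventually (\<lambda>x. \<not> P x) m" for P
  proof (rule disjCI)
    assume *: "\<not> eventually (\<lambda>x. \<not> P x) m"
    let ?G = "inf m (principal {x. P x})"
    have "?G \<noteq> bot" using * by (simp add: trivial_limit_def eventually_inf_principal)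
    then have "?G = m" using m(2) by (intro min) (auto intro: le_infI1)
    moreover have "eventually P ?G" by (simp add: eventually_inf_principal)
    ultimately show "eventually P m" by (simp only:)
  qed
  then show ?thesis using m by (auto simp: ultrafilter_def)
qed

text \<open>Otherwise every point of the compact interval has a neighbourhood that \<open>f\<close>
  eventually avoids; finitely many of them cover the interval, so \<open>f\<close> would eventually
  avoid all of it.\<close>

lemma ultrafilter_tendsto:
  fixes f :: "'x \<Rightarrow> real"
  assumes "ultrafilter U" and bdd: "eventually (\<lambda>x. \<bar>f x\<bar> \<le> c) U"
  shows "(f \<longlongrightarrow> Lim U f) U"
proof -
  have "\<exists>l. (f \<longlongrightarrow> l) U"
  proof (rule ccontr)
    assume "\<not> (\<exists>l. (f \<longlongrightarrow> l) U)"
    then have "\<exists>S. open S \<and> l \<in> S \<and> \<not> eventually (\<lambda>x. f x \<in> S) U" for l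
      unfolding tendsto_def by blast
    then obtain S where S: "\<And>l. open (S l)" "\<And>l. l \<in> S l" "\<And>l. \<not> eventually (\<lambda>x. f x \<in> S l) U"
      by metis
    obtain T where T: "finite T" "{-c..c} \<subseteq> (\<Union>l\<in>T. S l)"
    proof (rule compactE_image[of "{-c..c}" "{-c..c}" S])
      show "{-c..c} \<subseteq> (\<Union>l\<in>{-c..c}. S l)" using S(2) by blast
    qed (use S(1) in auto)
    have "eventually (\<lambda>x. \<forall>l\<in>T. f x \<notin> S l) U"
      using T(1) S(3) by (intro eventually_ball_finite) (auto simp: ultrafilter_not_iff[OF assms(1)])
    with bdd have "eventually (\<lambda>x. False) U"
    proof eventually_elim
      case (elim x)
      then have "f x \<in> {-c..c}" by (auto simp: abs_le_iff)
      then show False using T(2) elim(2) by blast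
    qed
    then show False using assms(1) by (simp add: ultrafilter_def trivial_limit_def)
  qed
  then show ?thesis using assms(1) tendsto_Lim[of U f] by (auto simp: ultrafilter_def)
qed

text \<open>A content on all subsets of \<open>'x\<close> is tight for the filtering families \<open>D m\<close>; it becomes a
  measure on the ultrafilters containing some \<open>D m\<close>, where the analogue of each subset of \<open>'x\<close> is
  clopen.\<close>

locale tight_content =
  fixes \<nu> :: "'x set \<Rightarrow> real" and D :: "nat \<Rightarrow> 'x set set" and \<delta> :: "nat \<Rightarrow> real"
  assumes additive: "A \<inter> B = {} \<Longrightarrow> \<nu> (A \<union> B) = \<nu> A + \<nu> B"
    and nonneg: "\<nu> A \<ge> 0"
    and D_inter: "M \<in> D m \<Longrightarrow> N \<in> D m \<Longrightarrow> M \<inter> N \<in> D m"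
    and D_nonempty: "D m \<noteq> {}"
    and D_compl: "M \<in> D m \<Longrightarrow> \<nu> (- M) \<le> \<delta> m"
    and \<delta>_lim: "\<delta> \<longlonglongrightarrow> 0"
begin

lemma mono: "A \<subseteq> B \<Longrightarrow> \<nu> A \<le> \<nu> B"
  using additive[of A "B - A"] nonneg[of "B - A"] by (simp add: Un_absorb1)

lemma empty: "\<nu> {} = 0"
  using additive[of "{}" "{}"] by simp

definition S :: "'x filter set" where
  "S = {U. ultrafilter U \<and> (\<exists>m. \<forall>M\<in>D m. eventually (\<lambda>x. x \<in> M) U)}"

definition cyl :: "'x set \<Rightarrow> 'x filter set" where
  "cyl M = {U\<in>S. eventually (\<lambda>x. x \<in> M) U}"

lemma S_ultrafilter: "U \<in> S \<Longrightarrow> ultrafilter U"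
  by (simp add: S_def)

lemma cyl_empty: "cyl {} = {}"
  using S_ultrafilter by (auto simp: cyl_def ultrafilter_def)

lemma cyl_UNIV: "cyl UNIV = S"
  by (simp add: cyl_def)

lemma cyl_inter: "cyl (M \<inter> N) = cyl M \<inter> cyl N"
  by (auto simp: cyl_def eventually_conj_iff)

lemma cyl_diff: "cyl (M - N) = cyl M - cyl N"
  using ultrafilter_not_iff[OF S_ultrafilter, of _ "\<lambda>x. x \<in> N"]
  by (auto simp: cyl_def eventually_conj_iff)

lemma cyl_union: "cyl (M \<union> N) = cyl M \<union> cyl N"
proof -
  have "M \<union> N = UNIV - ((UNIV - M) \<inter> (UNIV - N))" by auto
  then show ?thesis unfolding cyl_def[symmetric]
    by (simp only: cyl_diff cyl_inter cyl_UNIV) (auto simp: cyl_def)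
qed

text \<open>If every \<open>M i\<close> had content above \<open>\<delta> m\<close>, it would meet
  every member of \<open>D m\<close>. The intersections form a filter base, and an ultrafilter above
  it lies in all the cylinders.\<close>

lemma compactness:
  assumes dec: "decseq M" and cover: "(\<Inter>i. cyl (M i)) = {}"
  shows "\<exists>i. \<nu> (M i) \<le> \<delta> m"
proof (rule ccontr)
  assume "\<not> (\<exists>i. \<nu> (M i) \<le> \<delta> m)"
  then have large: "\<nu> (M i) > \<delta> m" for i by (auto simp: not_le)
  have meet: "M i \<inter> N \<noteq> {}" if "N \<in> D m" for i N
  proof
    assume "M i \<inter> N = {}"
    then have "\<nu> (M i) \<le> \<nu> (- N)" by (intro mono) auto
    then show False using D_compl[OF that] large[of i] by linarith
  qed
  define B where "B = {principal (M i \<inter> N) | i N. N \<in> D m}"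
  have base: "\<exists>x\<in>B. x \<le> inf F G" if "F \<in> B" "G \<in> B" for F G
  proof -
    obtain i N j N' where F: "F = principal (M i \<inter> N)" "N \<in> D m" and G: "G = principal (M j \<inter> N')" "N' \<in> D m"
      using \<open>F \<in> B\<close> \<open>G \<in> B\<close> unfolding B_def by blast
    have "M (max i j) \<subseteq> M i" "M (max i j) \<subseteq> M j" using dec by (auto simp: decseq_def)
    then have "principal (M (max i j) \<inter> (N \<inter> N')) \<le> inf F G" by (auto simp: F G)
    then show ?thesis unfolding B_def using D_inter[OF F(2) G(2)] by blast
  qed
  have "B \<noteq> {}" unfolding B_def using D_nonempty[of m] by blast
  then have "eventually P (Inf B) \<longleftrightarrow> (\<exists>b\<in>B. eventually P b)" for P
    by (rule eventually_Inf_base) (rule base)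
  note ev_B = this
  have "Inf B \<noteq> bot"
    unfolding trivial_limit_def ev_B
  proof
    assume "\<exists>b\<in>B. eventually (\<lambda>x. False) b"
    then obtain i N where "N \<in> D m" "eventually (\<lambda>x. False) (principal (M i \<inter> N))"
      unfolding B_def by blast
    then show False using meet[of N i] by (auto simp: eventually_principal)
  qed
  then obtain U where U: "U \<le> Inf B" "ultrafilter U" using ultrafilter_exists by blast
  have ev: "eventually (\<lambda>x. x \<in> M i) U \<and> eventually (\<lambda>x. x \<in> N) U" if "N \<in> D m" for i N
  proof -
    have "U \<le> principal (M i \<inter> N)"
      by (rule order_trans[OF U(1) Inf_lower]) (use that in \<open>auto simp: B_def\<close>)
    then show ?thesis by (simp add: le_principal eventually_conj_iff)
  qed
  then have "\<forall>N\<in>D m. eventually (\<lambda>x. x \<in> N) U" by blast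
  then have "U \<in> S" using U(2) by (auto simp: S_def)
  moreover obtain N where "N \<in> D m" using D_nonempty by blast
  then have "eventually (\<lambda>x. x \<in> M i) U" for i using ev by blast
  ultimately have "U \<in> (\<Inter>i. cyl (M i))" by (simp add: cyl_def)
  then show False using cover by simp
qed

text \<open>A set with empty cylinder has content at most every \<open>\<delta> m\<close>, hence 0.
  Consequently the content depends only on the cylinder, although different sets may share
  one.\<close>

lemma le_of_cyl_subset:
  assumes "cyl M \<subseteq> cyl N"
  shows "\<nu> M \<le> \<nu> N"
proof -
  have "\<nu> (M - N) \<le> \<delta> m" for m
    using compactness[of "\<lambda>_. M - N" m] assms by (auto simp: cyl_diff decseq_def)
  then have "\<nu> (M - N) \<le> 0" using \<delta>_lim by (intro LIMSEQ_le_const) auto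
  moreover have "\<nu> M = \<nu> (M \<inter> N) + \<nu> (M - N)"
    using additive[of "M \<inter> N" "M - N"] by (simp add: Int_Diff_Un Int_Diff_disjoint)
  moreover have "\<nu> (M \<inter> N) \<le> \<nu> N" by (rule mono) auto
  ultimately show ?thesis by linarith
qed

lemma measure_exists:
  "\<exists>P. space P = S \<and> (\<forall>M. cyl M \<in> sets P) \<and> (\<forall>M. emeasure P (cyl M) = ennreal (\<nu> M))"
proof -
  define f where "f C = ennreal (\<nu> (SOME M. C = cyl M))" for C
  have f_cyl: "f (cyl M) = ennreal (\<nu> M)" for M
  proof -
    have "cyl M = cyl (SOME N. cyl M = cyl N)" by (rule someI[of _ M]) simp
    then have "\<nu> (SOME N. cyl M = cyl N) = \<nu> M"
      by (metis le_of_cyl_subset order_antisym order_refl)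
    then show ?thesis by (simp add: f_def)
  qed
  have range_cyl: "range cyl \<subseteq> Pow S" by (auto simp: cyl_def)
  interpret ring_of_sets S "range cyl"
  proof (rule ring_of_setsI)
    show "{} \<in> range cyl" by (metis cyl_empty rangeI)
  qed (use range_cyl in \<open>auto simp flip: cyl_union cyl_diff\<close>)
  have "\<exists>\<mu>. (\<forall>s\<in>range cyl. \<mu> s = f s) \<and> measure_space S (sigma_sets S (range cyl)) \<mu>"
  proof (rule caratheodory_empty_continuous)
    show "positive (range cyl) f"
      using f_cyl[of "{}"] by (simp add: positive_def cyl_empty empty)
    show "additive (range cyl) f"
      unfolding additive_def
    proof (intro ballI impI)
      fix X Y assume "X \<in> range cyl" "Y \<in> range cyl" "X \<inter> Y = {}"
      then obtain M N where MN: "X = cyl M" "Y = cyl N" by auto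
      \<comment> \<open>Disjoint cylinders may come from overlapping sets; the overlap has content
        zero.\<close>
      have "cyl (M \<inter> N) \<subseteq> cyl {}" using \<open>X \<inter> Y = {}\<close> by (simp add: MN cyl_inter cyl_empty)
      then have "\<nu> (M \<inter> N) \<le> \<nu> {}" by (rule le_of_cyl_subset)
      then have "\<nu> (M \<inter> N) \<le> 0" by (simp only: empty)
      moreover have "\<nu> (M \<union> N) = \<nu> M + \<nu> (N - M)" using additive[of M "N - M"] by auto
      moreover have "\<nu> N = \<nu> (M \<inter> N) + \<nu> (N - M)"
      proof -
        have "M \<inter> N \<union> (N - M) = N" "M \<inter> N \<inter> (N - M) = {}" by auto
        then show ?thesis using additive[of "M \<inter> N" "N - M"] by (simp only:)
      qed
      ultimately have "\<nu> (M \<union> N) = \<nu> M + \<nu> N" using nonneg[of "M \<inter> N"] by linarith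
      then show "f (X \<union> Y) = f X + f Y"
        by (simp add: MN f_cyl nonneg flip: cyl_union)
    qed
    show "f A \<noteq> \<infinity>" for A by (simp add: f_def)
    fix A assume A: "range A \<subseteq> range cyl" "decseq A" "(\<Inter>i. A i) = {}"
    then have "\<exists>M. A i = cyl M" for i by blast
    then obtain M where M: "\<And>i. A i = cyl (M i)" by metis
    \<comment> \<open>The chosen representatives need not decrease although the cylinders do; their
      finite intersections decrease and have the same cylinders.\<close>
    define M' where "M' i = (\<Inter>j\<le>i. M j)" for i
    have A_eq: "A i = cyl (M' i)" for i
    proof (induction i)
      case (Suc i)
      have "M' (Suc i) = M' i \<inter> M (Suc i)" by (auto simp: M'_def le_Suc_eq)
      then have "cyl (M' (Suc i)) = A i \<inter> A (Suc i)" using Suc M by (simp add: cyl_inter)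
      then show ?case using A(2) by (auto simp: decseq_Suc_iff)
    qed (simp add: M'_def M)
    have dec: "decseq M'" by (force simp: decseq_def M'_def)
    have "(\<lambda>i. \<nu> (M' i)) \<longlonglongrightarrow> 0"
    proof (rule LIMSEQ_I)
      fix r :: real assume "r > 0"
      then obtain m where "\<delta> m < r"
        using order_tendstoD(2)[OF \<delta>_lim, of r] by (auto simp: eventually_sequentially)
      moreover obtain i where "\<nu> (M' i) \<le> \<delta> m"
        using compactness[OF dec, of m] A(3) A_eq by auto
      moreover have "\<nu> (M' j) \<le> \<nu> (M' i)" if "j \<ge> i" for j
        using dec that by (intro mono) (auto simp: decseq_def)
      ultimately show "\<exists>no. \<forall>n\<ge>no. norm (\<nu> (M' n) - 0) < r"
        using nonneg by (intro exI[of _ i]) force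
    qed
    then have "(\<lambda>i. ennreal (\<nu> (M' i))) \<longlonglongrightarrow> ennreal 0" by (rule tendsto_ennrealI)
    then show "(\<lambda>i. f (A i)) \<longlonglongrightarrow> 0" unfolding A_eq f_cyl ennreal_0 .
  qed
  then obtain \<mu> where \<mu>: "\<And>M. \<mu> (cyl M) = ennreal (\<nu> M)" "measure_space S (sigma_sets S (range cyl)) \<mu>"
    using f_cyl by auto
  let ?P = "measure_of S (range cyl) \<mu>"
  have sets: "sets ?P = sigma_sets S (range cyl)" by (rule sets_measure_of[OF range_cyl])
  have "emeasure ?P (cyl M) = ennreal (\<nu> M)" for M
    using \<mu> by (subst emeasure_measure_of[OF refl range_cyl]) (auto simp: sets measure_space_def)
  moreover have "space ?P = S" "\<And>M. cyl M \<in> sets ?P" using range_cyl by auto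
  ultimately show ?thesis by blast
qed

end

section \<open>Integration against a tight content\<close>

locale dominated_functional = dominated_extension R
  for R :: "('x \<Rightarrow> real) \<Rightarrow> real \<Rightarrow> bool" +
  fixes Q :: "('x \<Rightarrow> real) \<Rightarrow> real" and unit_value :: real
  assumes Q_add: "F \<in> D \<Longrightarrow> G \<in> D \<Longrightarrow> Q (\<lambda>x. F x + G x) = Q F + Q G"
    and Q_scale: "F \<in> D \<Longrightarrow> Q (\<lambda>x. c * F x) = c * Q F"
    and Q_nonneg: "F \<in> D \<Longrightarrow> (\<And>x. F x \<ge> 0) \<Longrightarrow> Q F \<ge> 0"
    and Q_R: "F \<in> D \<Longrightarrow> R F r \<Longrightarrow> Q F = r"
    and R_one: "R (\<lambda>_. 1) unit_value"
begin

lemma Q_diff: "F \<in> D \<Longrightarrow> G \<in> D \<Longrightarrow> Q (\<lambda>x. F x - G x) = Q F - Q G"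
  using Q_add[of F "\<lambda>x. - 1 * G x"] Q_scale[of G "- 1"] D_scale[of G "- 1"] by simp

lemma D_diff: "F \<in> D \<Longrightarrow> G \<in> D \<Longrightarrow> (\<lambda>x. F x - G x) \<in> D"
  using D_add[of F "\<lambda>x. - G x"] D_neg[of G] by simp

lemma Q_mono: "F \<in> D \<Longrightarrow> G \<in> D \<Longrightarrow> (\<And>x. F x \<le> G x) \<Longrightarrow> Q F \<le> Q G"
  using Q_nonneg[OF D_diff[of G F]] Q_diff[of G F] by simp

lemma D_bounded: "(\<And>x. \<bar>F x\<bar> \<le> c) \<Longrightarrow> F \<in> D"
  unfolding D_def using R_scale[OF R_one, of c] by (auto intro!: exI[of _ "\<lambda>_. c"])

lemma D_dominated: "G \<in> D \<Longrightarrow> (\<And>x. \<bar>F x\<bar> \<le> \<bar>G x\<bar>) \<Longrightarrow> F \<in> D"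
  unfolding D_def by (blast intro: order_trans)

lemma D_one: "(\<lambda>_. 1) \<in> D"
  by (rule D_bounded[of _ 1]) simp

lemma D_of_square:
  assumes "(\<lambda>x. (f x)\<^sup>2) \<in> D"
  shows "f \<in> D"
proof (rule D_dominated[OF D_add[OF D_one assms]])
  fix x
  have "0 \<le> (\<bar>f x\<bar> - 1)\<^sup>2" by simp
  then have "2 * \<bar>f x\<bar> \<le> 1 + (f x)\<^sup>2" by (simp add: power2_eq_square algebra_simps)
  then show "\<bar>f x\<bar> \<le> \<bar>1 + (f x)\<^sup>2\<bar>" by linarith
qed

lemma Q_abs_le:
  assumes "F \<in> D" "G \<in> D" "\<And>x. \<bar>F x\<bar> \<le> G x"
  shows "\<bar>Q F\<bar> \<le> Q G"
proof -
  have "Q F \<le> Q G" using assms by (intro Q_mono) (auto intro: abs_le_D1)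
  moreover have "Q (\<lambda>x. - 1 * F x) \<le> Q G"
    using assms by (intro Q_mono D_scale) (auto intro: abs_le_D2)
  ultimately show ?thesis using Q_scale[OF assms(1), of "- 1"] by simp
qed

definition content :: "'x set \<Rightarrow> real" where "content M = Q (indicator M)"

lemma D_indicator: "indicator M \<in> D"
  by (rule D_bounded[of _ 1]) (simp add: indicator_def)

lemma content_nonneg: "content M \<ge> 0"
  unfolding content_def by (rule Q_nonneg[OF D_indicator]) simp

lemma content_additive: "A \<inter> B = {} \<Longrightarrow> content (A \<union> B) = content A + content B"
proof -
  assume "A \<inter> B = {}"
  then have "indicator (A \<union> B) = (\<lambda>x. indicator A x + indicator B x :: real)"
    by (auto simp: indicator_def fun_eq_iff)
  then show ?thesis unfolding content_def using Q_add[OF D_indicator D_indicator] by simp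
qed

lemma content_mono: "A \<subseteq> B \<Longrightarrow> content A \<le> content B"
  unfolding content_def by (rule Q_mono[OF D_indicator D_indicator]) (auto simp: indicator_def)

lemma content_union_le: "content (A \<union> B) \<le> content A + content B"
proof -
  have "content (A \<union> B) = content A + content (B - A)"
    using content_additive[of A "B - A"] by auto
  also have "content (B - A) \<le> content B" by (rule content_mono) auto
  finally show ?thesis by simp
qed

lemma content_UN_le: "finite I \<Longrightarrow> content (\<Union>i\<in>I. A i) \<le> (\<Sum>i\<in>I. content (A i))"
proof (induction I rule: finite_induct)
  case empty
  show ?case using content_additive[of "{}" "{}"] by simp
next
  case (insert i I)
  then show ?case using content_union_le[of "A i" "\<Union>i\<in>I. A i"] by simp
qed

lemma markov:
  assumes "F \<in> D" "\<And>x. F x \<ge> 0" "c > 0"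
  shows "content {x. F x > c} \<le> Q F / c"
proof -
  have "c * content {x. F x > c} = Q (\<lambda>x. c * indicator {x. F x > c} x)"
    unfolding content_def by (rule Q_scale[OF D_indicator, symmetric])
  also have "\<dots> \<le> Q F"
    using assms by (intro Q_mono D_scale[OF D_indicator]) (auto simp: indicator_def)
  finally show ?thesis using assms(3) by (simp add: field_simps)
qed

lemma Q_sum:
  assumes "finite I" "\<And>i. i \<in> I \<Longrightarrow> F i \<in> D"
  shows "(\<lambda>x. \<Sum>i\<in>I. F i x) \<in> D \<and> Q (\<lambda>x. \<Sum>i\<in>I. F i x) = (\<Sum>i\<in>I. Q (F i))"
  using assms
proof (induction I rule: finite_induct)
  case empty
  show ?case using D_zero Q_scale[OF D_zero, of 0] by simp
next
  case (insert i I)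
  then show ?case using D_add[of "F i"] Q_add[of "F i"] by simp
qed

end

section \<open>Identifying the positive functional with an integral over ultrafilters\<close>

locale tight_functional = dominated_functional R Q unit_value
  for R :: "('x \<Rightarrow> real) \<Rightarrow> real \<Rightarrow> bool" and Q unit_value +
  fixes DD :: "nat \<Rightarrow> 'x set set" and \<delta> :: "nat \<Rightarrow> real" and P :: "'x filter measure"
  assumes DD_inter: "M \<in> DD m \<Longrightarrow> N \<in> DD m \<Longrightarrow> M \<inter> N \<in> DD m"
    and DD_nonempty: "DD m \<noteq> {}"
    and DD_compl: "M \<in> DD m \<Longrightarrow> content (- M) \<le> \<delta> m"
    and \<delta>_tendsto: "\<delta> \<longlonglongrightarrow> 0"
    and P_space: "space P = tight_content.S DD"
    and P_sets: "tight_content.cyl DD M \<in> sets P"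
    and P_emeasure: "emeasure P (tight_content.cyl DD M) = ennreal (content M)"
begin

sublocale tight_content content DD \<delta>
  by unfold_locales
    (fact content_additive content_nonneg DD_inter DD_nonempty DD_compl \<delta>_tendsto)+

lemma P_finite: "finite_measure P"
  by (rule finite_measureI) (simp add: P_space P_emeasure flip: cyl_UNIV)

lemma S_not_bot: "U \<in> S \<Longrightarrow> U \<noteq> bot"
  by (simp add: S_def ultrafilter_def)

lemma measure_cyl: "measure P (cyl M) = content M"
  by (simp add: measure_def P_emeasure content_nonneg)

text \<open>A limit may equal \<open>a\<close> although \<open>f\<close> exceeds \<open>a\<close>
  throughout, so the strict inequality is a union of cylinders with a gap
  \<open>1 / Suc n\<close>.\<close>

lemma Lim_measurable:
  fixes f :: "'x \<Rightarrow> real"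
  assumes lim: "\<And>U. U \<in> S \<Longrightarrow> (f \<longlongrightarrow> Lim U f) U"
  shows "(\<lambda>U. Lim U f) \<in> borel_measurable P"
  unfolding borel_measurable_iff_greater
proof
  fix a
  have "{U\<in>space P. a < Lim U f} = (\<Union>n. cyl {x. a + 1 / real (Suc n) < f x})"
  proof (intro set_eqI iffI)
    fix U assume "U \<in> {U\<in>space P. a < Lim U f}"
    then have U: "U \<in> S" "a < Lim U f" by (auto simp: P_space)
    then obtain n where "1 / real (Suc n) < Lim U f - a"
      using nat_approx_posE[of "Lim U f - a"] by auto
    then have "a + 1 / real (Suc n) < Lim U f" by simp
    then have "eventually (\<lambda>x. a + 1 / real (Suc n) < f x) U"
      by (rule order_tendstoD(1)[OF lim[OF U(1)]])
    then have "U \<in> cyl {x. a + 1 / real (Suc n) < f x}"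
      using U(1) by (simp add: cyl_def)
    then show "U \<in> (\<Union>n. cyl {x. a + 1 / real (Suc n) < f x})"
      by (rule UN_I[OF UNIV_I])
  next
    fix U assume "U \<in> (\<Union>n. cyl {x. a + 1 / real (Suc n) < f x})"
    then obtain n where n: "U \<in> S" "eventually (\<lambda>x. a + 1 / real (Suc n) < f x) U"
      by (auto simp: cyl_def)
    have "a + 1 / real (Suc n) \<le> Lim U f"
      by (rule tendsto_lowerbound[OF lim[OF n(1)] eventually_mono[OF n(2)] S_not_bot[OF n(1)]]) simp
    moreover have "0 < 1 / real (Suc n)" by simp
    ultimately have "a < Lim U f" by linarith
    then show "U \<in> {U\<in>space P. a < Lim U f}" using n(1) by (simp add: P_space)
  qed
  then show "{U\<in>space P. a < Lim U f} \<in> sets P" using P_sets by auto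
qed

lemma bounded_Lim:
  fixes f :: "'x \<Rightarrow> real"
  assumes "\<And>x. \<bar>f x\<bar> \<le> c" "U \<in> S"
  shows "(f \<longlongrightarrow> Lim U f) U"
  by (rule ultrafilter_tendsto[OF S_ultrafilter[OF assms(2)], of _ c]) (simp add: assms(1))

text \<open>Cutting the range of \<open>f\<close> into levels of width \<open>\<epsilon>\<close>
  gives step functions on both sides with the same value, because cylinders measure what their sets
  contain; each side errs by at most \<open>\<epsilon> * content UNIV\<close>.\<close>

lemma integral_bounded:
  fixes f :: "'x \<Rightarrow> real"
  assumes bdd: "\<And>x. \<bar>f x\<bar> \<le> c"
  shows "integrable P (\<lambda>U. Lim U f)" "(\<integral>U. Lim U f \<partial>P) = Q f"
proof -
  interpret P: finite_measure P by (rule P_finite)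
  have meas: "(\<lambda>U. Lim U f) \<in> borel_measurable P"
    by (rule Lim_measurable[OF bounded_Lim[OF bdd]])
  have "\<bar>Lim U f\<bar> \<le> c" if "U \<in> S" for U
  proof (rule tendsto_upperbound[OF tendsto_rabs[OF bounded_Lim[OF bdd that]] _ S_not_bot[OF that]])
    show "\<forall>\<^sub>F x in U. \<bar>f x\<bar> \<le> c" using bdd by simp
  qed
  then show int: "integrable P (\<lambda>U. Lim U f)"
    using meas by (intro P.integrable_const_bound[of _ c]) (auto simp: P_space intro!: AE_I2)
  have fD: "f \<in> D" by (rule D_bounded[OF bdd])
  have one: "content UNIV = Q (\<lambda>_. 1)" by (simp add: content_def)
  have approx: "\<bar>(\<integral>U. Lim U f \<partial>P) - Q f\<bar> \<le> 2 * \<epsilon> * content UNIV" if "\<epsilon> > 0" for \<epsilon>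
  proof -
    define M where "M k = {x. \<lfloor>f x / \<epsilon>\<rfloor> = k}" for k
    define I where "I = {\<lfloor>- c / \<epsilon>\<rfloor>..\<lfloor>c / \<epsilon>\<rfloor>}"
    define s where "s x = (\<Sum>k\<in>I. (\<epsilon> * of_int k) * indicator (M k) x)" for x
    define s' where "s' U = (\<Sum>k\<in>I. (\<epsilon> * of_int k) * indicator (cyl (M k)) U)" for U
    have s_eq: "s x = \<epsilon> * of_int \<lfloor>f x / \<epsilon>\<rfloor>" for x
    proof -
      have "- c \<le> f x" "f x \<le> c" using bdd[of x] by (auto simp: abs_le_iff)
      then have "- c / \<epsilon> \<le> f x / \<epsilon>" "f x / \<epsilon> \<le> c / \<epsilon>"
        using that divide_right_mono[of "- c" "f x" \<epsilon>] divide_right_mono[of "f x" c \<epsilon>] by simp_all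
      then have "\<lfloor>f x / \<epsilon>\<rfloor> \<in> I" unfolding I_def by (auto intro: floor_mono)
      moreover have "s x = (\<Sum>k\<in>I. if k = \<lfloor>f x / \<epsilon>\<rfloor> then \<epsilon> * of_int k else 0)"
        unfolding s_def by (rule sum.cong) (auto simp: M_def indicator_def)
      moreover have "finite I" by (simp add: I_def)
      ultimately show ?thesis by (simp add: sum.delta)
    qed
    have close: "\<bar>f x - s x\<bar> \<le> \<epsilon>" for x
    proof -
      have a: "of_int \<lfloor>f x / \<epsilon>\<rfloor> \<le> f x / \<epsilon>" "f x / \<epsilon> \<le> of_int \<lfloor>f x / \<epsilon>\<rfloor> + 1"
        by linarith+
      have "\<epsilon> * of_int \<lfloor>f x / \<epsilon>\<rfloor> \<le> \<epsilon> * (f x / \<epsilon>)" "\<epsilon> * (f x / \<epsilon>) \<le> \<epsilon> * (of_int \<lfloor>f x / \<epsilon>\<rfloor> + 1)"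
        using that by (auto intro: mult_left_mono[OF a(1)] mult_left_mono[OF a(2)] simp del: times_divide_eq_right nonzero_mult_div_cancel_left)
      then show ?thesis using that unfolding s_eq by (simp add: distrib_left abs_le_iff)
    qed
    have fin: "finite I" by (simp add: I_def)
    have s: "s \<in> D" "Q s = (\<Sum>k\<in>I. \<epsilon> * of_int k * content (M k))"
      using Q_sum[OF fin, of "\<lambda>k x. (\<epsilon> * of_int k) * indicator (M k) x"]
      by (auto simp: s_def[abs_def] content_def D_scale D_indicator Q_scale)
    have "(\<lambda>x. \<bar>f x - s x\<bar>) \<in> D" "(\<lambda>x. f x - s x) \<in> D" "(\<lambda>_. \<epsilon>) \<in> D"
      using close by (auto intro!: D_bounded[of _ \<epsilon>] simp: that less_imp_le)
    then have "\<bar>Q (\<lambda>x. f x - s x)\<bar> \<le> Q (\<lambda>_. \<epsilon>)"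
      using close by (intro Q_abs_le)
    also have "\<dots> = \<epsilon> * content UNIV" using Q_scale[OF D_one, of \<epsilon>] one by simp
    finally have 1: "\<bar>Q f - Q s\<bar> \<le> \<epsilon> * content UNIV" by (simp add: Q_diff[OF fD s(1)])
    have int_term: "integrable P (\<lambda>U. \<epsilon> * of_int k * indicator (cyl (M k)) U)" for k
      using integrable_real_indicator[OF P_sets, of "M k"]
      by (intro Bochner_Integration.integrable_mult_right) (simp add: P_emeasure)
    then have int_s: "integrable P s'"
      unfolding s'_def[abs_def] by (intro Bochner_Integration.integrable_sum)
    have "(\<integral>U. s' U \<partial>P) = (\<Sum>k\<in>I. \<integral>U. \<epsilon> * of_int k * indicator (cyl (M k)) U \<partial>P)"
      unfolding s'_def by (rule Bochner_Integration.integral_sum) (rule int_term)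
    also have "\<dots> = (\<Sum>k\<in>I. \<epsilon> * of_int k * content (M k))"
    proof (rule sum.cong[OF refl])
      fix k
      have "cyl (M k) \<inter> space P = cyl (M k)" by (auto simp: P_space cyl_def)
      then show "(\<integral>U. \<epsilon> * of_int k * indicator (cyl (M k)) U \<partial>P) = \<epsilon> * of_int k * content (M k)"
        by (simp add: measure_cyl)
    qed
    finally have "(\<integral>U. s' U \<partial>P) = (\<Sum>k\<in>I. \<epsilon> * of_int k * content (M k))" .
    then have 2: "(\<integral>U. s' U \<partial>P) = Q s" using s(2) by simp
    have close': "\<bar>Lim U f - s' U\<bar> \<le> \<epsilon>" if U: "U \<in> S" for U
    proof -
      have "((\<lambda>x. indicator (M k) x :: real) \<longlongrightarrow> indicator (cyl (M k)) U) U" for k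
      proof (cases "U \<in> cyl (M k)")
        case True
        then have "eventually (\<lambda>x. indicator (M k) x = (1::real)) U"
          by (auto simp: cyl_def elim: eventually_mono)
        then show ?thesis using True by (simp add: tendsto_eventually)
      next
        case False
        then have "eventually (\<lambda>x. x \<notin> M k) U"
          using U ultrafilter_not_iff[OF S_ultrafilter[OF U], of "\<lambda>x. x \<in> M k"] by (simp add: cyl_def)
        then have "eventually (\<lambda>x. indicator (M k) x = (0::real)) U"
          by (auto elim: eventually_mono)
        then show ?thesis using False by (simp add: tendsto_eventually)
      qed
      then have "(s \<longlongrightarrow> s' U) U" unfolding s_def[abs_def] s'_def by (intro tendsto_intros)
      then have "((\<lambda>x. \<bar>f x - s x\<bar>) \<longlongrightarrow> \<bar>Lim U f - s' U\<bar>) U"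
        by (intro tendsto_intros bounded_Lim[OF bdd U])
      then show ?thesis
        by (rule tendsto_upperbound[OF _ _ S_not_bot[OF U]]) (simp add: close)
    qed
    have "\<bar>(\<integral>U. Lim U f \<partial>P) - (\<integral>U. s' U \<partial>P)\<bar> = \<bar>\<integral>U. Lim U f - s' U \<partial>P\<bar>"
      using int int_s by simp
    also have "\<dots> \<le> (\<integral>U. \<bar>Lim U f - s' U\<bar> \<partial>P)" by (rule integral_abs_bound)
    also have "\<dots> \<le> (\<integral>U. \<epsilon> \<partial>P)"
      using int int_s close' by (intro integral_mono) (auto simp: P_space)
    also have "\<dots> = \<epsilon> * content UNIV"
      using measure_cyl[of UNIV] by (simp add: cyl_UNIV P_space)
    finally show ?thesis using 1 2 by linarith
  qed
  show "(\<integral>U. Lim U f \<partial>P) = Q f"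
  proof (rule ccontr)
    assume neq: "(\<integral>U. Lim U f \<partial>P) \<noteq> Q f"
    define d where "d = \<bar>(\<integral>U. Lim U f \<partial>P) - Q f\<bar>"
    have "d > 0" using neq by (simp add: d_def)
    define \<epsilon> where "\<epsilon> = d / (4 * (content UNIV + 1))"
    have c0: "content UNIV \<ge> 0" by (rule content_nonneg)
    then have "\<epsilon> > 0" using \<open>d > 0\<close> by (simp add: \<epsilon>_def)
    from approx[OF this] have "d \<le> 2 * \<epsilon> * content UNIV" by (simp add: d_def)
    also have "\<dots> \<le> 2 * \<epsilon> * (content UNIV + 1)" using \<open>\<epsilon> > 0\<close> by simp
    also have "\<dots> = d / 2" using c0 by (simp add: \<epsilon>_def field_simps)
    finally show False using \<open>d > 0\<close> by simp
  qed
qed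

text \<open>Truncations are handled by monotone and dominated convergence under the integral. For
  \<open>Q\<close>, which is only finitely additive, the pointwise bound
  \<open>\<bar>k N x - f x\<bar> \<le> (f x)^2 / N\<close> takes their place.\<close>

lemma integral_square_dominated:
  fixes f :: "'x \<Rightarrow> real"
  assumes lim: "\<And>U. U \<in> S \<Longrightarrow> (f \<longlongrightarrow> Lim U f) U"
    and sq: "(\<lambda>x. (f x)\<^sup>2) \<in> D"
  shows "integrable P (\<lambda>U. Lim U f)" "(\<integral>U. Lim U f \<partial>P) = Q f"
proof -
  interpret P: finite_measure P by (rule P_finite)
  have fD: "f \<in> D" by (rule D_of_square[OF sq])
  have meas: "(\<lambda>U. Lim U f) \<in> borel_measurable P" by (rule Lim_measurable[OF lim])
  define g where "g N x = min \<bar>f x\<bar> (real N)" for N x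
  define k where "k N x = max (- real N) (min (f x) (real N))" for N x
  have g_bdd: "\<bar>g N x\<bar> \<le> real N" for N x by (simp add: g_def)
  have k_bdd: "\<bar>k N x\<bar> \<le> real N" for N x by (auto simp: k_def)
  have g_lim: "Lim U (g N) = min \<bar>Lim U f\<bar> (real N)" if "U \<in> S" for U N
    unfolding g_def[abs_def]
    by (rule tendsto_Lim[OF _ tendsto_min[OF tendsto_rabs[OF lim[OF that]] tendsto_const]])
      (simp add: S_not_bot[OF that])
  have k_lim: "Lim U (k N) = max (- real N) (min (Lim U f) (real N))" if "U \<in> S" for U N
    unfolding k_def[abs_def]
    by (rule tendsto_Lim[OF _ tendsto_max[OF tendsto_const tendsto_min[OF lim[OF that] tendsto_const]]])
      (simp add: S_not_bot[OF that])
  have abs_D: "(\<lambda>x. \<bar>f x\<bar>) \<in> D" by (rule D_dominated[OF fD]) simp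
  have g_D: "g N \<in> D" for N by (rule D_bounded[OF g_bdd])
  have "integrable P (\<lambda>U. \<bar>Lim U f\<bar>)"
  proof -
    have gi: "integrable P (\<lambda>U. min \<bar>Lim U f\<bar> (real N))"
      and gq: "(\<integral>U. min \<bar>Lim U f\<bar> (real N) \<partial>P) = Q (g N)" for N
    proof -
      have "integrable P (\<lambda>U. Lim U (g N)) \<longleftrightarrow> integrable P (\<lambda>U. min \<bar>Lim U f\<bar> (real N))"
        by (rule Bochner_Integration.integrable_cong) (auto simp: P_space g_lim)
      then show "integrable P (\<lambda>U. min \<bar>Lim U f\<bar> (real N))"
        using integral_bounded(1)[OF g_bdd] by simp
      have "(\<integral>U. Lim U (g N) \<partial>P) = (\<integral>U. min \<bar>Lim U f\<bar> (real N) \<partial>P)"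
        by (rule Bochner_Integration.integral_cong) (auto simp: P_space g_lim)
      then show "(\<integral>U. min \<bar>Lim U f\<bar> (real N) \<partial>P) = Q (g N)"
        using integral_bounded(2)[OF g_bdd] by simp
    qed
    have inc: "incseq (\<lambda>N. Q (g N))"
      by (rule monoI) (intro Q_mono g_D, auto simp: g_def)
    have "Q (g N) \<le> Q (\<lambda>x. \<bar>f x\<bar>)" for N
      by (intro Q_mono g_D abs_D) (simp add: g_def)
    then obtain l where l: "(\<lambda>N. Q (g N)) \<longlonglongrightarrow> l"
      using incseq_convergent[OF inc] by blast
    have "(\<lambda>N. min \<bar>Lim U f\<bar> (real N)) \<longlonglongrightarrow> \<bar>Lim U f\<bar>" for U
    proof (rule tendsto_eventually)
      have "eventually (\<lambda>N. \<bar>Lim U f\<bar> \<le> real N) sequentially"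
        using eventually_ge_at_top[of "nat \<lceil>\<bar>Lim U f\<bar>\<rceil>"] by eventually_elim linarith
      then show "\<forall>\<^sub>F N in sequentially. min \<bar>Lim U f\<bar> (real N) = \<bar>Lim U f\<bar>"
        by eventually_elim simp
    qed
    note lim_min = this
    show ?thesis
    proof (rule integrable_monotone_convergence)
      show "integrable P (\<lambda>U. min \<bar>Lim U f\<bar> (real N))" for N by (rule gi)
      show "AE U in P. mono (\<lambda>N. min \<bar>Lim U f\<bar> (real N))"
        by (rule AE_I2, rule monoI, rule min.mono) simp_all
      show "AE U in P. (\<lambda>N. min \<bar>Lim U f\<bar> (real N)) \<longlonglongrightarrow> \<bar>Lim U f\<bar>"
        by (rule AE_I2, rule lim_min)
      show "(\<lambda>N. \<integral>U. min \<bar>Lim U f\<bar> (real N) \<partial>P) \<longlonglongrightarrow> l" unfolding gq by (rule l)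
      show "(\<lambda>U. \<bar>Lim U f\<bar>) \<in> borel_measurable P" using meas by (rule borel_measurable_abs)
    qed
  qed
  then show int: "integrable P (\<lambda>U. Lim U f)" using meas by (rule integrable_abs_cancel)
  have kq: "(\<integral>U. max (- real N) (min (Lim U f) (real N)) \<partial>P) = Q (k N)" for N
  proof -
    have "(\<integral>U. Lim U (k N) \<partial>P) = (\<integral>U. max (- real N) (min (Lim U f) (real N)) \<partial>P)"
      by (rule Bochner_Integration.integral_cong) (auto simp: P_space k_lim)
    then show ?thesis using integral_bounded(2)[OF k_bdd] by simp
  qed
  have "(\<lambda>N. \<integral>U. max (- real N) (min (Lim U f) (real N)) \<partial>P) \<longlonglongrightarrow> (\<integral>U. Lim U f \<partial>P)"
  proof (rule integral_dominated_convergence[where w = "\<lambda>U. \<bar>Lim U f\<bar>"])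
    show "AE U in P. (\<lambda>N. max (- real N) (min (Lim U f) (real N))) \<longlonglongrightarrow> Lim U f"
    proof (rule AE_I2, rule tendsto_eventually)
      fix U
      have "eventually (\<lambda>N. \<bar>Lim U f\<bar> \<le> real N) sequentially"
        using eventually_ge_at_top[of "nat \<lceil>\<bar>Lim U f\<bar>\<rceil>"] by eventually_elim linarith
      then show "\<forall>\<^sub>F N in sequentially. max (- real N) (min (Lim U f) (real N)) = Lim U f"
        by eventually_elim (auto simp: abs_le_iff)
    qed
    show "AE U in P. norm (max (- real N) (min (Lim U f) (real N))) \<le> \<bar>Lim U f\<bar>" for N
      by (rule AE_I2) (auto simp: max_def min_def)
  qed (use meas int in auto)
  moreover have "(\<lambda>N. Q (k N)) \<longlonglongrightarrow> Q f"
  proof -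
    have bound: "norm (Q (k N) - Q f) \<le> Q (\<lambda>x. (f x)\<^sup>2) * (1 / real N)" if "N > 0" for N
    proof -
      have kD: "k N \<in> D" by (rule D_bounded[OF k_bdd])
      have "\<bar>Q (\<lambda>x. k N x - f x)\<bar> \<le> Q (\<lambda>x. 1 / real N * (f x)\<^sup>2)"
      proof (intro Q_abs_le D_diff kD fD D_scale sq)
        fix x
        show "\<bar>k N x - f x\<bar> \<le> 1 / real N * (f x)\<^sup>2"
        proof (cases "\<bar>f x\<bar> \<le> real N")
          case True
          then have "k N x = f x" by (auto simp: k_def abs_le_iff)
          then show ?thesis by simp
        next
          case False
          have "\<bar>k N x - f x\<bar> \<le> \<bar>f x\<bar>" by (auto simp: k_def max_def min_def)
          also have "\<bar>f x\<bar> = 1 / real N * (real N * \<bar>f x\<bar>)" using that by simp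
          also have "real N * \<bar>f x\<bar> \<le> \<bar>f x\<bar> * \<bar>f x\<bar>"
            using False by (intro mult_right_mono) auto
          also have "\<bar>f x\<bar> * \<bar>f x\<bar> = (f x)\<^sup>2" by (simp add: power2_eq_square flip: abs_mult)
          finally show ?thesis by (simp add: divide_right_mono)
        qed
      qed
      then show ?thesis unfolding Q_diff[OF kD fD] Q_scale[OF sq] by (simp add: mult.commute)
    qed
    have ev: "eventually (\<lambda>N. norm (Q (k N) - Q f) \<le> Q (\<lambda>x. (f x)\<^sup>2) * (1 / real N)) sequentially"
      by (rule eventually_mono[OF eventually_gt_at_top[of "0::nat"]]) (rule bound)
    have "(\<lambda>N. Q (\<lambda>x. (f x)\<^sup>2) * (1 / real N)) \<longlonglongrightarrow> Q (\<lambda>x. (f x)\<^sup>2) * 0"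
      by (rule tendsto_mult[OF tendsto_const lim_1_over_n])
    then have null: "(\<lambda>N. Q (\<lambda>x. (f x)\<^sup>2) * (1 / real N)) \<longlonglongrightarrow> 0"
      by (simp only: mult_zero_right)
    have "(\<lambda>N. Q (k N) - Q f) \<longlonglongrightarrow> 0"
      by (rule Lim_null_comparison[OF ev null])
    then show ?thesis by (rule LIM_zero_cancel)
  qed
  ultimately show "(\<integral>U. Lim U f \<partial>P) = Q f" unfolding kq by (rule LIMSEQ_unique)
qed

end

section \<open>Continuity of the Hilbert seminorm\<close>

lemma seminorm_nonneg: "seminorm p \<Longrightarrow> p x \<ge> 0"
proof -
  assume p: "seminorm p"
  have "p (0 *\<^sub>R x) = \<bar>0\<bar> * p x" "p (- 1 *\<^sub>R x) = \<bar>- 1\<bar> * p x"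
    using p unfolding seminorm_def by blast+
  moreover have "p (x + - 1 *\<^sub>R x) \<le> p x + p (- 1 *\<^sub>R x)" using p unfolding seminorm_def by blast
  ultimately show ?thesis by simp
qed

lemma seminorm_triangle: "seminorm p \<Longrightarrow> p (x + y) \<le> p x + p y"
  and seminorm_scaleR: "seminorm p \<Longrightarrow> p (c *\<^sub>R x) = \<bar>c\<bar> * p x"
  unfolding seminorm_def by blast+

lemma seminorm_minus_commute: "seminorm p \<Longrightarrow> p (x - y) = p (y - x)"
  using seminorm_scaleR[of p "- 1" "x - y"] by simp

lemma seminorm_abs_diff_le:
  assumes "seminorm p"
  shows "\<bar>p x - p y\<bar> \<le> p (x - y)"
  using seminorm_triangle[OF assms, of "x - y" y] seminorm_triangle[OF assms, of "y - x" x]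
    seminorm_minus_commute[OF assms, of x y] by simp

lemma completion_const: "seminorm p \<Longrightarrow> (\<lambda>_. x) \<in> completion p"
  using seminorm_scaleR[of p 0 0] by (simp add: completion_def)

lemma completion_add:
  assumes p: "seminorm p" and s: "s \<in> completion p" and t: "t \<in> completion p"
  shows "(\<lambda>k. s k + t k) \<in> completion p"
  unfolding completion_def
proof (intro CollectI allI impI)
  fix e :: real assume "e > 0"
  then have e2: "e / 2 > 0" by simp
  obtain M where M: "\<forall>m\<ge>M. \<forall>n\<ge>M. p (s m - s n) < e / 2"
    using s e2 unfolding completion_def by blast
  obtain N where N: "\<forall>m\<ge>N. \<forall>n\<ge>N. p (t m - t n) < e / 2"
    using t e2 unfolding completion_def by blast
  have "p (s m + t m - (s n + t n)) < e" if "m \<ge> max M N" "n \<ge> max M N" for m n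
  proof -
    have eq: "s m + t m - (s n + t n) = (s m - s n) + (t m - t n)" by simp
    have "p (s m - s n) < e / 2" "p (t m - t n) < e / 2" using M N that by auto
    then show ?thesis
      unfolding eq using seminorm_triangle[OF p, of "s m - s n" "t m - t n"] by linarith
  qed
  then show "\<exists>N. \<forall>m\<ge>N. \<forall>n\<ge>N. p (s m + t m - (s n + t n)) < e" by blast
qed

lemma completion_scaleR:
  assumes p: "seminorm p" and s: "s \<in> completion p"
  shows "(\<lambda>k. c *\<^sub>R s k) \<in> completion p"
  unfolding completion_def
proof (intro CollectI allI impI)
  fix e :: real assume "e > 0"
  then have "e / (\<bar>c\<bar> + 1) > 0" by (simp add: add_nonneg_pos)
  then obtain M where M: "\<forall>m\<ge>M. \<forall>n\<ge>M. p (s m - s n) < e / (\<bar>c\<bar> + 1)"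
    using s unfolding completion_def by blast
  have "p (c *\<^sub>R s m - c *\<^sub>R s n) < e" if "m \<ge> M" "n \<ge> M" for m n
  proof -
    have "p (c *\<^sub>R s m - c *\<^sub>R s n) = \<bar>c\<bar> * p (s m - s n)"
      by (simp add: seminorm_scaleR[OF p] flip: scaleR_diff_right)
    also have "\<dots> \<le> (\<bar>c\<bar> + 1) * p (s m - s n)"
      using seminorm_nonneg[OF p] by (intro mult_right_mono) auto
    also have "\<dots> < e" using M[rule_format, OF that] by (simp add: pos_less_divide_eq add_nonneg_pos mult.commute)
    finally show ?thesis .
  qed
  then show "\<exists>N. \<forall>m\<ge>N. \<forall>n\<ge>N. p (c *\<^sub>R s m - c *\<^sub>R s n) < e" by blast
qed

lemma completion_sum:
  assumes p: "seminorm p" and "\<And>i. i \<in> I \<Longrightarrow> s i \<in> completion p"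
  shows "(\<lambda>k. \<Sum>i\<in>I. s i k) \<in> completion p"
  using assms(2)
  by (induction I rule: infinite_finite_induct) (simp_all add: completion_const p completion_add)

lemma completion_norm_tendsto:
  assumes p: "seminorm p" and s: "s \<in> completion p"
  shows "(\<lambda>k. p (s k)) \<longlonglongrightarrow> completion_norm p s"
proof -
  have "Cauchy (\<lambda>k. p (s k))"
    unfolding Cauchy_def dist_real_def
  proof (intro allI impI)
    fix e :: real assume "e > 0"
    then obtain M where M: "\<forall>m\<ge>M. \<forall>n\<ge>M. p (s m - s n) < e"
      using s unfolding completion_def by blast
    have "\<bar>p (s m) - p (s n)\<bar> < e" if "m \<ge> M" "n \<ge> M" for m n
      using M[rule_format, OF that] seminorm_abs_diff_le[OF p, of "s m" "s n"] by linarith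
    then show "\<exists>M. \<forall>m\<ge>M. \<forall>n\<ge>M. \<bar>p (s m) - p (s n)\<bar> < e" by blast
  qed
  then show ?thesis
    unfolding completion_norm_def by (simp add: Cauchy_convergent_iff convergent_LIMSEQ_iff)
qed

lemma completion_norm_nonneg:
  assumes "seminorm p" "s \<in> completion p"
  shows "completion_norm p s \<ge> 0"
  using completion_norm_tendsto[OF assms] by (rule LIMSEQ_le_const) (simp add: seminorm_nonneg assms)

lemma dual_norm_bound:
  assumes q: "seminorm q" and f: "f \<in> dual_space q"
  shows "\<bar>f x\<bar> \<le> dual_norm q f * q x" and "dual_norm q f \<ge> 0"
proof -
  obtain C where lin: "linear f" and C: "\<And>x. \<bar>f x\<bar> \<le> C * q x"
    using f unfolding dual_space_def by blast
  have bdd: "bdd_above ((\<lambda>x. \<bar>f x\<bar>) ` {x. q x \<le> 1})"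
  proof (rule bdd_aboveI2)
    fix x assume "x \<in> {x. q x \<le> 1}"
    then have "C * q x \<le> \<bar>C\<bar> * 1"
      using seminorm_nonneg[OF q] by (intro mult_mono) auto
    then show "\<bar>f x\<bar> \<le> \<bar>C\<bar>" using C[of x] by simp
  qed
  have le: "\<bar>f x\<bar> \<le> dual_norm q f" if "q x \<le> 1" for x
    unfolding dual_norm_def using that by (intro cSUP_upper[OF _ bdd]) simp
  have "q 0 = 0" using seminorm_scaleR[OF q, of 0 0] by simp
  then show "dual_norm q f \<ge> 0" using le[of 0] by simp
  show "\<bar>f x\<bar> \<le> dual_norm q f * q x"
  proof (cases "q x = 0")
    case True
    then show ?thesis using C[of x] by simp
  next
    case False
    then have pos: "q x > 0" using seminorm_nonneg[OF q, of x] by simp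
    have "\<bar>f ((1 / q x) *\<^sub>R x)\<bar> \<le> dual_norm q f"
      using pos by (intro le) (simp add: seminorm_scaleR[OF q])
    then show ?thesis using pos by (simp add: linear_scale[OF lin] abs_mult field_simps)
  qed
qed

context positive_functional
begin

definition hnorm :: "'a \<Rightarrow> real" where "hnorm a = sqrt (L (a * a))"

lemma hnorm_sq: "(hnorm a)\<^sup>2 = L (a * a)"
  by (simp add: hnorm_def square_nonneg)

lemma hnorm_nonneg: "hnorm a \<ge> 0"
  by (simp add: hnorm_def square_nonneg)

lemma seminorm_hnorm: "seminorm hnorm"
  unfolding seminorm_def
proof (intro conjI allI)
  fix x y
  have "(hnorm (x + y))\<^sup>2 = L (x * x) + 2 * L (x * y) + L (y * y)"
    by (simp add: hnorm_sq algebra_simps L_simps)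
  also have "\<dots> \<le> (hnorm x)\<^sup>2 + 2 * (hnorm x * hnorm y) + (hnorm y)\<^sup>2"
    using abs_le_sqrt[of x y] by (simp add: hnorm_sq) (simp add: hnorm_def)
  also have "\<dots> = (hnorm x + hnorm y)\<^sup>2"
    by (simp add: power2_eq_square algebra_simps)
  finally show "hnorm (x + y) \<le> hnorm x + hnorm y"
    by (rule power2_le_imp_le) (simp add: hnorm_nonneg)
next
  fix c x
  show "hnorm (c *\<^sub>R x) = \<bar>c\<bar> * hnorm x"
    by (simp add: hnorm_def L_simps real_sqrt_mult flip: mult.assoc)
qed

text \<open>The unit ball is closed although multiplication is only separately continuous, because by
  Cauchy-Schwarz it is the polar of the functionals \<open>L (b * \<cdot>)\<close>.\<close>

lemma closedin_unit_ball:
  assumes "topspace T = UNIV" "separately_continuous_mult T" "continuous_map T euclideanreal L"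
  shows "closedin T {a. L (a * a) \<le> 1}"
proof -
  have "{a. L (a * a) \<le> 1} = (\<Inter>b. {a\<in>topspace T. L (b * a) \<in> {- hnorm b..hnorm b}})"
  proof (intro set_eqI iffI)
    fix a assume "a \<in> {a. L (a * a) \<le> 1}"
    then have "hnorm b * hnorm a \<le> hnorm b * 1" for b
      by (intro mult_left_mono) (simp_all add: hnorm_def square_nonneg)
    then have "\<bar>L (b * a)\<bar> \<le> hnorm b" for b
      using abs_le_sqrt[of b a] by (simp add: hnorm_def) (meson order_trans)
    then show "a \<in> (\<Inter>b. {a\<in>topspace T. L (b * a) \<in> {- hnorm b..hnorm b}})"
      by (auto simp: assms(1) abs_le_iff minus_le_iff)
  next
    fix a assume "a \<in> (\<Inter>b. {a\<in>topspace T. L (b * a) \<in> {- hnorm b..hnorm b}})"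
    then have "L (a * a) \<le> hnorm a" by auto
    then have *: "hnorm a * hnorm a \<le> hnorm a"
      by (simp flip: power2_eq_square add: hnorm_sq)
    have "hnorm a \<le> 1"
    proof (rule ccontr)
      assume "\<not> hnorm a \<le> 1"
      then have "hnorm a * 1 < hnorm a * hnorm a"
        by (intro mult_strict_left_mono) auto
      then show False using * by simp
    qed
    then show "a \<in> {a. L (a * a) \<le> 1}" by (simp add: hnorm_def)
  qed
  moreover have "closedin T {a\<in>topspace T. L (b * a) \<in> {- hnorm b..hnorm b}}" for b
  proof (rule closedin_continuous_map_preimage)
    have "continuous_map T T (\<lambda>a. b * a)"
      using assms(2) by (simp add: separately_continuous_mult_def)
    from continuous_map_compose[OF this assms(3)]
    show "continuous_map T euclideanreal (\<lambda>a. L (b * a))" by (simp add: o_def)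
  qed simp
  ultimately show ?thesis by (simp add: closedin_INT)
qed

text \<open>The unit ball is a barrel and so contains a neighbourhood of 0; translating and scaling
  that neighbourhood gives continuity at every point.\<close>

lemma continuous_hnorm:
  assumes lc: "locally_convex_topology T" and bar: "barrelled T"
    and "separately_continuous_mult T" "continuous_map T euclideanreal L"
  shows "continuous_map T euclideanreal hnorm"
proof -
  note p = seminorm_hnorm
  let ?B = "{a. L (a * a) \<le> 1}"
  have top: "topspace T = UNIV" using lc by (simp add: locally_convex_topology_def)
  have B: "?B = {a. hnorm a \<le> 1}" by (simp add: hnorm_def)
  have "absolutely_convex ?B"
    unfolding absolutely_convex_def
  proof (intro conjI ballI allI impI)
    show "convex ?B" unfolding B convex_def
    proof (intro ballI allI impI)
      fix x y and u v :: real
      assume xy: "x \<in> {a. hnorm a \<le> 1}" "y \<in> {a. hnorm a \<le> 1}" and uv: "0 \<le> u" "0 \<le> v" "u + v = 1"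
      have "hnorm (u *\<^sub>R x + v *\<^sub>R y) \<le> u * hnorm x + v * hnorm y"
        using seminorm_triangle[OF p, of "u *\<^sub>R x" "v *\<^sub>R y"] uv by (simp add: seminorm_scaleR[OF p])
      also have "\<dots> \<le> u * 1 + v * 1" using xy uv by (intro add_mono mult_left_mono) auto
      finally show "u *\<^sub>R x + v *\<^sub>R y \<in> {a. hnorm a \<le> 1}" using uv by simp
    qed
    fix x and c :: real assume "x \<in> ?B" "\<bar>c\<bar> \<le> 1"
    then have "\<bar>c\<bar> * hnorm x \<le> 1"
      unfolding B using hnorm_nonneg by (intro mult_le_one) auto
    then show "c *\<^sub>R x \<in> ?B" unfolding B by (simp add: seminorm_scaleR[OF p])
  qed
  moreover have "absorbing ?B"
    unfolding absorbing_def B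
  proof (intro allI)
    fix x
    let ?r = "1 / (hnorm x + 1)"
    have pos: "hnorm x + 1 > 0" using hnorm_nonneg[of x] by simp
    have "hnorm (c *\<^sub>R x) \<le> 1" if "\<bar>c\<bar> \<le> ?r" for c
    proof -
      have "\<bar>c\<bar> * hnorm x \<le> ?r * (hnorm x + 1)"
        using that pos hnorm_nonneg[of x] by (intro mult_mono) auto
      then show ?thesis using pos by (simp add: seminorm_scaleR[OF p])
    qed
    then show "\<exists>r>0. \<forall>c. \<bar>c\<bar> \<le> r \<longrightarrow> c *\<^sub>R x \<in> {a. hnorm a \<le> 1}"
      using pos by (intro exI[of _ ?r]) auto
  qed
  moreover have "closedin T ?B" by (rule closedin_unit_ball[OF top assms(3,4)])
  ultimately obtain U where U: "openin T U" "0 \<in> U" "U \<subseteq> ?B"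
    using bar unfolding barrelled_def by blast
  have affine: "continuous_map T T (\<lambda>a. c *\<^sub>R (a + b))" for b c
  proof -
    have "continuous_map T T (\<lambda>a. a + b)"
      using continuous_map_compose[of T "prod_topology T T" "\<lambda>a. (a, b)" T "\<lambda>(x, y). x + y"] lc top
      by (simp add: locally_convex_topology_def o_def continuous_map_pairedI)
    moreover have "continuous_map T T (\<lambda>a. c *\<^sub>R a)"
      using continuous_map_compose[of T "prod_topology euclideanreal T" "\<lambda>a. (c, a)" T "\<lambda>(c, x). c *\<^sub>R x"] lc
      by (simp add: locally_convex_topology_def o_def continuous_map_pairedI)
    ultimately show ?thesis
      using continuous_map_compose[of T T "\<lambda>a. a + b" T "\<lambda>a. c *\<^sub>R a"] by (simp add: o_def)
  qed
  show ?thesis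
    unfolding continuous_map_def
  proof (intro conjI allI impI)
    fix W :: "real set" assume W: "openin euclideanreal W"
    show "openin T {x\<in>topspace T. hnorm x \<in> W}"
    proof (subst openin_subopen, intro ballI)
      fix a assume a: "a \<in> {x\<in>topspace T. hnorm x \<in> W}"
      then obtain \<epsilon> where \<epsilon>: "\<epsilon> > 0" "\<And>y. \<bar>y - hnorm a\<bar> < \<epsilon> \<Longrightarrow> y \<in> W"
        using W unfolding open_openin[symmetric] open_dist dist_real_def by auto
      let ?V = "{x\<in>topspace T. (2 / \<epsilon>) *\<^sub>R (x + - a) \<in> U}"
      have "openin T ?V" by (rule openin_continuous_map_preimage[OF affine U(1)])
      moreover have "a \<in> ?V" using U(2) by (simp add: top)
      moreover have "?V \<subseteq> {x\<in>topspace T. hnorm x \<in> W}"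
      proof
        fix x assume "x \<in> ?V"
        then have "hnorm ((2 / \<epsilon>) *\<^sub>R (x - a)) \<le> 1" using U(3) B by auto
        then have "2 / \<epsilon> * hnorm (x - a) \<le> 1"
          unfolding seminorm_scaleR[OF p] using \<epsilon>(1) by simp
        then have "hnorm (x - a) \<le> \<epsilon> / 2"
          using \<epsilon>(1) by (simp add: field_simps)
        then have "\<bar>hnorm x - hnorm a\<bar> < \<epsilon>"
          using seminorm_abs_diff_le[OF p, of x a] \<epsilon>(1) by linarith
        then show "x \<in> {x\<in>topspace T. hnorm x \<in> W}" using \<epsilon>(2) by (simp add: top)
      qed
      ultimately show "\<exists>Ta. openin T Ta \<and> a \<in> Ta \<and> Ta \<subseteq> {x\<in>topspace T. hnorm x \<in> W}"
        by blast
    qed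
  qed simp
qed

end

section \<open>The representing measure\<close>

text \<open>Common ground of both hypotheses: the construction of the measure uses them only through
  this positivity.\<close>

locale polynomially_positive =
  fixes L :: "'a::{real_algebra, comm_monoid_mult} \<Rightarrow> real"
  assumes linear_L: "linear L"
    and polyrel_nonneg: "polyrel UNIV a g \<Longrightarrow> (\<And>y. g y \<ge> 0) \<Longrightarrow> L a \<ge> 0"
begin

sublocale positive_functional L
proof (rule positive_functional.intro)
  show "0 \<le> L (a * a)" for a
    by (rule polyrel_nonneg[OF polyrel.mult[OF polyrel.gen polyrel.gen]]) simp_all
qed (rule linear_L)

definition poly_value :: "(('a \<Rightarrow> real) \<Rightarrow> real) \<Rightarrow> real \<Rightarrow> bool" where
  "poly_value g r \<longleftrightarrow> (\<exists>a. polyrel UNIV a g \<and> L a = r)"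

lemma dominated_extension_poly_value: "dominated_extension poly_value"
proof
  show "poly_value (\<lambda>x. f x + g x) (r + s)" if "poly_value f r" "poly_value g s" for f g r s
    using that unfolding poly_value_def by (metis polyrel.add L_simps(1))
  show "poly_value (\<lambda>x. c * f x) (c * r)" if fr: "poly_value f r" for f r c
  proof -
    obtain a where "polyrel UNIV a f" "L a = r" using fr unfolding poly_value_def by blast
    then show ?thesis unfolding poly_value_def
      by (intro exI[of _ "c *\<^sub>R a"]) (simp add: polyrel_scaleR L_simps)
  qed
  show "0 \<le> r" if fr: "poly_value f r" and pos: "\<And>x. 0 \<le> f x" for f r
  proof -
    obtain a where "polyrel UNIV a f" "L a = r" using fr unfolding poly_value_def by blast
    then show ?thesis using polyrel_nonneg pos by blast
  qed
  show "poly_value (\<lambda>_. 0) 0"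
    unfolding poly_value_def using polyrel.const[of UNIV 0] by (intro exI[of _ 0]) (simp add: L_simps)
qed

end

locale extended_functional = polynomially_positive L + dominated_functional poly_value Q "L 1"
  for L :: "'a::{real_algebra, comm_monoid_mult} \<Rightarrow> real" and Q
begin

lemma poly_square: "polyrel UNIV a g \<Longrightarrow> (\<lambda>x. (g x)\<^sup>2) \<in> D \<and> Q (\<lambda>x. (g x)\<^sup>2) = L (a * a)"
proof -
  assume "polyrel UNIV a g"
  then have "polyrel UNIV (a * a) (\<lambda>x. g x * g x)" by (intro polyrel.mult)
  then have R: "poly_value (\<lambda>x. (g x)\<^sup>2) (L (a * a))"
    unfolding poly_value_def power2_eq_square by blast
  then have "(\<lambda>x. (g x)\<^sup>2) \<in> D" unfolding D_def by (auto intro!: exI[of _ "\<lambda>x. (g x)\<^sup>2"])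
  with R show ?thesis using Q_R by blast
qed

lemma poly_in_D: "polyrel UNIV a g \<Longrightarrow> g \<in> D"
  using poly_square D_of_square by blast

lemma Q_poly: "polyrel UNIV a g \<Longrightarrow> Q g = L a"
  by (rule Q_R[OF poly_in_D]) (auto simp: poly_value_def)

lemma content_square_le:
  assumes "polyrel UNIV a g" "c > 0"
  shows "content {x. \<bar>g x\<bar> > c} \<le> L (a * a) / c\<^sup>2"
proof -
  have "{x. \<bar>g x\<bar> > c} = {x. (g x)\<^sup>2 > c\<^sup>2}"
    using assms(2) by (auto simp: abs_le_square_iff[symmetric] simp flip: not_le)
  then show ?thesis
    using markov[of "\<lambda>x. (g x)\<^sup>2" "c\<^sup>2"] poly_square[OF assms(1)] assms(2) by simp
qed

text \<open>\<open>\<bar>s\<bar> \<le> \<tau> + s^2 / \<tau>\<close>. A positive bound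
  \<open>\<tau>\<close> is used in place of \<open>hnorm y\<close>, which may be 0.\<close>

lemma Q_abs_var_le:
  assumes "\<tau> > 0" "hnorm y \<le> \<tau>"
  shows "(\<lambda>x. \<bar>x y\<bar>) \<in> D" "Q (\<lambda>x. \<bar>x y\<bar>) \<le> (L 1 + 1) * \<tau>"
proof -
  have gen: "polyrel UNIV y (\<lambda>x. x y)" by (rule polyrel.gen) simp
  show abs_D: "(\<lambda>x. \<bar>x y\<bar>) \<in> D" by (rule D_dominated[OF poly_in_D[OF gen]]) simp
  have sq: "(\<lambda>x. (x y)\<^sup>2) \<in> D" "Q (\<lambda>x. (x y)\<^sup>2) = L (y * y)" using poly_square[OF gen] by auto
  have "Q (\<lambda>x. \<bar>x y\<bar>) \<le> Q (\<lambda>x. \<tau> * 1 + 1 / \<tau> * (x y)\<^sup>2)"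
  proof (rule Q_mono[OF abs_D D_add[OF D_scale[OF D_one] D_scale[OF sq(1)]]])
    fix x :: "'a \<Rightarrow> real"
    have "0 \<le> (\<bar>x y\<bar> - \<tau>)\<^sup>2 + \<tau> * \<bar>x y\<bar>" using assms(1) by simp
    then have "\<tau> * \<bar>x y\<bar> \<le> \<tau> * (\<tau> * 1 + 1 / \<tau> * (x y)\<^sup>2)"
      using assms(1) by (simp add: power2_eq_square algebra_simps)
    then show "\<bar>x y\<bar> \<le> \<tau> * 1 + 1 / \<tau> * (x y)\<^sup>2"
      using assms(1) by (rule mult_left_le_imp_le)
  qed
  also have "\<dots> = \<tau> * Q (\<lambda>_. 1) + 1 / \<tau> * L (y * y)"
    by (simp only: Q_add[OF D_scale[OF D_one] D_scale[OF sq(1)]] Q_scale[OF D_one] Q_scale[OF sq(1)] sq(2))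
  also have "Q (\<lambda>_. 1) = L 1" by (rule Q_R[OF D_one R_one])
  also have "1 / \<tau> * L (y * y) \<le> \<tau>"
  proof -
    have "L (y * y) \<le> \<tau> * \<tau>"
      unfolding hnorm_sq[symmetric] power2_eq_square
      using assms hnorm_nonneg[of y] by (intro mult_mono) auto
    then show ?thesis using assms(1) by (simp add: field_simps)
  qed
  finally show "Q (\<lambda>x. \<bar>x y\<bar>) \<le> (L 1 + 1) * \<tau>" by (simp add: algebra_simps)
qed

text \<open>Minlos' theorem in this setting: a nuclear representation \<open>a = \<Sum>n. f n a *\<^sub>R y n\<close> bounds all
  coordinates simultaneously, \<open>\<bar>x a\<bar> \<le> q a * Z x\<close> with \<open>Z x = \<Sum>n. \<parallel>f n\<parallel> * \<bar>x (y n)\<bar>\<close>, and \<open>Z\<close> has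
  finite expectation.\<close>

lemma tightness:
  assumes q: "seminorm q" and nuc: "nuclear_canonical_map q hnorm"
  obtains C where "\<And>F m. finite F \<Longrightarrow> m > 0 \<Longrightarrow>
    content {x. \<exists>a\<in>F. \<bar>x a\<bar> > m * (q a + 1)} \<le> C / m"
proof -
  note p = seminorm_hnorm
  obtain f y where f: "\<And>n. f n \<in> dual_space q" and y: "\<And>n. y n \<in> completion hnorm"
    and summable: "summable (\<lambda>n. dual_norm q (f n) * completion_norm hnorm (y n))"
    and lim: "\<And>x. (\<lambda>N. completion_norm hnorm (\<lambda>k. x - (\<Sum>n<N. f n x *\<^sub>R y n k))) \<longlonglongrightarrow> 0"
    using nuc unfolding nuclear_canonical_map_def by blast
  let ?s = "\<lambda>N a k. \<Sum>n<N. f n a *\<^sub>R y n k"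
  define d where "d n = dual_norm q (f n)" for n
  define cn where "cn n = completion_norm hnorm (y n)" for n
  define C0 where "C0 = (\<Sum>n. d n * cn n)"
  have d: "d n \<ge> 0" "\<bar>f n a\<bar> \<le> d n * q a" for n a
    using dual_norm_bound[OF q f] by (auto simp: d_def)
  have cn: "cn n \<ge> 0" for n unfolding cn_def by (rule completion_norm_nonneg[OF p y])
  have sum_le: "(\<Sum>n<N. d n * cn n) \<le> C0" for N
    unfolding C0_def using summable d cn by (intro sum_le_suminf) (auto simp: d_def cn_def)
  have "content {x. \<exists>a\<in>F. \<bar>x a\<bar> > m * (q a + 1)} \<le> ((L 1 + 1) * (C0 + 1) + 1) / m"
    if F: "finite F" and m: "m > 0" for F m
  proof -
    \<comment> \<open>Makes the \<open>card F\<close> error terms \<open>\<eta>^2 / m^2\<close> add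
      up to at most \<open>1 / m\<close>, so that the final constant does not depend on
      \<open>F\<close>.\<close>
    define \<eta> where "\<eta> = sqrt (m / (real (card F) + 1))"
    have \<eta>: "\<eta> > 0" using m by (simp add: \<eta>_def add_nonneg_pos)
    have "\<forall>\<^sub>F N in sequentially. \<forall>a\<in>F. completion_norm hnorm (\<lambda>k. a - ?s N a k) < \<eta>"
      using order_tendstoD(2)[OF lim \<eta>] by (intro eventually_ball_finite[OF F] ballI)
    then obtain N where N: "\<And>a. a \<in> F \<Longrightarrow> completion_norm hnorm (\<lambda>k. a - ?s N a k) < \<eta>"
      by (auto simp: eventually_sequentially)
    \<comment> \<open>Slack for replacing elements of the completion by members \<open>y n k\<close>
      of their Cauchy sequences; weighted by \<open>d n\<close>, it costs at most 1 in
      total.\<close>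
    define \<kappa> where "\<kappa> = 1 / ((\<Sum>n<N. d n) + 1)"
    have sd: "(\<Sum>n<N. d n) \<ge> 0" using d(1) by (rule sum_nonneg)
    then have \<kappa>: "\<kappa> > 0" "\<kappa> * (\<Sum>n<N. d n) \<le> 1" by (auto simp: \<kappa>_def)
    have comp: "(\<lambda>k. a - ?s N a k) \<in> completion hnorm" for a
    proof -
      have "(\<lambda>k. a + - 1 *\<^sub>R ?s N a k) \<in> completion hnorm"
        by (intro completion_add completion_scaleR completion_sum completion_const p y)
      then show ?thesis by simp
    qed
    have "\<forall>\<^sub>F k in sequentially. \<forall>a\<in>F. hnorm (a - ?s N a k) < \<eta>"
      by (intro eventually_ball_finite[OF F] ballI order_tendstoD(2)[OF completion_norm_tendsto[OF p comp] N])
    moreover have "\<forall>\<^sub>F k in sequentially. \<forall>n\<in>{..<N}. hnorm (y n k) < cn n + \<kappa>"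
      using \<kappa>(1) by (intro eventually_ball_finite ballI order_tendstoD(2)[OF completion_norm_tendsto[OF p y]])
        (auto simp: cn_def)
    ultimately have "\<forall>\<^sub>F k in sequentially. (\<forall>a\<in>F. hnorm (a - ?s N a k) < \<eta>)
       \<and> (\<forall>n\<in>{..<N}. hnorm (y n k) < cn n + \<kappa>)"
      by (rule eventually_conj)
    then obtain k where k1: "\<And>a. a \<in> F \<Longrightarrow> hnorm (a - ?s N a k) < \<eta>"
      and k2: "\<And>n. n < N \<Longrightarrow> hnorm (y n k) < cn n + \<kappa>"
      by (auto simp: eventually_sequentially)
    define Z where "Z x = (\<Sum>n<N. d n * \<bar>x (y n k)\<bar>)" for x :: "'a \<Rightarrow> real"
    \<comment> \<open>The points \<open>x\<close> are not linear, so \<open>x a\<close> is compared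
      with the sum of coordinates through the polynomial \<open>g a\<close>. It represents
      \<open>a - ?s N a k\<close>, whose \<open>hnorm\<close> is below \<open>\<eta>\<close> for
      \<open>a\<close> in \<open>F\<close>.\<close>
    define g where "g a x = x a + - 1 * (\<Sum>n<N. f n a * x (y n k))" for a and x :: "'a \<Rightarrow> real"
    have var: "(\<lambda>x. \<bar>x (y n k)\<bar>) \<in> D" "Q (\<lambda>x. \<bar>x (y n k)\<bar>) \<le> (L 1 + 1) * (cn n + \<kappa>)" if "n < N" for n
    proof -
      have \<tau>: "cn n + \<kappa> > 0" "hnorm (y n k) \<le> cn n + \<kappa>"
        using k2[OF that] \<kappa>(1) cn[of n] by auto
      show "(\<lambda>x. \<bar>x (y n k)\<bar>) \<in> D" "Q (\<lambda>x. \<bar>x (y n k)\<bar>) \<le> (L 1 + 1) * (cn n + \<kappa>)"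
        by (rule Q_abs_var_le[OF \<tau>])+
    qed
    have Z_sum: "Z \<in> D \<and> Q Z = (\<Sum>n<N. Q (\<lambda>x. d n * \<bar>x (y n k)\<bar>))"
      unfolding Z_def[abs_def] by (rule Q_sum) (auto intro: D_scale var)
    have "Q Z \<le> (\<Sum>n<N. d n * ((L 1 + 1) * (cn n + \<kappa>)))"
      unfolding conjunct2[OF Z_sum]
      by (rule sum_mono) (simp add: Q_scale var mult_left_mono d)
    also have "\<dots> = (L 1 + 1) * ((\<Sum>n<N. d n * cn n) + \<kappa> * (\<Sum>n<N. d n))"
      by (simp add: sum_distrib_left sum.distrib algebra_simps)
    also have "\<dots> \<le> (L 1 + 1) * (C0 + 1)"
      using sum_le[of N] \<kappa>(2) one_nonneg by (intro mult_left_mono add_mono) auto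
    finally have QZ: "Q Z \<le> (L 1 + 1) * (C0 + 1)" .
    have "content {x. Z x > m} \<le> Q Z / m"
      by (rule markov[OF conjunct1[OF Z_sum] _ m]) (simp add: Z_def sum_nonneg d)
    also have "\<dots> \<le> (L 1 + 1) * (C0 + 1) / m" using QZ m by (intro divide_right_mono) auto
    finally have 1: "content {x. Z x > m} \<le> (L 1 + 1) * (C0 + 1) / m" .
    have 2: "content {x. \<bar>g a x\<bar> > m} \<le> \<eta>\<^sup>2 / m\<^sup>2" if a: "a \<in> F" for a
    proof -
      have "polyrel UNIV (a + - 1 *\<^sub>R ?s N a k) (g a)"
        unfolding g_def[abs_def]
        by (intro polyrel.add polyrel_scaleR polyrel_sum polyrel.gen UNIV_I)
      then have "content {x. \<bar>g a x\<bar> > m} \<le> L ((a - ?s N a k) * (a - ?s N a k)) / m\<^sup>2"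
        using content_square_le m by fastforce
      also have "\<dots> \<le> \<eta>\<^sup>2 / m\<^sup>2"
        unfolding hnorm_sq[symmetric] using k1[OF a] hnorm_nonneg
        by (intro divide_right_mono power_mono) auto
      finally show ?thesis .
    qed
    have "{x. \<exists>a\<in>F. \<bar>x a\<bar> > m * (q a + 1)} \<subseteq> {x. Z x > m} \<union> (\<Union>a\<in>F. {x. \<bar>g a x\<bar> > m})"
    proof
      fix x assume "x \<in> {x. \<exists>a\<in>F. \<bar>x a\<bar> > m * (q a + 1)}"
      then obtain a where a: "a \<in> F" "\<bar>x a\<bar> > m * (q a + 1)" by blast
      show "x \<in> {x. Z x > m} \<union> (\<Union>a\<in>F. {x. \<bar>g a x\<bar> > m})"
      proof (rule ccontr)
        assume "x \<notin> {x. Z x > m} \<union> (\<Union>a\<in>F. {x. \<bar>g a x\<bar> > m})"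
        then have small: "Z x \<le> m" "\<bar>g a x\<bar> \<le> m" using a(1) by auto
        have "\<bar>\<Sum>n<N. f n a * x (y n k)\<bar> \<le> (\<Sum>n<N. \<bar>f n a * x (y n k)\<bar>)" by (rule sum_abs)
        also have "\<dots> \<le> (\<Sum>n<N. q a * (d n * \<bar>x (y n k)\<bar>))"
        proof (rule sum_mono)
          fix n
          have "\<bar>f n a\<bar> * \<bar>x (y n k)\<bar> \<le> d n * q a * \<bar>x (y n k)\<bar>"
            using d(2) by (rule mult_right_mono) simp
          then show "\<bar>f n a * x (y n k)\<bar> \<le> q a * (d n * \<bar>x (y n k)\<bar>)"
            by (simp add: abs_mult ac_simps)
        qed
        also have "\<dots> = q a * Z x" by (simp add: Z_def sum_distrib_left)
        also have "\<dots> \<le> q a * m" using small(1) seminorm_nonneg[OF q] by (rule mult_left_mono)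
        finally have "\<bar>x a\<bar> \<le> q a * m + m" using small(2) by (simp add: g_def)
        then show False using a(2) by (simp add: algebra_simps)
      qed
    qed
    then have "content {x. \<exists>a\<in>F. \<bar>x a\<bar> > m * (q a + 1)}
        \<le> content ({x. Z x > m} \<union> (\<Union>a\<in>F. {x. \<bar>g a x\<bar> > m}))"
      by (rule content_mono)
    also have "\<dots> \<le> content {x. Z x > m} + content (\<Union>a\<in>F. {x. \<bar>g a x\<bar> > m})"
      by (rule content_union_le)
    also have "content (\<Union>a\<in>F. {x. \<bar>g a x\<bar> > m}) \<le> (\<Sum>a\<in>F. content {x. \<bar>g a x\<bar> > m})"
      by (rule content_UN_le[OF F])
    also have "\<dots> \<le> (\<Sum>a\<in>F. \<eta>\<^sup>2 / m\<^sup>2)" by (rule sum_mono[OF 2])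
    also have "\<dots> = real (card F) / (real (card F) + 1) * (1 / m)"
      using m by (simp add: \<eta>_def power2_eq_square)
    also have "\<dots> \<le> 1 * (1 / m)" using m by (intro mult_right_mono) (auto simp: divide_le_eq)
    finally show ?thesis using 1 by (simp add: add_divide_distrib)
  qed
  then show ?thesis by (rule that)
qed

end

section \<open>Transport of the measure to the characters\<close>

lemma evaluation_measurable: "(\<lambda>\<phi>. \<phi> a) \<in> borel_measurable character_sigma"
proof (rule measurableI)
  fix A :: "real set" assume "A \<in> sets borel"
  have sub: "{(\<lambda>\<phi>. \<phi> a) -` S \<inter> characters | a S. S \<in> sets (borel :: real measure)} \<subseteq> Pow characters"
    by auto
  show "(\<lambda>\<phi>. \<phi> a) -` A \<inter> space character_sigma \<in> sets character_sigma"
    unfolding character_sigma_def sets_measure_of[OF sub] space_measure_of_conv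
    using \<open>A \<in> sets borel\<close> by (intro sigma_sets.Basic) blast
qed simp

context extended_functional
begin

lemma representing_measure:
  assumes w_tight: "\<And>F m. finite F \<Longrightarrow> m > 0 \<Longrightarrow> content {x. \<exists>a\<in>F. \<bar>x a\<bar> > m * w a} \<le> C / m"
  shows "\<exists>\<mu> :: ('a \<Rightarrow> real) measure.
           sets \<mu> = sets character_sigma \<and>
           (\<forall>a. integrable \<mu> (\<lambda>\<phi>. \<phi> a) \<and> L a = (\<integral>\<phi>. \<phi> a \<partial>\<mu>))"
proof -
  let ?box = "\<lambda>F m. {x :: 'a \<Rightarrow> real. \<forall>a\<in>F. \<bar>x a\<bar> \<le> real (Suc m) * w a}"
  \<comment> \<open>The boxes bound every coordinate along an ultrafilter, with one \<open>m\<close>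
    for all finite \<open>F\<close>. The sets \<open>N\<close> with complement of content zero are
    included so that the polynomial relations of the algebra hold in the limit.\<close>
  define DD where "DD m = {N \<inter> ?box F m | F N. finite F \<and> content (- N) = 0}"
    for m
  define \<delta> where "\<delta> m = C * (1 / real (Suc m))" for m
  have DD_I: "finite F \<Longrightarrow> content (- N) = 0 \<Longrightarrow> N \<inter> ?box F m \<in> DD m" for F N m
    unfolding DD_def by blast
  have DD_E: thesis
    if "M \<in> DD m" "\<And>F N. finite F \<Longrightarrow> content (- N) = 0 \<Longrightarrow>
      M = N \<inter> ?box F m \<Longrightarrow> thesis" for M m thesis
    using that(1) unfolding DD_def by (elim CollectE exE conjE) (rule that(2))
  have content_empty: "content {} = 0" using content_additive[of "{}" "{}"] by simp
  have inter: "M \<inter> N \<in> DD m" if "M \<in> DD m" "N \<in> DD m" for M N m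
  proof -
    obtain F A where F: "finite F" "content (- A) = 0" "M = A \<inter> ?box F m"
      using DD_E[OF \<open>M \<in> DD m\<close>] .
    obtain G B where G: "finite G" "content (- B) = 0" "N = B \<inter> ?box G m"
      using DD_E[OF \<open>N \<in> DD m\<close>] .
    have "content (- (A \<inter> B)) \<le> 0"
      using content_union_le[of "- A" "- B"] F(2) G(2) by (simp add: Compl_Int)
    then have "content (- (A \<inter> B)) = 0" using content_nonneg by (rule antisym)
    moreover have "M \<inter> N = (A \<inter> B) \<inter> ?box (F \<union> G) m"
      unfolding F(3) G(3) by auto
    ultimately show ?thesis using DD_I[of "F \<union> G" "A \<inter> B" m] F(1) G(1) by (simp only: finite_Un simp_thms)
  qed
  have nonempty: "DD m \<noteq> {}" for m
    using DD_I[of "{}" UNIV m] content_empty by auto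
  have compl: "content (- M) \<le> \<delta> m" if "M \<in> DD m" for M m
  proof -
    obtain F A where F: "finite F" "content (- A) = 0" "M = A \<inter> ?box F m"
      using DD_E[OF \<open>M \<in> DD m\<close>] .
    have "- M = - A \<union> {x. \<exists>a\<in>F. \<bar>x a\<bar> > real (Suc m) * w a}" unfolding F(3) by (auto simp: not_le)
    then have "content (- M) \<le> content {x. \<exists>a\<in>F. \<bar>x a\<bar> > real (Suc m) * w a}"
      using content_union_le[of "- A"] F(2) by simp
    also have "\<dots> \<le> C / real (Suc m)" by (rule w_tight[OF F(1)]) simp
    finally show ?thesis by (simp add: \<delta>_def)
  qed
  have \<delta>_lim: "\<delta> \<longlonglongrightarrow> 0"
    unfolding \<delta>_def[abs_def] using tendsto_mult[OF tendsto_const LIMSEQ_inverse_real_of_nat, of C]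
    by (simp add: inverse_eq_divide)
  have tc: "tight_content content DD \<delta>"
    by unfold_locales (fact content_additive content_nonneg inter nonempty compl \<delta>_lim)+
  obtain P where P: "space P = tight_content.S DD" "\<And>M. tight_content.cyl DD M \<in> sets P"
    "\<And>M. emeasure P (tight_content.cyl DD M) = ennreal (content M)"
    using tight_content.measure_exists[OF tc] by blast
  interpret tight_functional poly_value Q "L 1" DD \<delta> P
    by unfold_locales (fact inter nonempty compl \<delta>_lim P)+
  define \<Phi> where "\<Phi> U a = Lim U (\<lambda>x. x a)" for U :: "('a \<Rightarrow> real) filter" and a
  have ev: "\<exists>m. eventually (\<lambda>x. x \<in> N \<inter> ?box F m) U"
    if "U \<in> S" "finite F" "content (- N) = 0" for U F N
  proof -
    obtain m where m: "\<forall>M\<in>DD m. eventually (\<lambda>x. x \<in> M) U"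
      using \<open>U \<in> S\<close> unfolding S_def by blast
    show ?thesis by (rule exI[of _ m], rule bspec[OF m], rule DD_I[OF that(2,3)])
  qed
  have lim: "((\<lambda>x. x a) \<longlongrightarrow> \<Phi> U a) U" if U: "U \<in> S" for U a
  proof -
    obtain m where m: "eventually (\<lambda>x. x \<in> UNIV \<inter> ?box {a} m) U"
      using ev[OF U, of "{a}" UNIV] content_empty by auto
    show ?thesis unfolding \<Phi>_def
      by (rule ultrafilter_tendsto[OF S_ultrafilter[OF U] eventually_mono[OF m]]) simp
  qed
  \<comment> \<open>As \<open>L (0 * 0) = 0\<close>, Chebyshev's inequality puts
    \<open>\<bar>g x\<bar> > e / 2\<close> into a set of content zero, which no ultrafilter in
    \<open>S\<close> contains.\<close>
  have null: "(g \<longlongrightarrow> 0) U" if U: "U \<in> S" and g: "polyrel UNIV 0 g" for U g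
  proof (rule tendstoI)
    fix e :: real assume e: "e > 0"
    have "- {x. \<bar>g x\<bar> \<le> e / 2} = {x. \<bar>g x\<bar> > e / 2}" by auto
    then have "content (- {x. \<bar>g x\<bar> \<le> e / 2}) \<le> 0"
      using content_square_le[OF g, of "e / 2"] e by (simp add: L_simps)
    then have "content (- {x. \<bar>g x\<bar> \<le> e / 2}) = 0" using content_nonneg by (rule antisym)
    from ev[OF U finite.emptyI this]
    obtain m where m: "eventually (\<lambda>x. x \<in> {x. \<bar>g x\<bar> \<le> e / 2} \<inter> ?box {} m) U" ..
    show "eventually (\<lambda>x. dist (g x) 0 < e) U"
      by (rule eventually_mono[OF m]) (use e in auto)
  qed
  have gen: "polyrel UNIV a (\<lambda>x. x a)" for a :: 'a by (rule polyrel.gen) simp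
  have neg: "polyrel UNIV a g \<Longrightarrow> polyrel UNIV (- 1 *\<^sub>R a) (\<lambda>x. - 1 * g x)" for a :: 'a and g
    by (rule polyrel_scaleR)
  have char: "\<Phi> U \<in> characters" if U: "U \<in> S" for U
  proof -
    note unique = tendsto_unique[OF S_not_bot[OF U] _ null[OF U]]
    have 1: "\<Phi> U a + \<Phi> U b + - 1 * \<Phi> U (a + b) = 0" for a b
    proof (rule unique)
      show "((\<lambda>x. x a + x b + - 1 * x (a + b)) \<longlongrightarrow> \<Phi> U a + \<Phi> U b + - 1 * \<Phi> U (a + b)) U"
        by (intro tendsto_intros lim U)
      have "polyrel UNIV (a + b + - 1 *\<^sub>R (a + b)) (\<lambda>x. x a + x b + - 1 * x (a + b))"
        by (intro polyrel.add neg gen)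
      then show "polyrel UNIV 0 (\<lambda>x. x a + x b + - 1 * x (a + b))" by simp
    qed
    have 2: "c * \<Phi> U a + - 1 * \<Phi> U (c *\<^sub>R a) = 0" for a c
    proof (rule unique)
      show "((\<lambda>x. c * x a + - 1 * x (c *\<^sub>R a)) \<longlongrightarrow> c * \<Phi> U a + - 1 * \<Phi> U (c *\<^sub>R a)) U"
        by (intro tendsto_intros lim U)
      have "polyrel UNIV (c *\<^sub>R a + - 1 *\<^sub>R (c *\<^sub>R a)) (\<lambda>x. c * x a + - 1 * x (c *\<^sub>R a))"
        by (intro polyrel.add neg gen polyrel_scaleR)
      then show "polyrel UNIV 0 (\<lambda>x. c * x a + - 1 * x (c *\<^sub>R a))" by simp
    qed
    have 3: "\<Phi> U a * \<Phi> U b + - 1 * \<Phi> U (a * b) = 0" for a b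
    proof (rule unique)
      show "((\<lambda>x. x a * x b + - 1 * x (a * b)) \<longlongrightarrow> \<Phi> U a * \<Phi> U b + - 1 * \<Phi> U (a * b)) U"
        by (intro tendsto_intros lim U)
      have "polyrel UNIV (a * b + - 1 *\<^sub>R (a * b)) (\<lambda>x. x a * x b + - 1 * x (a * b))"
        by (intro polyrel.add polyrel.mult neg gen)
      then show "polyrel UNIV 0 (\<lambda>x. x a * x b + - 1 * x (a * b))" by simp
    qed
    have 4: "\<Phi> U 1 + - 1 = 0"
    proof (rule unique)
      show "((\<lambda>x. x 1 + - 1) \<longlongrightarrow> \<Phi> U 1 + - 1) U" by (intro tendsto_intros lim U)
      have "polyrel UNIV (1 + - 1 *\<^sub>R 1 :: 'a) (\<lambda>x. x 1 + - 1)"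
        by (intro polyrel.add polyrel.const gen)
      then show "polyrel UNIV (0 :: 'a) (\<lambda>x. x 1 + - 1)" by simp
    qed
    have "linear (\<Phi> U)"
    proof (rule linearI)
      show "\<Phi> U (a + b) = \<Phi> U a + \<Phi> U b" for a b using 1[of a b] by simp
      show "\<Phi> U (c *\<^sub>R a) = c *\<^sub>R \<Phi> U a" for c a using 2[of c a] by simp
    qed
    moreover have "\<Phi> U (a * b) = \<Phi> U a * \<Phi> U b" for a b using 3[of a b] by simp
    moreover have "\<Phi> U 1 = 1" using 4 by simp
    ultimately show ?thesis by (simp add: characters_def)
  qed
  have var: "(\<lambda>U. Lim U (\<lambda>x. x a)) \<in> borel_measurable P"
    "integrable P (\<lambda>U. Lim U (\<lambda>x. x a))" "(\<integral>U. Lim U (\<lambda>x. x a) \<partial>P) = L a" for a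
  proof -
    have l: "((\<lambda>x. x a) \<longlongrightarrow> Lim U (\<lambda>x. x a)) U" if "U \<in> S" for U
      using lim[OF that, of a] unfolding \<Phi>_def .
    show "(\<lambda>U. Lim U (\<lambda>x. x a)) \<in> borel_measurable P" by (rule Lim_measurable[OF l])
    have sq: "(\<lambda>x. (x a)\<^sup>2) \<in> D" using poly_square[OF gen] by blast
    show "integrable P (\<lambda>U. Lim U (\<lambda>x. x a))" by (rule integral_square_dominated(1)[OF l sq])
    show "(\<integral>U. Lim U (\<lambda>x. x a) \<partial>P) = L a"
      using integral_square_dominated(2)[OF l sq] Q_poly[OF gen] by simp
  qed
  have meas: "\<Phi> \<in> measurable P character_sigma"
    unfolding character_sigma_def
  proof (rule measurable_measure_of)
    show "\<Phi> \<in> space P \<rightarrow> characters" using char by (simp add: P_space)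
    fix Y :: "('a \<Rightarrow> real) set" assume "Y \<in> {(\<lambda>\<phi>. \<phi> a) -` A \<inter> characters | a A. A \<in> sets (borel :: real measure)}"
    then obtain a A where Y: "Y = (\<lambda>\<phi>. \<phi> a) -` A \<inter> characters" "A \<in> sets borel" by blast
    have "\<Phi> -` Y \<inter> space P = (\<lambda>U. Lim U (\<lambda>x. x a)) -` A \<inter> space P"
      using char by (auto simp: Y(1) P_space \<Phi>_def[abs_def])
    then show "\<Phi> -` Y \<inter> space P \<in> sets P"
      using measurable_sets[OF var(1) Y(2)] by simp
  qed auto
  have "integrable (distr P character_sigma \<Phi>) (\<lambda>\<phi>. \<phi> a) \<and> L a = (\<integral>\<phi>. \<phi> a \<partial>distr P character_sigma \<Phi>)" for a
    using var[of a]
    by (simp add: integrable_distr_eq[OF meas evaluation_measurable] integral_distr[OF meas evaluation_measurable] \<Phi>_def)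
  then show ?thesis by (intro exI[of _ "distr P character_sigma \<Phi>"]) simp
qed

end

text \<open>A character is itself a point of the function space, and one at which polynomial
  relations are respected; hence \<open>g \<ge> 0\<close> puts \<open>a\<close> into
  \<open>pos_cone\<close>.\<close>

lemma polyrel_character:
  "polyrel UNIV a g \<Longrightarrow> \<phi> \<in> characters \<Longrightarrow> \<phi> a = g \<phi>"
  by (induction rule: polyrel.induct)
    (auto simp: characters_def linear_add linear_scale)

theorem theorem15:
  fixes T :: "'a::{real_algebra, comm_monoid_mult} topology"
    and L :: "'a \<Rightarrow> real"
  assumes "locally_convex_topology T"
    and "nuclear T"
    and "barrelled T"
    and "separately_continuous_mult T"
    and "linear L"
    and "continuous_map T euclideanreal L"
    and "(\<forall>a\<in>pos_cone. L a \<ge> 0) \<or>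
         ((\<forall>a. L (a ^ 2) \<ge> 0) \<and>
          (\<exists>B. independent B \<and> span B = UNIV \<and> (\<forall>t\<in>B. carleman L t)))"
  shows "\<exists>\<mu> :: ('a \<Rightarrow> real) measure.
           sets \<mu> = sets character_sigma \<and>
           (\<forall>a. integrable \<mu> (\<lambda>\<phi>. \<phi> a) \<and> L a = (\<integral>\<phi>. \<phi> a \<partial>\<mu>))"
proof -
  have nonneg: "L a \<ge> 0" if a: "polyrel UNIV a g" and g: "\<And>y. g y \<ge> 0" for a g
    using assms(7)
  proof
    assume "\<forall>a\<in>pos_cone. L a \<ge> 0"
    moreover have "a \<in> pos_cone"
      unfolding pos_cone_def by (intro CollectI ballI) (simp only: polyrel_character[OF a] g)
    ultimately show ?thesis by blast
  next
    assume *: "(\<forall>a. L (a ^ 2) \<ge> 0) \<and>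
          (\<exists>B. independent B \<and> span B = UNIV \<and> (\<forall>t\<in>B. carleman L t))"
    then obtain B where B: "independent B" "span B = UNIV" "\<And>t. t \<in> B \<Longrightarrow> carleman L t" by blast
    have pos: "positive_functional L"
      using * assms(5) by (intro positive_functional.intro) (auto simp: power2_eq_square)
    show ?thesis
      by (rule polyrel_nonneg[OF pos positive_functional.carleman_imp_resolvent_dense[OF pos B(3)] B(1,2) a g])
  qed
  interpret polynomially_positive L
    using assms(5) nonneg by (rule polynomially_positive.intro)
  interpret dominated_extension poly_value by (rule dominated_extension_poly_value)
  obtain Q where Q: "\<forall>F\<in>D. \<forall>G\<in>D. Q (\<lambda>x. F x + G x) = Q F + Q G"
    "\<forall>F\<in>D. \<forall>c. Q (\<lambda>x. c * F x) = c * Q F" "\<forall>F\<in>D. (\<forall>x. F x \<ge> 0) \<longrightarrow> Q F \<ge> 0"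
    "\<forall>F\<in>D. \<forall>r. poly_value F r \<longrightarrow> Q F = r"
    using positive_extension by blast
  have one: "poly_value (\<lambda>_. 1) (L 1)"
    unfolding poly_value_def using polyrel.const[of UNIV 1] by (intro exI[of _ 1]) simp
  interpret extended_functional L Q
    by unfold_locales (use Q one in auto)
  obtain q where q: "seminorm q" "nuclear_canonical_map q hnorm"
    using assms(2) continuous_hnorm[OF assms(1,3,4,6)] seminorm_hnorm
    unfolding nuclear_def by blast
  obtain C where "\<And>F m. finite F \<Longrightarrow> m > 0 \<Longrightarrow> content {x. \<exists>a\<in>F. \<bar>x a\<bar> > m * (q a + 1)} \<le> C / m"
    using tightness[OF q] by blast
  then show ?thesis by (rule representing_measure)
qed

end
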